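(* Given any non-trivial formal space $S\equiv(S,\vartriangleleft)$, the formal space $S^{**}\equiv(S,\vartriangleleft^{**})$, where $$a\vartriangleleft^{**}U\iff\{a\}^{**}\vartriangleleft U^{**},$$ cannot be proved to be set-presented in $\mathrm{CTT}^*$, $\mathrm{CZF}^*$.
   Context: Systems. CZF is Aczel's constructive set theory; CTT is Martin-Löf's constructive type theory. $\mathrm{CZF}^*$ denotes an arbitrary fixed extension of CZF consistent with the scheme GUP-CZF: for every set $I$, $(\forall x)(\exists y\in I)A(x,y)\to(\exists y\in I)(\forall x)A(x,y)$ ($x$ ranging over all sets). $\mathrm{CTT}^*$ denotes an arbitrary fixed extension of CTT consistent with GUP-CTT: for every set $I$, every $R$ mapping a proposition and an element of $I$ to a proposition, and every $F$ from propositions to $I$ with $R(P,F(P))$ for all $P$, there is $\bar i\in I$ with $R(P,\bar i)$ for all $P$. "Cannot be proved in $T$" is a metamathematical statement: for no $S$ (given by a definition in $T$) that is a non-trivial formal space in $T$ does $T$ prove that $S^{**}$ is set-presented. Formal spaces. A formal space is a pair $(S,\vartriangleleft)$ with $S$ a set and $\vartriangleleft$ a relation (a class in CZF) between elements and subsets of $S$ such that: $a\in U$ implies $a\vartriangleleft U$; $a\vartriangleleft U$ and $U\vartriangleleft V$ imply $a\vartriangleleft V$; $a\vartriangleleft U$ and $a\vartriangleleft V$ imply $a\vartriangleleft U\downarrow V$; and (in CZF) $\{a\in S:a\vartriangleleft U\}$ is a set for every $U\subseteq S$. Here $U\vartriangleleft V$ means $(\forall u\in U)\,u\vartriangleleft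 V$, $U\downarrow V\equiv\{d\in S:(\exists u\in U)\,d\vartriangleleft\{u\}\ \&\ (\exists v\in V)\,d\vartriangleleft\{v\}\}$, and $a\downarrow U$ means $\{a\}\downarrow U$. The pseudocomplement of $U\subseteq S$ is $U^*\equiv\{a\in S:a\downarrow U\vartriangleleft\emptyset\}$, and $U^{**}\equiv(U^* )^*$. $S$ is non-trivial if $\neg(S\vartriangleleft\emptyset)$. A formal space $(S,\vartriangleleft)$ is set-presented if there are families of sets $I(x)$, for $x\in S$, and $C(x,i)\subseteq S$, for $x\in S$, $i\in I(x)$, such that $a\vartriangleleft U\iff(\exists i\in I(a))\,C(a,i)\subseteq U$. *)

theory Defs
  imports Main
begin

section \<open>Intuitionistic first-order set theory\<close>

text \<open>Formulas in the language of membership and equality, with de Bruijn indices. Variables are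
  the only terms, so substitution is renaming of variables.\<close>

datatype fm =
    Mem nat nat
  | Equal nat nat
  | Falsum
  | Conj fm fm
  | Disj fm fm
  | Impl fm fm
  | Forall fm
  | Exists fm

definition up_var :: "(nat \<Rightarrow> nat) \<Rightarrow> nat \<Rightarrow> nat" where
  "up_var f = case_nat 0 (\<lambda>i. Suc (f i))"

primrec ren :: "(nat \<Rightarrow> nat) \<Rightarrow> fm \<Rightarrow> fm" where
  "ren f (Mem i j) = Mem (f i) (f j)"
| "ren f (Equal i j) = Equal (f i) (f j)"
| "ren f Falsum = Falsum"
| "ren f (Conj p q) = Conj (ren f p) (ren f q)"
| "ren f (Disj p q) = Disj (ren f p) (ren f q)"
| "ren f (Impl p q) = Impl (ren f p) (ren f q)"
| "ren f (Forall p) = Forall (ren (up_var f) p)"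
| "ren f (Exists p) = Exists (ren (up_var f) p)"

primrec free_vars :: "fm \<Rightarrow> nat set" where
  "free_vars (Mem i j) = {i, j}"
| "free_vars (Equal i j) = {i, j}"
| "free_vars Falsum = {}"
| "free_vars (Conj p q) = free_vars p \<union> free_vars q"
| "free_vars (Disj p q) = free_vars p \<union> free_vars q"
| "free_vars (Impl p q) = free_vars p \<union> free_vars q"
| "free_vars (Forall p) = {i. Suc i \<in> free_vars p}"
| "free_vars (Exists p) = {i. Suc i \<in> free_vars p}"

abbreviation inst_var :: "nat \<Rightarrow> fm \<Rightarrow> fm" where
  "inst_var t \<equiv> ren (case_nat t (\<lambda>i. i))"

text \<open>Natural deduction for intuitionistic logic with equality over a set \<open>T\<close> of axioms. Only the
  local hypotheses are shifted under a binder, not \<open>T\<close>; hence the free variables of an axiom are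
  read universally.\<close>

inductive prv :: "fm set \<Rightarrow> fm list \<Rightarrow> fm \<Rightarrow> bool" for T where
  axiom: "p \<in> T \<Longrightarrow> prv T H p"
| hyp: "p \<in> set H \<Longrightarrow> prv T H p"
| falsumE: "prv T H Falsum \<Longrightarrow> prv T H p"
| conjI: "prv T H p \<Longrightarrow> prv T H q \<Longrightarrow> prv T H (Conj p q)"
| conjE1: "prv T H (Conj p q) \<Longrightarrow> prv T H p"
| conjE2: "prv T H (Conj p q) \<Longrightarrow> prv T H q"
| disjI1: "prv T H p \<Longrightarrow> prv T H (Disj p q)"
| disjI2: "prv T H q \<Longrightarrow> prv T H (Disj p q)"
| disjE: "prv T H (Disj p q) \<Longrightarrow> prv T (p # H) r \<Longrightarrow> prv T (q # H) r \<Longrightarrow> prv T H r"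
| implI: "prv T (p # H) q \<Longrightarrow> prv T H (Impl p q)"
| implE: "prv T H (Impl p q) \<Longrightarrow> prv T H p \<Longrightarrow> prv T H q"
| forallI: "prv T (map (ren Suc) H) p \<Longrightarrow> prv T H (Forall p)"
| forallE: "prv T H (Forall p) \<Longrightarrow> prv T H (inst_var t p)"
| existsI: "prv T H (inst_var t p) \<Longrightarrow> prv T H (Exists p)"
| existsE: "prv T H (Exists p) \<Longrightarrow> prv T (p # map (ren Suc) H) (ren Suc q) \<Longrightarrow> prv T H q"
| equalI: "prv T H (Equal t t)"
| equalE: "prv T H (Equal s t) \<Longrightarrow> prv T H (inst_var s p) \<Longrightarrow> prv T H (inst_var t p)"

text \<open>Concrete formulas are written in higher-order abstract syntax. A \<open>form\<close> (a \<open>var\<close>) maps the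
  number \<open>n\<close> of binders enclosing an occurrence to the formula (the index) to be put there. Under
  \<open>n\<close> binders, the variable of the binder at depth \<open>k < n\<close> has index \<open>n - Suc k\<close>, and the \<open>p\<close>-th
  free variable has index \<open>n + p\<close>. The formula denoted by \<open>F\<close> is \<open>F 0\<close>.\<close>

type_synonym var = "nat \<Rightarrow> nat"
type_synonym form = "nat \<Rightarrow> fm"

definition fmem :: "var \<Rightarrow> var \<Rightarrow> form" (infix "\<^bold>\<in>" 50) where
  "(x \<^bold>\<in> y) = (\<lambda>n. Mem (x n) (y n))"

definition feq :: "var \<Rightarrow> var \<Rightarrow> form" (infix "\<^bold>=" 50) where
  "(x \<^bold>= y) = (\<lambda>n. Equal (x n) (y n))"

definition ffalse :: form ("\<^bold>\<bottom>") where
  "\<^bold>\<bottom> = (\<lambda>n. Falsum)"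

definition fand :: "form \<Rightarrow> form \<Rightarrow> form" (infixr "\<^bold>\<and>" 35) where
  "(P \<^bold>\<and> Q) = (\<lambda>n. Conj (P n) (Q n))"

definition f_or :: "form \<Rightarrow> form \<Rightarrow> form" (infixr "\<^bold>\<or>" 30) where
  "(P \<^bold>\<or> Q) = (\<lambda>n. Disj (P n) (Q n))"

definition fimp :: "form \<Rightarrow> form \<Rightarrow> form" (infixr "\<^bold>\<longrightarrow>" 25) where
  "(P \<^bold>\<longrightarrow> Q) = (\<lambda>n. Impl (P n) (Q n))"

definition fiff :: "form \<Rightarrow> form \<Rightarrow> form" (infixr "\<^bold>\<longleftrightarrow>" 25) where
  "(P \<^bold>\<longleftrightarrow> Q) = ((P \<^bold>\<longrightarrow> Q) \<^bold>\<and> (Q \<^bold>\<longrightarrow> P))"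

definition fnot :: "form \<Rightarrow> form" ("\<^bold>\<not> _" [40] 40) where
  "(\<^bold>\<not> P) = (P \<^bold>\<longrightarrow> \<^bold>\<bottom>)"

definition fall :: "(var \<Rightarrow> form) \<Rightarrow> form" (binder "\<^bold>\<forall>" 10) where
  "fall F = (\<lambda>n. Forall (F (\<lambda>m. m - Suc n) (Suc n)))"

definition fex :: "(var \<Rightarrow> form) \<Rightarrow> form" (binder "\<^bold>\<exists>" 10) where
  "fex F = (\<lambda>n. Exists (F (\<lambda>m. m - Suc n) (Suc n)))"

text \<open>\<open>inst p [x, y]\<close> is \<open>p\<close> with \<open>x\<close> and \<open>y\<close> for its free variables 0 and 1; the remaining free
  variables of \<open>p\<close> (its parameters) become the free variables 0, 1, ... of the result.\<close>

definition inst :: "fm \<Rightarrow> var list \<Rightarrow> form" where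
  "inst p xs =
    (\<lambda>n. ren (\<lambda>i. if i < length xs then (xs ! i) n else n + (i - length xs)) p)"


section \<open>CZF\<close>

definition is_empty :: "var \<Rightarrow> form" where
  "is_empty x = (\<^bold>\<forall>z. \<^bold>\<not> (z \<^bold>\<in> x))"

definition is_succ :: "var \<Rightarrow> var \<Rightarrow> form" where
  "is_succ y x = (\<^bold>\<forall>z. z \<^bold>\<in> y \<^bold>\<longleftrightarrow> (z \<^bold>\<in> x \<^bold>\<or> z \<^bold>= x))"

definition subseteq :: "var \<Rightarrow> var \<Rightarrow> form" where
  "subseteq x y = (\<^bold>\<forall>z. z \<^bold>\<in> x \<^bold>\<longrightarrow> z \<^bold>\<in> y)"

inductive bounded_fm :: "fm \<Rightarrow> bool" where
  "bounded_fm (Mem i j)"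
| "bounded_fm (Equal i j)"
| "bounded_fm Falsum"
| "bounded_fm p \<Longrightarrow> bounded_fm q \<Longrightarrow> bounded_fm (Conj p q)"
| "bounded_fm p \<Longrightarrow> bounded_fm q \<Longrightarrow> bounded_fm (Disj p q)"
| "bounded_fm p \<Longrightarrow> bounded_fm q \<Longrightarrow> bounded_fm (Impl p q)"
| "bounded_fm p \<Longrightarrow> bounded_fm (Forall (Impl (Mem 0 (Suc i)) p))"
| "bounded_fm p \<Longrightarrow> bounded_fm (Exists (Conj (Mem 0 (Suc i)) p))"

definition extensionality :: form where
  "extensionality = (\<^bold>\<forall>x. \<^bold>\<forall>y. (\<^bold>\<forall>z. z \<^bold>\<in> x \<^bold>\<longleftrightarrow> z \<^bold>\<in> y) \<^bold>\<longrightarrow> x \<^bold>= y)"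

definition pairing :: form where
  "pairing = (\<^bold>\<forall>x. \<^bold>\<forall>y. \<^bold>\<exists>z. x \<^bold>\<in> z \<^bold>\<and> y \<^bold>\<in> z)"

definition union :: form where
  "union = (\<^bold>\<forall>x. \<^bold>\<exists>y. \<^bold>\<forall>z. z \<^bold>\<in> y \<^bold>\<longleftrightarrow> (\<^bold>\<exists>w. w \<^bold>\<in> x \<^bold>\<and> z \<^bold>\<in> w))"

definition strong_infinity :: form where
  "strong_infinity =
    (\<^bold>\<exists>a. \<^bold>\<forall>x. x \<^bold>\<in> a \<^bold>\<longleftrightarrow> (is_empty x \<^bold>\<or> (\<^bold>\<exists>y. y \<^bold>\<in> a \<^bold>\<and> is_succ x y)))"

definition set_induction :: "fm \<Rightarrow> form" where
  "set_induction p =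
    ((\<^bold>\<forall>a. (\<^bold>\<forall>x. x \<^bold>\<in> a \<^bold>\<longrightarrow> inst p [x]) \<^bold>\<longrightarrow> inst p [a]) \<^bold>\<longrightarrow> (\<^bold>\<forall>a. inst p [a]))"

definition separation :: "fm \<Rightarrow> form" where
  "separation p = (\<^bold>\<forall>a. \<^bold>\<exists>b. \<^bold>\<forall>x. x \<^bold>\<in> b \<^bold>\<longleftrightarrow> (x \<^bold>\<in> a \<^bold>\<and> inst p [x]))"

definition strong_collection :: "fm \<Rightarrow> form" where
  "strong_collection p =
    (\<^bold>\<forall>a. (\<^bold>\<forall>x. x \<^bold>\<in> a \<^bold>\<longrightarrow> (\<^bold>\<exists>y. inst p [x, y])) \<^bold>\<longrightarrow>
      (\<^bold>\<exists>b. (\<^bold>\<forall>x. x \<^bold>\<in> a \<^bold>\<longrightarrow> (\<^bold>\<exists>y. y \<^bold>\<in> b \<^bold>\<and> inst p [x, y])) \<^bold>\<and>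
           (\<^bold>\<forall>y. y \<^bold>\<in> b \<^bold>\<longrightarrow> (\<^bold>\<exists>x. x \<^bold>\<in> a \<^bold>\<and> inst p [x, y]))))"

definition subset_collection :: "fm \<Rightarrow> form" where
  "subset_collection p =
    (\<^bold>\<forall>a. \<^bold>\<forall>b. \<^bold>\<exists>c. \<^bold>\<forall>u. (\<^bold>\<forall>x. x \<^bold>\<in> a \<^bold>\<longrightarrow> (\<^bold>\<exists>y. y \<^bold>\<in> b \<^bold>\<and> inst p [x, y, u])) \<^bold>\<longrightarrow>
      (\<^bold>\<exists>d. d \<^bold>\<in> c \<^bold>\<and>
        (\<^bold>\<forall>x. x \<^bold>\<in> a \<^bold>\<longrightarrow> (\<^bold>\<exists>y. y \<^bold>\<in> d \<^bold>\<and> inst p [x, y, u])) \<^bold>\<and>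
        (\<^bold>\<forall>y. y \<^bold>\<in> d \<^bold>\<longrightarrow> (\<^bold>\<exists>x. x \<^bold>\<in> a \<^bold>\<and> inst p [x, y, u]))))"

definition CZF :: "fm set" where
  "CZF = {extensionality 0, pairing 0, union 0, strong_infinity 0}
    \<union> {set_induction p 0 | p. True}
    \<union> {separation p 0 | p. bounded_fm p}
    \<union> {strong_collection p 0 | p. True}
    \<union> {subset_collection p 0 | p. True}"

definition GUP_CZF :: "fm set" where
  "GUP_CZF = {(\<^bold>\<forall>I. (\<^bold>\<forall>x. \<^bold>\<exists>y. y \<^bold>\<in> I \<^bold>\<and> inst p [x, y]) \<^bold>\<longrightarrow>
    (\<^bold>\<exists>y. y \<^bold>\<in> I \<^bold>\<and> (\<^bold>\<forall>x. inst p [x, y]))) 0 | p. True}"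

definition consistent_CZF_ext :: "fm set \<Rightarrow> bool" where
  "consistent_CZF_ext T \<longleftrightarrow> \<not> prv T [] Falsum"


section \<open>Formal spaces in CZF\<close>

definition is_upair :: "var \<Rightarrow> var \<Rightarrow> var \<Rightarrow> form" where
  "is_upair p x y = (\<^bold>\<forall>z. z \<^bold>\<in> p \<^bold>\<longleftrightarrow> (z \<^bold>= x \<^bold>\<or> z \<^bold>= y))"

definition is_pair :: "var \<Rightarrow> var \<Rightarrow> var \<Rightarrow> form" where
  "is_pair p x y = (\<^bold>\<exists>u. \<^bold>\<exists>v. is_upair u x x \<^bold>\<and> is_upair v x y \<^bold>\<and> is_upair p u v)"

definition maps_to :: "var \<Rightarrow> var \<Rightarrow> var \<Rightarrow> form" where
  "maps_to f x y = (\<^bold>\<exists>p. p \<^bold>\<in> f \<^bold>\<and> is_pair p x y)"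

text \<open>\<open>f\<close> is a function with domain \<open>d\<close>.\<close>

definition is_function :: "var \<Rightarrow> var \<Rightarrow> form" where
  "is_function f d =
    ((\<^bold>\<forall>p. p \<^bold>\<in> f \<^bold>\<longrightarrow> (\<^bold>\<exists>x. \<^bold>\<exists>y. x \<^bold>\<in> d \<^bold>\<and> is_pair p x y)) \<^bold>\<and>
     (\<^bold>\<forall>x. x \<^bold>\<in> d \<^bold>\<longrightarrow> (\<^bold>\<exists>y. maps_to f x y \<^bold>\<and> (\<^bold>\<forall>z. maps_to f x z \<^bold>\<longrightarrow> z \<^bold>= y))))"

text \<open>A class is given by its membership condition; a cover relates elements to classes. The cover
  defined by a formula \<open>\<delta>(a, U)\<close> relates \<open>a\<close> to a class \<open>K\<close> when \<open>K\<close> is a set \<open>W\<close> with \<open>\<delta>(a, W)\<close>.\<close>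

type_synonym cls = "var \<Rightarrow> form"
type_synonym cover = "var \<Rightarrow> cls \<Rightarrow> form"

definition cover_of :: "fm \<Rightarrow> cover" where
  "cover_of \<delta> a K = (\<^bold>\<exists>W. (\<^bold>\<forall>x. x \<^bold>\<in> W \<^bold>\<longleftrightarrow> K x) \<^bold>\<and> inst \<delta> [a, W])"

definition set_cls :: "var \<Rightarrow> cls" where
  "set_cls U = (\<lambda>x. x \<^bold>\<in> U)"

definition empty_cls :: cls where
  "empty_cls = (\<lambda>x. \<^bold>\<bottom>)"

definition single_cls :: "var \<Rightarrow> cls" where
  "single_cls a = (\<lambda>x. x \<^bold>= a)"

definition covers :: "cover \<Rightarrow> cls \<Rightarrow> cls \<Rightarrow> form" where
  "covers C K L = (\<^bold>\<forall>u. K u \<^bold>\<longrightarrow> C u L)"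

definition down_cls :: "var \<Rightarrow> cover \<Rightarrow> cls \<Rightarrow> cls \<Rightarrow> cls" where
  "down_cls S C K L =
    (\<lambda>d. d \<^bold>\<in> S \<^bold>\<and> (\<^bold>\<exists>u. K u \<^bold>\<and> C d (single_cls u)) \<^bold>\<and> (\<^bold>\<exists>v. L v \<^bold>\<and> C d (single_cls v)))"

definition pseudocompl :: "var \<Rightarrow> cover \<Rightarrow> cls \<Rightarrow> cls" where
  "pseudocompl S C K =
    (\<lambda>a. a \<^bold>\<in> S \<^bold>\<and> covers C (down_cls S C (single_cls a) K) empty_cls)"

definition formal_space :: "var \<Rightarrow> cover \<Rightarrow> form" where
  "formal_space S C =
    ((\<^bold>\<forall>a. \<^bold>\<forall>U. a \<^bold>\<in> S \<^bold>\<longrightarrow> subseteq U S \<^bold>\<longrightarrow> a \<^bold>\<in> U \<^bold>\<longrightarrow> C a (set_cls U)) \<^bold>\<and>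
     (\<^bold>\<forall>a. \<^bold>\<forall>U. \<^bold>\<forall>V. a \<^bold>\<in> S \<^bold>\<longrightarrow> subseteq U S \<^bold>\<longrightarrow> subseteq V S \<^bold>\<longrightarrow>
        C a (set_cls U) \<^bold>\<longrightarrow> covers C (set_cls U) (set_cls V) \<^bold>\<longrightarrow> C a (set_cls V)) \<^bold>\<and>
     (\<^bold>\<forall>a. \<^bold>\<forall>U. \<^bold>\<forall>V. a \<^bold>\<in> S \<^bold>\<longrightarrow> subseteq U S \<^bold>\<longrightarrow> subseteq V S \<^bold>\<longrightarrow>
        C a (set_cls U) \<^bold>\<longrightarrow> C a (set_cls V) \<^bold>\<longrightarrow>
        C a (down_cls S C (set_cls U) (set_cls V))) \<^bold>\<and>
     (\<^bold>\<forall>U. subseteq U S \<^bold>\<longrightarrow>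
        (\<^bold>\<exists>W. \<^bold>\<forall>a. a \<^bold>\<in> W \<^bold>\<longleftrightarrow> (a \<^bold>\<in> S \<^bold>\<and> C a (set_cls U)))))"

definition nontrivial :: "var \<Rightarrow> cover \<Rightarrow> form" where
  "nontrivial S C = (\<^bold>\<not> covers C (set_cls S) empty_cls)"

definition dneg_cover :: "var \<Rightarrow> cover \<Rightarrow> cover" where
  "dneg_cover S C a K =
    covers C (pseudocompl S C (pseudocompl S C (single_cls a)))
             (pseudocompl S C (pseudocompl S C K))"

text \<open>The families \<open>I\<close> and \<open>F\<close> (for \<open>C(x, i)\<close>) are functions with domains \<open>S\<close> and
  \<open>D = {(x, i). x \<in> S, i \<in> I(x)}\<close>.\<close>

definition set_presented :: "var \<Rightarrow> cover \<Rightarrow> form" where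
  "set_presented S C =
    (\<^bold>\<exists>I. \<^bold>\<exists>D. \<^bold>\<exists>F. is_function I S \<^bold>\<and>
      (\<^bold>\<forall>p. p \<^bold>\<in> D \<^bold>\<longleftrightarrow>
        (\<^bold>\<exists>x. \<^bold>\<exists>A. \<^bold>\<exists>i. x \<^bold>\<in> S \<^bold>\<and> maps_to I x A \<^bold>\<and> i \<^bold>\<in> A \<^bold>\<and> is_pair p x i)) \<^bold>\<and>
      is_function F D \<^bold>\<and>
      (\<^bold>\<forall>p. \<^bold>\<forall>V. maps_to F p V \<^bold>\<longrightarrow> subseteq V S) \<^bold>\<and>
      (\<^bold>\<forall>a. \<^bold>\<forall>U. a \<^bold>\<in> S \<^bold>\<longrightarrow> subseteq U S \<^bold>\<longrightarrow>
        (C a (set_cls U) \<^bold>\<longleftrightarrow>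
          (\<^bold>\<exists>A. \<^bold>\<exists>i. \<^bold>\<exists>p. \<^bold>\<exists>V. maps_to I a A \<^bold>\<and> i \<^bold>\<in> A \<^bold>\<and> is_pair p a i \<^bold>\<and> maps_to F p V \<^bold>\<and>
            subseteq V U))))"

text \<open>\<open>T\<close> proves that there is a unique set satisfying \<open>\<sigma>\<close> and that it has the property \<open>P\<close>.\<close>

definition proves_of :: "fm set \<Rightarrow> fm \<Rightarrow> (var \<Rightarrow> form) \<Rightarrow> bool" where
  "proves_of T \<sigma> P \<longleftrightarrow>
    prv T [] ((\<^bold>\<exists>S. inst \<sigma> [S] \<^bold>\<and> (\<^bold>\<forall>X. inst \<sigma> [X] \<^bold>\<longrightarrow> X \<^bold>= S) \<^bold>\<and> P S) 0)"


section \<open>Martin-Loef type theory in its logical framework\<close>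

text \<open>The monomorphic theory: types are \<open>Set\<close>, \<open>El A\<close> and dependent function types; the sets are
  given by typed constants and definitional equalities. \<open>Fin n\<close> is the set with the \<open>n\<close> elements
  \<open>Elt n 0, ..., Elt n (n - 1)\<close>; \<open>Univ n\<close> is the \<open>n\<close>-th universe, with decoding \<open>Dec n\<close>.\<close>

datatype prim =
    PI | LAMBDA | FUNSPLIT
  | SIG | PAIR | SPLIT
  | PLUS | INL | INR | WHEN
  | ID | REFL | IDPEEL
  | Fin nat | Elt nat nat | Case nat
  | NAT | ZERO | SUCC | NATREC
  | LIST | NIL | CONS | LISTREC
  | W | WSUP | WREC
  | Univ nat | Dec nat
  | CPi nat | CSigma nat | CPlus nat | CId nat | CFin nat nat | CNat nat | CList nat | CW nat
  | CUniv nat | CLift nat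

text \<open>\<open>Ext k\<close> are the constants available to extensions; the last two are the ones of the
  generalized uniformity principle.\<close>

datatype con = Prim prim | Ext nat | GUP_point | GUP_proof

datatype tm = Var nat | Const con | App tm tm | Lam tm

datatype ty = TSet | TEl tm | TFun ty ty

primrec ren_tm :: "(nat \<Rightarrow> nat) \<Rightarrow> tm \<Rightarrow> tm" where
  "ren_tm f (Var i) = Var (f i)"
| "ren_tm f (Const c) = Const c"
| "ren_tm f (App a b) = App (ren_tm f a) (ren_tm f b)"
| "ren_tm f (Lam a) = Lam (ren_tm (up_var f) a)"

definition up_tm :: "(nat \<Rightarrow> tm) \<Rightarrow> nat \<Rightarrow> tm" where
  "up_tm s = case_nat (Var 0) (\<lambda>i. ren_tm Suc (s i))"

primrec subst_tm :: "(nat \<Rightarrow> tm) \<Rightarrow> tm \<Rightarrow> tm" where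
  "subst_tm s (Var i) = s i"
| "subst_tm s (Const c) = Const c"
| "subst_tm s (App a b) = App (subst_tm s a) (subst_tm s b)"
| "subst_tm s (Lam a) = Lam (subst_tm (up_tm s) a)"

primrec subst_ty :: "(nat \<Rightarrow> tm) \<Rightarrow> ty \<Rightarrow> ty" where
  "subst_ty s TSet = TSet"
| "subst_ty s (TEl a) = TEl (subst_tm s a)"
| "subst_ty s (TFun A B) = TFun (subst_ty s A) (subst_ty (up_tm s) B)"

primrec free_vars_tm :: "tm \<Rightarrow> nat set" where
  "free_vars_tm (Var i) = {i}"
| "free_vars_tm (Const c) = {}"
| "free_vars_tm (App a b) = free_vars_tm a \<union> free_vars_tm b"
| "free_vars_tm (Lam a) = {i. Suc i \<in> free_vars_tm a}"

definition closed_tm :: "tm \<Rightarrow> bool" where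
  "closed_tm a \<longleftrightarrow> free_vars_tm a = {}"

abbreviation weaken :: "nat \<Rightarrow> ty \<Rightarrow> ty" where
  "weaken k \<equiv> subst_ty (\<lambda>i. Var (i + k))"

abbreviation sub1 :: "tm \<Rightarrow> nat \<Rightarrow> tm" where
  "sub1 a \<equiv> case_nat a Var"

text \<open>The type of the variable with index \<open>i\<close> is the \<open>i\<close>-th entry of the context, which lives over
  the entries after it.\<close>

type_synonym ctx = "ty list"

datatype stmt =
    Wf
  | IsType ty
  | EqType ty ty
  | HasType tm ty
  | EqTerm tm tm ty

primrec subst_stmt :: "(nat \<Rightarrow> tm) \<Rightarrow> stmt \<Rightarrow> stmt" where
  "subst_stmt s Wf = Wf"
| "subst_stmt s (IsType A) = IsType (subst_ty s A)"
| "subst_stmt s (EqType A B) = EqType (subst_ty s A) (subst_ty s B)"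
| "subst_stmt s (HasType a A) = HasType (subst_tm s a) (subst_ty s A)"
| "subst_stmt s (EqTerm a b A) = EqTerm (subst_tm s a) (subst_tm s b) (subst_ty s A)"

type_synonym judgement = "ctx \<times> stmt"

type_synonym rule = "judgement list \<times> judgement"

text \<open>Concrete terms and types in higher-order abstract syntax, as for formulas.\<close>

type_synonym term_b = "nat \<Rightarrow> tm"
type_synonym type_b = "nat \<Rightarrow> ty"

definition bound :: "nat \<Rightarrow> term_b" where
  "bound k = (\<lambda>n. Var (n - Suc k))"

definition tapp :: "term_b \<Rightarrow> term_b \<Rightarrow> term_b" (infixl "\<cdot>" 200) where
  "a \<cdot> b = (\<lambda>n. App (a n) (b n))"

definition tlam :: "(term_b \<Rightarrow> term_b) \<Rightarrow> term_b" (binder "\<^bold>\<lambda>" 10) where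
  "tlam f = (\<lambda>n. Lam (f (bound n) (Suc n)))"

definition cn :: "prim \<Rightarrow> term_b" where
  "cn c = (\<lambda>n. Const (Prim c))"

definition SET :: type_b where
  "SET = (\<lambda>n. TSet)"

definition El :: "term_b \<Rightarrow> type_b" where
  "El a = (\<lambda>n. TEl (a n))"

definition Fun :: "type_b \<Rightarrow> (term_b \<Rightarrow> type_b) \<Rightarrow> type_b" where
  "Fun A B = (\<lambda>n. TFun (A n) (B (bound n) (Suc n)))"

syntax "_Fun" :: "pttrn \<Rightarrow> type_b \<Rightarrow> type_b \<Rightarrow> type_b"  ("(3\<^bold>\<Pi>_\<^bold>:_./ _)" [0, 0, 10] 10)
translations "\<^bold>\<Pi>x\<^bold>:A. B" \<rightleftharpoons> "CONST Fun A (\<lambda>x. B)"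

definition arrow :: "type_b \<Rightarrow> type_b \<Rightarrow> type_b" (infixr "\<^bold>\<rightarrow>" 25) where
  "(A \<^bold>\<rightarrow> B) = (\<^bold>\<Pi>x\<^bold>:A. B)"

fun prim_type :: "prim \<Rightarrow> type_b" where
  "prim_type PI = (\<^bold>\<Pi>A\<^bold>:SET. (El A \<^bold>\<rightarrow> SET) \<^bold>\<rightarrow> SET)"
| "prim_type LAMBDA =
    (\<^bold>\<Pi>A\<^bold>:SET. \<^bold>\<Pi>B\<^bold>:(El A \<^bold>\<rightarrow> SET). (\<^bold>\<Pi>x\<^bold>:El A. El (B \<cdot> x)) \<^bold>\<rightarrow> El (cn PI \<cdot> A \<cdot> B))"
| "prim_type FUNSPLIT =
    (\<^bold>\<Pi>A\<^bold>:SET. \<^bold>\<Pi>B\<^bold>:(El A \<^bold>\<rightarrow> SET). \<^bold>\<Pi>C\<^bold>:(El (cn PI \<cdot> A \<cdot> B) \<^bold>\<rightarrow> SET).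
      (\<^bold>\<Pi>y\<^bold>:(\<^bold>\<Pi>x\<^bold>:El A. El (B \<cdot> x)). El (C \<cdot> (cn LAMBDA \<cdot> A \<cdot> B \<cdot> y))) \<^bold>\<rightarrow>
      (\<^bold>\<Pi>z\<^bold>:El (cn PI \<cdot> A \<cdot> B). El (C \<cdot> z)))"
| "prim_type SIG = (\<^bold>\<Pi>A\<^bold>:SET. (El A \<^bold>\<rightarrow> SET) \<^bold>\<rightarrow> SET)"
| "prim_type PAIR =
    (\<^bold>\<Pi>A\<^bold>:SET. \<^bold>\<Pi>B\<^bold>:(El A \<^bold>\<rightarrow> SET). \<^bold>\<Pi>a\<^bold>:El A. El (B \<cdot> a) \<^bold>\<rightarrow> El (cn SIG \<cdot> A \<cdot> B))"
| "prim_type SPLIT =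
    (\<^bold>\<Pi>A\<^bold>:SET. \<^bold>\<Pi>B\<^bold>:(El A \<^bold>\<rightarrow> SET). \<^bold>\<Pi>C\<^bold>:(El (cn SIG \<cdot> A \<cdot> B) \<^bold>\<rightarrow> SET).
      (\<^bold>\<Pi>x\<^bold>:El A. \<^bold>\<Pi>y\<^bold>:El (B \<cdot> x). El (C \<cdot> (cn PAIR \<cdot> A \<cdot> B \<cdot> x \<cdot> y))) \<^bold>\<rightarrow>
      (\<^bold>\<Pi>z\<^bold>:El (cn SIG \<cdot> A \<cdot> B). El (C \<cdot> z)))"
| "prim_type PLUS = (SET \<^bold>\<rightarrow> SET \<^bold>\<rightarrow> SET)"
| "prim_type INL = (\<^bold>\<Pi>A\<^bold>:SET. \<^bold>\<Pi>B\<^bold>:SET. El A \<^bold>\<rightarrow> El (cn PLUS \<cdot> A \<cdot> B))"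
| "prim_type INR = (\<^bold>\<Pi>A\<^bold>:SET. \<^bold>\<Pi>B\<^bold>:SET. El B \<^bold>\<rightarrow> El (cn PLUS \<cdot> A \<cdot> B))"
| "prim_type WHEN =
    (\<^bold>\<Pi>A\<^bold>:SET. \<^bold>\<Pi>B\<^bold>:SET. \<^bold>\<Pi>C\<^bold>:(El (cn PLUS \<cdot> A \<cdot> B) \<^bold>\<rightarrow> SET).
      (\<^bold>\<Pi>x\<^bold>:El A. El (C \<cdot> (cn INL \<cdot> A \<cdot> B \<cdot> x))) \<^bold>\<rightarrow>
      (\<^bold>\<Pi>y\<^bold>:El B. El (C \<cdot> (cn INR \<cdot> A \<cdot> B \<cdot> y))) \<^bold>\<rightarrow>
      (\<^bold>\<Pi>z\<^bold>:El (cn PLUS \<cdot> A \<cdot> B). El (C \<cdot> z)))"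
| "prim_type ID = (\<^bold>\<Pi>A\<^bold>:SET. El A \<^bold>\<rightarrow> El A \<^bold>\<rightarrow> SET)"
| "prim_type REFL = (\<^bold>\<Pi>A\<^bold>:SET. \<^bold>\<Pi>a\<^bold>:El A. El (cn ID \<cdot> A \<cdot> a \<cdot> a))"
| "prim_type IDPEEL =
    (\<^bold>\<Pi>A\<^bold>:SET. \<^bold>\<Pi>C\<^bold>:(\<^bold>\<Pi>x\<^bold>:El A. \<^bold>\<Pi>y\<^bold>:El A. El (cn ID \<cdot> A \<cdot> x \<cdot> y) \<^bold>\<rightarrow> SET).
      (\<^bold>\<Pi>x\<^bold>:El A. El (C \<cdot> x \<cdot> x \<cdot> (cn REFL \<cdot> A \<cdot> x))) \<^bold>\<rightarrow>
      (\<^bold>\<Pi>a\<^bold>:El A. \<^bold>\<Pi>b\<^bold>:El A. \<^bold>\<Pi>e\<^bold>:El (cn ID \<cdot> A \<cdot> a \<cdot> b). El (C \<cdot> a \<cdot> b \<cdot> e)))"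
| "prim_type (Fin n) = SET"
| "prim_type (Elt n i) = El (cn (Fin n))"
| "prim_type (Case n) =
    (\<^bold>\<Pi>C\<^bold>:(El (cn (Fin n)) \<^bold>\<rightarrow> SET).
      foldr (\<lambda>i T. El (C \<cdot> cn (Elt n i)) \<^bold>\<rightarrow> T) [0..<n] (\<^bold>\<Pi>z\<^bold>:El (cn (Fin n)). El (C \<cdot> z)))"
| "prim_type NAT = SET"
| "prim_type ZERO = El (cn NAT)"
| "prim_type SUCC = (El (cn NAT) \<^bold>\<rightarrow> El (cn NAT))"
| "prim_type NATREC =
    (\<^bold>\<Pi>C\<^bold>:(El (cn NAT) \<^bold>\<rightarrow> SET). El (C \<cdot> cn ZERO) \<^bold>\<rightarrow>
      (\<^bold>\<Pi>x\<^bold>:El (cn NAT). El (C \<cdot> x) \<^bold>\<rightarrow> El (C \<cdot> (cn SUCC \<cdot> x))) \<^bold>\<rightarrow>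
      (\<^bold>\<Pi>z\<^bold>:El (cn NAT). El (C \<cdot> z)))"
| "prim_type LIST = (SET \<^bold>\<rightarrow> SET)"
| "prim_type NIL = (\<^bold>\<Pi>A\<^bold>:SET. El (cn LIST \<cdot> A))"
| "prim_type CONS = (\<^bold>\<Pi>A\<^bold>:SET. El A \<^bold>\<rightarrow> El (cn LIST \<cdot> A) \<^bold>\<rightarrow> El (cn LIST \<cdot> A))"
| "prim_type LISTREC =
    (\<^bold>\<Pi>A\<^bold>:SET. \<^bold>\<Pi>C\<^bold>:(El (cn LIST \<cdot> A) \<^bold>\<rightarrow> SET). El (C \<cdot> (cn NIL \<cdot> A)) \<^bold>\<rightarrow>
      (\<^bold>\<Pi>x\<^bold>:El A. \<^bold>\<Pi>l\<^bold>:El (cn LIST \<cdot> A). El (C \<cdot> l) \<^bold>\<rightarrow> El (C \<cdot> (cn CONS \<cdot> A \<cdot> x \<cdot> l))) \<^bold>\<rightarrow>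
      (\<^bold>\<Pi>z\<^bold>:El (cn LIST \<cdot> A). El (C \<cdot> z)))"
| "prim_type W = (\<^bold>\<Pi>A\<^bold>:SET. (El A \<^bold>\<rightarrow> SET) \<^bold>\<rightarrow> SET)"
| "prim_type WSUP =
    (\<^bold>\<Pi>A\<^bold>:SET. \<^bold>\<Pi>B\<^bold>:(El A \<^bold>\<rightarrow> SET). \<^bold>\<Pi>a\<^bold>:El A.
      (El (B \<cdot> a) \<^bold>\<rightarrow> El (cn W \<cdot> A \<cdot> B)) \<^bold>\<rightarrow> El (cn W \<cdot> A \<cdot> B))"
| "prim_type WREC =
    (\<^bold>\<Pi>A\<^bold>:SET. \<^bold>\<Pi>B\<^bold>:(El A \<^bold>\<rightarrow> SET). \<^bold>\<Pi>C\<^bold>:(El (cn W \<cdot> A \<cdot> B) \<^bold>\<rightarrow> SET).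
      (\<^bold>\<Pi>a\<^bold>:El A. \<^bold>\<Pi>f\<^bold>:(El (B \<cdot> a) \<^bold>\<rightarrow> El (cn W \<cdot> A \<cdot> B)).
        (\<^bold>\<Pi>x\<^bold>:El (B \<cdot> a). El (C \<cdot> (f \<cdot> x))) \<^bold>\<rightarrow> El (C \<cdot> (cn WSUP \<cdot> A \<cdot> B \<cdot> a \<cdot> f))) \<^bold>\<rightarrow>
      (\<^bold>\<Pi>z\<^bold>:El (cn W \<cdot> A \<cdot> B). El (C \<cdot> z)))"
| "prim_type (Univ n) = SET"
| "prim_type (Dec n) = (El (cn (Univ n)) \<^bold>\<rightarrow> SET)"
| "prim_type (CPi n) =
    (\<^bold>\<Pi>a\<^bold>:El (cn (Univ n)). (El (cn (Dec n) \<cdot> a) \<^bold>\<rightarrow> El (cn (Univ n))) \<^bold>\<rightarrow> El (cn (Univ n)))"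
| "prim_type (CSigma n) =
    (\<^bold>\<Pi>a\<^bold>:El (cn (Univ n)). (El (cn (Dec n) \<cdot> a) \<^bold>\<rightarrow> El (cn (Univ n))) \<^bold>\<rightarrow> El (cn (Univ n)))"
| "prim_type (CPlus n) =
    (El (cn (Univ n)) \<^bold>\<rightarrow> El (cn (Univ n)) \<^bold>\<rightarrow> El (cn (Univ n)))"
| "prim_type (CId n) =
    (\<^bold>\<Pi>a\<^bold>:El (cn (Univ n)).
      El (cn (Dec n) \<cdot> a) \<^bold>\<rightarrow> El (cn (Dec n) \<cdot> a) \<^bold>\<rightarrow> El (cn (Univ n)))"
| "prim_type (CFin n k) = El (cn (Univ n))"
| "prim_type (CNat n) = El (cn (Univ n))"
| "prim_type (CList n) = (El (cn (Univ n)) \<^bold>\<rightarrow> El (cn (Univ n)))"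
| "prim_type (CW n) =
    (\<^bold>\<Pi>a\<^bold>:El (cn (Univ n)). (El (cn (Dec n) \<cdot> a) \<^bold>\<rightarrow> El (cn (Univ n))) \<^bold>\<rightarrow> El (cn (Univ n)))"
| "prim_type (CUniv n) = El (cn (Univ (Suc n)))"
| "prim_type (CLift n) = (El (cn (Univ n)) \<^bold>\<rightarrow> El (cn (Univ (Suc n))))"

fun legal_prim :: "prim \<Rightarrow> bool" where
  "legal_prim (Elt n i) \<longleftrightarrow> i < n"
| "legal_prim _ \<longleftrightarrow> True"

text \<open>A computation rule is a definitional equality in the context given by its hypotheses.\<close>

datatype law = Hyp type_b "term_b \<Rightarrow> law" | Law term_b term_b type_b

syntax "_Hyp" :: "pttrn \<Rightarrow> type_b \<Rightarrow> law \<Rightarrow> law"  ("(3\<^bold>\<And>_\<^bold>:_./ _)" [0, 0, 10] 10)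
translations "\<^bold>\<And>x\<^bold>:A. L" \<rightleftharpoons> "CONST Hyp A (\<lambda>x. L)"

primrec law_judgement :: "law \<Rightarrow> ctx \<Rightarrow> judgement" where
  "law_judgement (Hyp A L) \<Gamma> = law_judgement (L (bound (length \<Gamma>))) (A (length \<Gamma>) # \<Gamma>)"
| "law_judgement (Law a b A) \<Gamma> =
    (\<Gamma>, EqTerm (a (length \<Gamma>)) (b (length \<Gamma>)) (A (length \<Gamma>)))"

primrec hyps :: "type_b list \<Rightarrow> (term_b list \<Rightarrow> law) \<Rightarrow> law" where
  "hyps [] L = L []"
| "hyps (A # As) L = (\<^bold>\<And>d\<^bold>:A. hyps As (\<lambda>ds. L (d # ds)))"

inductive_set laws :: "law set" where
  funsplit: "(\<^bold>\<And>A\<^bold>:SET. \<^bold>\<And>B\<^bold>:(El A \<^bold>\<rightarrow> SET). \<^bold>\<And>C\<^bold>:(El (cn PI \<cdot> A \<cdot> B) \<^bold>\<rightarrow> SET).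
    \<^bold>\<And>d\<^bold>:(\<^bold>\<Pi>y\<^bold>:(\<^bold>\<Pi>x\<^bold>:El A. El (B \<cdot> x)). El (C \<cdot> (cn LAMBDA \<cdot> A \<cdot> B \<cdot> y))).
    \<^bold>\<And>b\<^bold>:(\<^bold>\<Pi>x\<^bold>:El A. El (B \<cdot> x)).
      Law (cn FUNSPLIT \<cdot> A \<cdot> B \<cdot> C \<cdot> d \<cdot> (cn LAMBDA \<cdot> A \<cdot> B \<cdot> b)) (d \<cdot> b)
          (El (C \<cdot> (cn LAMBDA \<cdot> A \<cdot> B \<cdot> b)))) \<in> laws"
| split: "(\<^bold>\<And>A\<^bold>:SET. \<^bold>\<And>B\<^bold>:(El A \<^bold>\<rightarrow> SET). \<^bold>\<And>C\<^bold>:(El (cn SIG \<cdot> A \<cdot> B) \<^bold>\<rightarrow> SET).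
    \<^bold>\<And>d\<^bold>:(\<^bold>\<Pi>x\<^bold>:El A. \<^bold>\<Pi>y\<^bold>:El (B \<cdot> x). El (C \<cdot> (cn PAIR \<cdot> A \<cdot> B \<cdot> x \<cdot> y))).
    \<^bold>\<And>a\<^bold>:El A. \<^bold>\<And>b\<^bold>:El (B \<cdot> a).
      Law (cn SPLIT \<cdot> A \<cdot> B \<cdot> C \<cdot> d \<cdot> (cn PAIR \<cdot> A \<cdot> B \<cdot> a \<cdot> b)) (d \<cdot> a \<cdot> b)
          (El (C \<cdot> (cn PAIR \<cdot> A \<cdot> B \<cdot> a \<cdot> b)))) \<in> laws"
| when_inl: "(\<^bold>\<And>A\<^bold>:SET. \<^bold>\<And>B\<^bold>:SET. \<^bold>\<And>C\<^bold>:(El (cn PLUS \<cdot> A \<cdot> B) \<^bold>\<rightarrow> SET).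
    \<^bold>\<And>d\<^bold>:(\<^bold>\<Pi>x\<^bold>:El A. El (C \<cdot> (cn INL \<cdot> A \<cdot> B \<cdot> x))).
    \<^bold>\<And>e\<^bold>:(\<^bold>\<Pi>y\<^bold>:El B. El (C \<cdot> (cn INR \<cdot> A \<cdot> B \<cdot> y))). \<^bold>\<And>a\<^bold>:El A.
      Law (cn WHEN \<cdot> A \<cdot> B \<cdot> C \<cdot> d \<cdot> e \<cdot> (cn INL \<cdot> A \<cdot> B \<cdot> a)) (d \<cdot> a)
          (El (C \<cdot> (cn INL \<cdot> A \<cdot> B \<cdot> a)))) \<in> laws"
| when_inr: "(\<^bold>\<And>A\<^bold>:SET. \<^bold>\<And>B\<^bold>:SET. \<^bold>\<And>C\<^bold>:(El (cn PLUS \<cdot> A \<cdot> B) \<^bold>\<rightarrow> SET).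
    \<^bold>\<And>d\<^bold>:(\<^bold>\<Pi>x\<^bold>:El A. El (C \<cdot> (cn INL \<cdot> A \<cdot> B \<cdot> x))).
    \<^bold>\<And>e\<^bold>:(\<^bold>\<Pi>y\<^bold>:El B. El (C \<cdot> (cn INR \<cdot> A \<cdot> B \<cdot> y))). \<^bold>\<And>b\<^bold>:El B.
      Law (cn WHEN \<cdot> A \<cdot> B \<cdot> C \<cdot> d \<cdot> e \<cdot> (cn INR \<cdot> A \<cdot> B \<cdot> b)) (e \<cdot> b)
          (El (C \<cdot> (cn INR \<cdot> A \<cdot> B \<cdot> b)))) \<in> laws"
| idpeel: "(\<^bold>\<And>A\<^bold>:SET. \<^bold>\<And>C\<^bold>:(\<^bold>\<Pi>x\<^bold>:El A. \<^bold>\<Pi>y\<^bold>:El A. El (cn ID \<cdot> A \<cdot> x \<cdot> y) \<^bold>\<rightarrow> SET).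
    \<^bold>\<And>d\<^bold>:(\<^bold>\<Pi>x\<^bold>:El A. El (C \<cdot> x \<cdot> x \<cdot> (cn REFL \<cdot> A \<cdot> x))). \<^bold>\<And>a\<^bold>:El A.
      Law (cn IDPEEL \<cdot> A \<cdot> C \<cdot> d \<cdot> a \<cdot> a \<cdot> (cn REFL \<cdot> A \<cdot> a)) (d \<cdot> a)
          (El (C \<cdot> a \<cdot> a \<cdot> (cn REFL \<cdot> A \<cdot> a)))) \<in> laws"
| fin_case: "i < n \<Longrightarrow> (\<^bold>\<And>C\<^bold>:(El (cn (Fin n)) \<^bold>\<rightarrow> SET).
    hyps (map (\<lambda>j. El (C \<cdot> cn (Elt n j))) [0..<n]) (\<lambda>ds.
      Law (foldl tapp (cn (Case n) \<cdot> C) ds \<cdot> cn (Elt n i)) (ds ! i)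
          (El (C \<cdot> cn (Elt n i))))) \<in> laws"
| natrec_zero: "(\<^bold>\<And>C\<^bold>:(El (cn NAT) \<^bold>\<rightarrow> SET). \<^bold>\<And>d\<^bold>:El (C \<cdot> cn ZERO).
    \<^bold>\<And>e\<^bold>:(\<^bold>\<Pi>x\<^bold>:El (cn NAT). El (C \<cdot> x) \<^bold>\<rightarrow> El (C \<cdot> (cn SUCC \<cdot> x))).
      Law (cn NATREC \<cdot> C \<cdot> d \<cdot> e \<cdot> cn ZERO) d (El (C \<cdot> cn ZERO))) \<in> laws"
| natrec_succ: "(\<^bold>\<And>C\<^bold>:(El (cn NAT) \<^bold>\<rightarrow> SET). \<^bold>\<And>d\<^bold>:El (C \<cdot> cn ZERO).
    \<^bold>\<And>e\<^bold>:(\<^bold>\<Pi>x\<^bold>:El (cn NAT). El (C \<cdot> x) \<^bold>\<rightarrow> El (C \<cdot> (cn SUCC \<cdot> x))). \<^bold>\<And>a\<^bold>:El (cn NAT).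
      Law (cn NATREC \<cdot> C \<cdot> d \<cdot> e \<cdot> (cn SUCC \<cdot> a)) (e \<cdot> a \<cdot> (cn NATREC \<cdot> C \<cdot> d \<cdot> e \<cdot> a))
          (El (C \<cdot> (cn SUCC \<cdot> a)))) \<in> laws"
| listrec_nil: "(\<^bold>\<And>A\<^bold>:SET. \<^bold>\<And>C\<^bold>:(El (cn LIST \<cdot> A) \<^bold>\<rightarrow> SET). \<^bold>\<And>d\<^bold>:El (C \<cdot> (cn NIL \<cdot> A)).
    \<^bold>\<And>e\<^bold>:(\<^bold>\<Pi>x\<^bold>:El A. \<^bold>\<Pi>l\<^bold>:El (cn LIST \<cdot> A). El (C \<cdot> l) \<^bold>\<rightarrow> El (C \<cdot> (cn CONS \<cdot> A \<cdot> x \<cdot> l))).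
      Law (cn LISTREC \<cdot> A \<cdot> C \<cdot> d \<cdot> e \<cdot> (cn NIL \<cdot> A)) d (El (C \<cdot> (cn NIL \<cdot> A)))) \<in> laws"
| listrec_cons: "(\<^bold>\<And>A\<^bold>:SET. \<^bold>\<And>C\<^bold>:(El (cn LIST \<cdot> A) \<^bold>\<rightarrow> SET). \<^bold>\<And>d\<^bold>:El (C \<cdot> (cn NIL \<cdot> A)).
    \<^bold>\<And>e\<^bold>:(\<^bold>\<Pi>x\<^bold>:El A. \<^bold>\<Pi>l\<^bold>:El (cn LIST \<cdot> A). El (C \<cdot> l) \<^bold>\<rightarrow> El (C \<cdot> (cn CONS \<cdot> A \<cdot> x \<cdot> l))).
    \<^bold>\<And>a\<^bold>:El A. \<^bold>\<And>l\<^bold>:El (cn LIST \<cdot> A).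
      Law (cn LISTREC \<cdot> A \<cdot> C \<cdot> d \<cdot> e \<cdot> (cn CONS \<cdot> A \<cdot> a \<cdot> l))
          (e \<cdot> a \<cdot> l \<cdot> (cn LISTREC \<cdot> A \<cdot> C \<cdot> d \<cdot> e \<cdot> l))
          (El (C \<cdot> (cn CONS \<cdot> A \<cdot> a \<cdot> l)))) \<in> laws"
| wrec: "(\<^bold>\<And>A\<^bold>:SET. \<^bold>\<And>B\<^bold>:(El A \<^bold>\<rightarrow> SET). \<^bold>\<And>C\<^bold>:(El (cn W \<cdot> A \<cdot> B) \<^bold>\<rightarrow> SET).
    \<^bold>\<And>d\<^bold>:(\<^bold>\<Pi>a\<^bold>:El A. \<^bold>\<Pi>f\<^bold>:(El (B \<cdot> a) \<^bold>\<rightarrow> El (cn W \<cdot> A \<cdot> B)).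
          (\<^bold>\<Pi>x\<^bold>:El (B \<cdot> a). El (C \<cdot> (f \<cdot> x))) \<^bold>\<rightarrow> El (C \<cdot> (cn WSUP \<cdot> A \<cdot> B \<cdot> a \<cdot> f))).
    \<^bold>\<And>a\<^bold>:El A. \<^bold>\<And>f\<^bold>:(El (B \<cdot> a) \<^bold>\<rightarrow> El (cn W \<cdot> A \<cdot> B)).
      Law (cn WREC \<cdot> A \<cdot> B \<cdot> C \<cdot> d \<cdot> (cn WSUP \<cdot> A \<cdot> B \<cdot> a \<cdot> f))
          (d \<cdot> a \<cdot> f \<cdot> (\<^bold>\<lambda>x. cn WREC \<cdot> A \<cdot> B \<cdot> C \<cdot> d \<cdot> (f \<cdot> x)))
          (El (C \<cdot> (cn WSUP \<cdot> A \<cdot> B \<cdot> a \<cdot> f)))) \<in> laws"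
| dec_pi: "(\<^bold>\<And>a\<^bold>:El (cn (Univ n)). \<^bold>\<And>b\<^bold>:(El (cn (Dec n) \<cdot> a) \<^bold>\<rightarrow> El (cn (Univ n))).
      Law (cn (Dec n) \<cdot> (cn (CPi n) \<cdot> a \<cdot> b))
          (cn PI \<cdot> (cn (Dec n) \<cdot> a) \<cdot> (\<^bold>\<lambda>x. cn (Dec n) \<cdot> (b \<cdot> x))) SET) \<in> laws"
| dec_sigma: "(\<^bold>\<And>a\<^bold>:El (cn (Univ n)). \<^bold>\<And>b\<^bold>:(El (cn (Dec n) \<cdot> a) \<^bold>\<rightarrow> El (cn (Univ n))).
      Law (cn (Dec n) \<cdot> (cn (CSigma n) \<cdot> a \<cdot> b))
          (cn SIG \<cdot> (cn (Dec n) \<cdot> a) \<cdot> (\<^bold>\<lambda>x. cn (Dec n) \<cdot> (b \<cdot> x))) SET) \<in> laws"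
| dec_plus: "(\<^bold>\<And>a\<^bold>:El (cn (Univ n)). \<^bold>\<And>b\<^bold>:El (cn (Univ n)).
      Law (cn (Dec n) \<cdot> (cn (CPlus n) \<cdot> a \<cdot> b))
          (cn PLUS \<cdot> (cn (Dec n) \<cdot> a) \<cdot> (cn (Dec n) \<cdot> b)) SET) \<in> laws"
| dec_id: "(\<^bold>\<And>a\<^bold>:El (cn (Univ n)). \<^bold>\<And>x\<^bold>:El (cn (Dec n) \<cdot> a). \<^bold>\<And>y\<^bold>:El (cn (Dec n) \<cdot> a).
      Law (cn (Dec n) \<cdot> (cn (CId n) \<cdot> a \<cdot> x \<cdot> y))
          (cn ID \<cdot> (cn (Dec n) \<cdot> a) \<cdot> x \<cdot> y) SET) \<in> laws"
| dec_fin: "Law (cn (Dec n) \<cdot> cn (CFin n k)) (cn (Fin k)) SET \<in> laws"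
| dec_nat: "Law (cn (Dec n) \<cdot> cn (CNat n)) (cn NAT) SET \<in> laws"
| dec_list: "(\<^bold>\<And>a\<^bold>:El (cn (Univ n)).
      Law (cn (Dec n) \<cdot> (cn (CList n) \<cdot> a)) (cn LIST \<cdot> (cn (Dec n) \<cdot> a)) SET) \<in> laws"
| dec_w: "(\<^bold>\<And>a\<^bold>:El (cn (Univ n)). \<^bold>\<And>b\<^bold>:(El (cn (Dec n) \<cdot> a) \<^bold>\<rightarrow> El (cn (Univ n))).
      Law (cn (Dec n) \<cdot> (cn (CW n) \<cdot> a \<cdot> b))
          (cn W \<cdot> (cn (Dec n) \<cdot> a) \<cdot> (\<^bold>\<lambda>x. cn (Dec n) \<cdot> (b \<cdot> x))) SET) \<in> laws"
| dec_univ: "Law (cn (Dec (Suc n)) \<cdot> cn (CUniv n)) (cn (Univ n)) SET \<in> laws"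
| dec_lift: "(\<^bold>\<And>a\<^bold>:El (cn (Univ n)).
      Law (cn (Dec (Suc n)) \<cdot> (cn (CLift n) \<cdot> a)) (cn (Dec n) \<cdot> a) SET) \<in> laws"

text \<open>\<open>der R (\<Gamma>, J)\<close>: the judgement \<open>J\<close> is derivable in the context \<open>\<Gamma>\<close> in the extension of CTT by
  the rule instances \<open>R\<close> (pairs of premises and conclusion). These may declare new constants, add
  definitional equalities, or be of any other form. The substitution rule \<open>subst\<close> includes
  weakening.\<close>

inductive der :: "rule set \<Rightarrow> judgement \<Rightarrow> bool" for R where
  ext: "(Js, J) \<in> R \<Longrightarrow> (\<And>K. K \<in> set Js \<Longrightarrow> der R K) \<Longrightarrow> der R J"
| empty: "der R ([], Wf)"
| extend: "der R (\<Gamma>, IsType A) \<Longrightarrow> der R (A # \<Gamma>, Wf)"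
| var: "der R (\<Gamma>, Wf) \<Longrightarrow> i < length \<Gamma> \<Longrightarrow>
    der R (\<Gamma>, HasType (Var i) (weaken (Suc i) (\<Gamma> ! i)))"
| subst: "der R (\<Gamma>, J) \<Longrightarrow> der R (\<Delta>, Wf) \<Longrightarrow>
    (\<And>i. i < length \<Gamma> \<Longrightarrow>
      der R (\<Delta>, HasType (s i) (subst_ty s (weaken (Suc i) (\<Gamma> ! i))))) \<Longrightarrow>
    der R (\<Delta>, subst_stmt s J)"
| subst_eq_ty: "der R (\<Gamma>, IsType A) \<Longrightarrow> der R (\<Delta>, Wf) \<Longrightarrow>
    (\<And>i. i < length \<Gamma> \<Longrightarrow>
      der R (\<Delta>, EqTerm (s i) (t i) (subst_ty s (weaken (Suc i) (\<Gamma> ! i))))) \<Longrightarrow>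
    der R (\<Delta>, EqType (subst_ty s A) (subst_ty t A))"
| subst_eq_tm: "der R (\<Gamma>, HasType a A) \<Longrightarrow> der R (\<Delta>, Wf) \<Longrightarrow>
    (\<And>i. i < length \<Gamma> \<Longrightarrow>
      der R (\<Delta>, EqTerm (s i) (t i) (subst_ty s (weaken (Suc i) (\<Gamma> ! i))))) \<Longrightarrow>
    der R (\<Delta>, EqTerm (subst_tm s a) (subst_tm t a) (subst_ty s A))"
| ty_refl: "der R (\<Gamma>, IsType A) \<Longrightarrow> der R (\<Gamma>, EqType A A)"
| ty_sym: "der R (\<Gamma>, EqType A B) \<Longrightarrow> der R (\<Gamma>, EqType B A)"
| ty_trans: "der R (\<Gamma>, EqType A B) \<Longrightarrow> der R (\<Gamma>, EqType B C) \<Longrightarrow> der R (\<Gamma>, EqType A C)"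
| tm_refl: "der R (\<Gamma>, HasType a A) \<Longrightarrow> der R (\<Gamma>, EqTerm a a A)"
| tm_sym: "der R (\<Gamma>, EqTerm a b A) \<Longrightarrow> der R (\<Gamma>, EqTerm b a A)"
| tm_trans: "der R (\<Gamma>, EqTerm a b A) \<Longrightarrow> der R (\<Gamma>, EqTerm b c A) \<Longrightarrow> der R (\<Gamma>, EqTerm a c A)"
| conv: "der R (\<Gamma>, HasType a A) \<Longrightarrow> der R (\<Gamma>, EqType A B) \<Longrightarrow> der R (\<Gamma>, HasType a B)"
| conv_eq: "der R (\<Gamma>, EqTerm a b A) \<Longrightarrow> der R (\<Gamma>, EqType A B) \<Longrightarrow> der R (\<Gamma>, EqTerm a b B)"
| set_form: "der R (\<Gamma>, Wf) \<Longrightarrow> der R (\<Gamma>, IsType TSet)"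
| el_form: "der R (\<Gamma>, HasType a TSet) \<Longrightarrow> der R (\<Gamma>, IsType (TEl a))"
| el_eq: "der R (\<Gamma>, EqTerm a b TSet) \<Longrightarrow> der R (\<Gamma>, EqType (TEl a) (TEl b))"
| fun_form: "der R (\<Gamma>, IsType A) \<Longrightarrow> der R (A # \<Gamma>, IsType B) \<Longrightarrow> der R (\<Gamma>, IsType (TFun A B))"
| fun_eq: "der R (\<Gamma>, EqType A A') \<Longrightarrow> der R (A # \<Gamma>, EqType B B') \<Longrightarrow>
    der R (\<Gamma>, EqType (TFun A B) (TFun A' B'))"
| abs: "der R (A # \<Gamma>, HasType b B) \<Longrightarrow> der R (\<Gamma>, HasType (Lam b) (TFun A B))"
| abs_eq: "der R (A # \<Gamma>, EqTerm b b' B) \<Longrightarrow> der R (\<Gamma>, EqTerm (Lam b) (Lam b') (TFun A B))"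
| app: "der R (\<Gamma>, HasType c (TFun A B)) \<Longrightarrow> der R (\<Gamma>, HasType a A) \<Longrightarrow>
    der R (\<Gamma>, HasType (App c a) (subst_ty (sub1 a) B))"
| app_eq: "der R (\<Gamma>, EqTerm c c' (TFun A B)) \<Longrightarrow> der R (\<Gamma>, EqTerm a a' A) \<Longrightarrow>
    der R (\<Gamma>, EqTerm (App c a) (App c' a') (subst_ty (sub1 a) B))"
| beta: "der R (A # \<Gamma>, HasType b B) \<Longrightarrow> der R (\<Gamma>, HasType a A) \<Longrightarrow>
    der R (\<Gamma>, EqTerm (App (Lam b) a) (subst_tm (sub1 a) b) (subst_ty (sub1 a) B))"
| eta: "der R (\<Gamma>, HasType c (TFun A B)) \<Longrightarrow>
    der R (\<Gamma>, EqTerm (Lam (App (ren_tm Suc c) (Var 0))) c (TFun A B))"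
| prim: "legal_prim c \<Longrightarrow> der R ([], HasType (Const (Prim c)) (prim_type c 0))"
| law: "L \<in> laws \<Longrightarrow> der R (law_judgement L [])"

text \<open>\<open>R\<close> proves a type when it derives a closed term of that type.\<close>

definition proves_type :: "rule set \<Rightarrow> type_b \<Rightarrow> bool" where
  "proves_type R A \<longleftrightarrow> (\<exists>t. der R ([], HasType t (A 0)))"

text \<open>Propositions are sets.\<close>

definition tAll :: "term_b \<Rightarrow> (term_b \<Rightarrow> term_b) \<Rightarrow> term_b" where
  "tAll A B = cn PI \<cdot> A \<cdot> (\<^bold>\<lambda>x. B x)"

definition tEx :: "term_b \<Rightarrow> (term_b \<Rightarrow> term_b) \<Rightarrow> term_b" where
  "tEx A B = cn SIG \<cdot> A \<cdot> (\<^bold>\<lambda>x. B x)"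

definition tImp :: "term_b \<Rightarrow> term_b \<Rightarrow> term_b" (infixr "\<^bold>\<supset>" 25) where
  "(P \<^bold>\<supset> Q) = tAll P (\<lambda>_. Q)"

definition tAnd :: "term_b \<Rightarrow> term_b \<Rightarrow> term_b" (infixr "\<^bold>&" 35) where
  "(P \<^bold>& Q) = tEx P (\<lambda>_. Q)"

definition tFalse :: term_b where
  "tFalse = cn (Fin 0)"

definition consistent_CTT_ext :: "rule set \<Rightarrow> bool" where
  "consistent_CTT_ext R \<longleftrightarrow> \<not> proves_type R (El tFalse)"

definition GUP_CTT_types :: "type_b \<times> type_b" where
  "GUP_CTT_types =
    (let tele = (\<lambda>G :: term_b \<Rightarrow> term_b \<Rightarrow> term_b \<Rightarrow> term_b \<Rightarrow> type_b.
           \<^bold>\<Pi>I\<^bold>:SET. \<^bold>\<Pi>R\<^bold>:(SET \<^bold>\<rightarrow> El I \<^bold>\<rightarrow> SET). \<^bold>\<Pi>F\<^bold>:(SET \<^bold>\<rightarrow> El I).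
             \<^bold>\<Pi>h\<^bold>:(\<^bold>\<Pi>P\<^bold>:SET. El (R \<cdot> P \<cdot> (F \<cdot> P))). G I R F h);
         point = (\<lambda>n. Const GUP_point)
     in (tele (\<lambda>I R F h. El I),
         tele (\<lambda>I R F h. \<^bold>\<Pi>P\<^bold>:SET. El (R \<cdot> P \<cdot> (point \<cdot> I \<cdot> R \<cdot> F \<cdot> h)))))"

definition GUP_CTT :: "rule set" where
  "GUP_CTT =
    {([], ([], HasType (Const GUP_point) (fst GUP_CTT_types 0))),
     ([], ([], HasType (Const GUP_proof) (snd GUP_CTT_types 0)))}"


section \<open>Formal spaces in CTT\<close>

text \<open>Subsets of \<open>S\<close> are propositional functions on \<open>S\<close>.\<close>

definition tSub :: "term_b \<Rightarrow> type_b" where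
  "tSub S = (El S \<^bold>\<rightarrow> SET)"

definition tEmpty :: term_b where
  "tEmpty = (\<^bold>\<lambda>x. tFalse)"

definition tFull :: term_b where
  "tFull = (\<^bold>\<lambda>x. cn (Fin 1))"

definition tSingle :: "term_b \<Rightarrow> term_b \<Rightarrow> term_b" where
  "tSingle S a = (\<^bold>\<lambda>x. cn ID \<cdot> S \<cdot> x \<cdot> a)"

definition tSubset :: "term_b \<Rightarrow> term_b \<Rightarrow> term_b \<Rightarrow> term_b" where
  "tSubset S U V = tAll S (\<lambda>x. U \<cdot> x \<^bold>\<supset> V \<cdot> x)"

definition tCovers :: "term_b \<Rightarrow> term_b \<Rightarrow> term_b \<Rightarrow> term_b \<Rightarrow> term_b" where
  "tCovers S C U V = tAll S (\<lambda>u. U \<cdot> u \<^bold>\<supset> C \<cdot> u \<cdot> V)"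

definition tDown :: "term_b \<Rightarrow> term_b \<Rightarrow> term_b \<Rightarrow> term_b \<Rightarrow> term_b" where
  "tDown S C U V =
    (\<^bold>\<lambda>d. tEx S (\<lambda>u. U \<cdot> u \<^bold>& C \<cdot> d \<cdot> tSingle S u) \<^bold>& tEx S (\<lambda>v. V \<cdot> v \<^bold>& C \<cdot> d \<cdot> tSingle S v))"

definition tPseudocompl :: "term_b \<Rightarrow> term_b \<Rightarrow> term_b \<Rightarrow> term_b" where
  "tPseudocompl S C U = (\<^bold>\<lambda>a. tCovers S C (tDown S C (tSingle S a) U) tEmpty)"

definition tDneg_cover :: "term_b \<Rightarrow> term_b \<Rightarrow> term_b" where
  "tDneg_cover S C =
    (\<^bold>\<lambda>a. \<^bold>\<lambda>U. tCovers S C (tPseudocompl S C (tPseudocompl S C (tSingle S a)))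
                         (tPseudocompl S C (tPseudocompl S C U)))"

text \<open>A formal space given by a definition in an extension of CTT is a pair of closed terms. (For
  arbitrary additional rules \<open>R\<close>, being typable in the empty context does not entail closedness.)\<close>

definition ctt_formal_space :: "rule set \<Rightarrow> tm \<Rightarrow> tm \<Rightarrow> bool" where
  "ctt_formal_space R S\<^sub>0 C\<^sub>0 \<longleftrightarrow>
    (let S = (\<lambda>n. S\<^sub>0); C = (\<lambda>n. C\<^sub>0) in
      closed_tm S\<^sub>0 \<and> der R ([], HasType S\<^sub>0 TSet) \<and>
      closed_tm C\<^sub>0 \<and>
      der R ([], HasType C\<^sub>0 ((El S \<^bold>\<rightarrow> tSub S \<^bold>\<rightarrow> SET) 0)) \<and>
      proves_type R (\<^bold>\<Pi>a\<^bold>:El S. \<^bold>\<Pi>U\<^bold>:tSub S. El (U \<cdot> a \<^bold>\<supset> C \<cdot> a \<cdot> U)) \<and>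
      proves_type R (\<^bold>\<Pi>a\<^bold>:El S. \<^bold>\<Pi>U\<^bold>:tSub S. \<^bold>\<Pi>V\<^bold>:tSub S.
        El (C \<cdot> a \<cdot> U \<^bold>\<supset> tCovers S C U V \<^bold>\<supset> C \<cdot> a \<cdot> V)) \<and>
      proves_type R (\<^bold>\<Pi>a\<^bold>:El S. \<^bold>\<Pi>U\<^bold>:tSub S. \<^bold>\<Pi>V\<^bold>:tSub S.
        El (C \<cdot> a \<cdot> U \<^bold>\<supset> C \<cdot> a \<cdot> V \<^bold>\<supset> C \<cdot> a \<cdot> tDown S C U V)))"

definition ctt_nontrivial :: "rule set \<Rightarrow> tm \<Rightarrow> tm \<Rightarrow> bool" where
  "ctt_nontrivial R S\<^sub>0 C\<^sub>0 \<longleftrightarrow>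
    (let S = (\<lambda>n. S\<^sub>0); C = (\<lambda>n. C\<^sub>0) in
      proves_type R (El (tCovers S C tFull tEmpty \<^bold>\<supset> tFalse)))"

definition ctt_set_presented :: "rule set \<Rightarrow> tm \<Rightarrow> tm \<Rightarrow> bool" where
  "ctt_set_presented R S\<^sub>0 C\<^sub>0 \<longleftrightarrow>
    (\<exists>I\<^sub>0 D\<^sub>0. let S = (\<lambda>n. S\<^sub>0); C = (\<lambda>n. C\<^sub>0); I = (\<lambda>n. I\<^sub>0); D = (\<lambda>n. D\<^sub>0) in
      closed_tm I\<^sub>0 \<and> closed_tm D\<^sub>0 \<and>
      der R ([], HasType I\<^sub>0 ((El S \<^bold>\<rightarrow> SET) 0)) \<and>
      der R ([], HasType D\<^sub>0 ((\<^bold>\<Pi>x\<^bold>:El S. El (I \<cdot> x) \<^bold>\<rightarrow> tSub S) 0)) \<and>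
      proves_type R (\<^bold>\<Pi>a\<^bold>:El S. \<^bold>\<Pi>U\<^bold>:tSub S.
        El ((C \<cdot> a \<cdot> U \<^bold>\<supset> tEx (I \<cdot> a) (\<lambda>i. tSubset S (D \<cdot> a \<cdot> i) U)) \<^bold>&
            (tEx (I \<cdot> a) (\<lambda>i. tSubset S (D \<cdot> a \<cdot> i) U) \<^bold>\<supset> C \<cdot> a \<cdot> U))))"

definition ctt_dneg :: "tm \<Rightarrow> tm \<Rightarrow> tm" where
  "ctt_dneg S\<^sub>0 C\<^sub>0 = tDneg_cover (\<lambda>n. S\<^sub>0) (\<lambda>n. C\<^sub>0) 0"

end

theory Submission
  imports Defs
begin

text \<open>For a proposition \<open>P\<close> let \<open>U\<^sub>P\<close> consist of the points for which one can decide, by means of an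
  element of a two-element set (a code in the first universe), whether \<open>P\<close> holds or \<open>P\<close> implies that
  the point is null, that is, covered by the empty set. A point \<open>v\<close> of the pseudocomplement of \<open>U\<^sub>P\<close>
  is null: if \<open>P\<close> holds then \<open>v\<close> is in \<open>U\<^sub>P\<close> and hence null, so \<open>P\<close> implies that \<open>v\<close> is null, so \<open>v\<close>
  is in \<open>U\<^sub>P\<close> anyway. Thus every \<open>U\<^sub>P\<close> covers every \<open>a\<close> in the double negation space. If that space
  is set-presented, the uniformity principle yields one basic cover \<open>V\<close> of \<open>a\<close> contained in all
  \<open>U\<^sub>P\<close>. For \<open>x\<close> in \<open>V\<close>, a second use of the principle yields one decision for all \<open>P\<close>; taking
  \<open>P\<close> false and \<open>P\<close> true shows that \<open>x\<close> is null. So \<open>a\<close> is covered by the null points in the double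
  negation space, which makes \<open>a\<close> null, and the space is trivial.\<close>


section \<open>Renaming in intuitionistic predicate logic\<close>

text \<open>In a non-trivial space a single point may still be null, and a null point yields no
  contradiction. So the second alternative cannot be that P is false; it has to be that P makes the
  point null, since this is what membership in the pseudocomplement delivers. A plain disjunction
  has no witness in a set, so it is expressed by a choice k that counts as true or false, to which
  uniformity can be applied. In CZF the subset has to be formed by bounded separation. A proposition
  is therefore represented by a set x being inhabited, and nullity by membership in the set Z of
  null points, which exists by the last condition on formal spaces. In CTT subsets are propositional
  functions and nullity may occur directly, but membership in a singleton is an identity set whose
  proofs have to be eliminated. The extensions are arbitrary, so the argument is carried out inside
  them: for CZF through an interpretation of formulas by contexts, for CTT through a notion of truth
  closed under substitution.\<close>

lemma up_var_simps [simp]: "up_var f 0 = 0" "up_var f (Suc i) = Suc (f i)"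
  by (simp_all add: up_var_def)

lemma up_var_comp: "up_var f \<circ> up_var g = up_var (f \<circ> g)"
  by (auto simp: up_var_def fun_eq_iff split: nat.splits)

lemma up_var_ident: "up_var (\<lambda>i. i) = (\<lambda>i. i)"
  by (auto simp: up_var_def fun_eq_iff split: nat.splits)

lemma ren_ren: "ren f (ren g p) = ren (f \<circ> g) p"
  by (induction p arbitrary: f g) (simp_all add: up_var_comp)

lemma up_var_cong: "(\<And>i. Suc i \<in> A \<Longrightarrow> f i = g i) \<Longrightarrow> i \<in> A \<Longrightarrow> up_var f i = up_var g i"
  by (cases i) auto

lemma ren_cong: "(\<And>i. i \<in> free_vars p \<Longrightarrow> f i = g i) \<Longrightarrow> ren f p = ren g p"
proof (induction p arbitrary: f g)
  case (Forall p)
  show ?case using Forall.prems by (auto intro!: Forall.IH up_var_cong[of "free_vars p"])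
next
  case (Exists p)
  show ?case using Exists.prems by (auto intro!: Exists.IH up_var_cong[of "free_vars p"])
next
  case (Conj p q)
  show ?case using Conj.prems by (auto intro!: Conj.IH)
next
  case (Disj p q)
  show ?case using Disj.prems by (auto intro!: Disj.IH)
next
  case (Impl p q)
  show ?case using Impl.prems by (auto intro!: Impl.IH)
qed simp_all

lemma ren_ident: "ren (\<lambda>i. i) p = p"
  by (induction p) (simp_all add: up_var_ident)

lemma finite_Suc_vimage: "finite A \<Longrightarrow> finite {i. Suc i \<in> A}"
  using finite_vimageI[of A Suc] by (simp add: vimage_def)

lemma finite_free_vars: "finite (free_vars p)"
  by (induction p) (simp_all add: finite_Suc_vimage)

lemma free_vars_ren: "free_vars (ren f p) = f ` free_vars p"
proof (induction p arbitrary: f)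
  case (Forall p)
  show ?case
    by (auto simp: Forall.IH image_iff; metis up_var_simps not0_implies_Suc nat.distinct(1) Suc_inject)
next
  case (Exists p)
  show ?case
    by (auto simp: Exists.IH image_iff; metis up_var_simps not0_implies_Suc nat.distinct(1) Suc_inject)
qed auto

section \<open>Weakening and renaming of derivations\<close>

lemma prv_mono:
  assumes "T \<subseteq> T'"
  shows "prv T H p \<Longrightarrow> set H \<subseteq> set H' \<Longrightarrow> prv T' H' p"
proof (induction arbitrary: H' rule: prv.induct)
  case (axiom p H)
  then show ?case using assms by (blast intro: prv.axiom)
next
  case (hyp p H)
  then show ?case by (auto intro: prv.hyp)
next
  case (falsumE H p)
  show ?case by (rule prv.falsumE) (rule falsumE.IH[OF falsumE.prems])
next
  case (conjI H p q)
  show ?case by (rule prv.conjI) (rule conjI.IH[OF conjI.prems])+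
next
  case (conjE1 H p q)
  show ?case by (rule prv.conjE1) (rule conjE1.IH[OF conjE1.prems])
next
  case (conjE2 H p q)
  show ?case by (rule prv.conjE2) (rule conjE2.IH[OF conjE2.prems])
next
  case (disjI1 H p q)
  show ?case by (rule prv.disjI1) (rule disjI1.IH[OF disjI1.prems])
next
  case (disjI2 H q p)
  show ?case by (rule prv.disjI2) (rule disjI2.IH[OF disjI2.prems])
next
  case (disjE H p q r)
  show ?case
    by (rule prv.disjE[OF disjE.IH(1)[OF disjE.prems]]; rule disjE.IH) (use disjE.prems in auto)
next
  case (implI p H q)
  show ?case by (rule prv.implI, rule implI.IH) (use implI.prems in auto)
next
  case (implE H p q)
  show ?case by (rule prv.implE) (rule implE.IH[OF implE.prems])+
next
  case (forallI H p)
  show ?case by (rule prv.forallI, rule forallI.IH) (use forallI.prems in auto)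
next
  case (forallE H p t)
  show ?case by (rule prv.forallE) (rule forallE.IH[OF forallE.prems])
next
  case (existsI H t p)
  show ?case by (rule prv.existsI) (rule existsI.IH[OF existsI.prems])
next
  case (existsE H p q)
  show ?case
    by (rule prv.existsE[OF existsE.IH(1)[OF existsE.prems]], rule existsE.IH) (use existsE.prems in auto)
next
  case (equalI H t)
  show ?case by (rule prv.equalI)
next
  case (equalE H s t p)
  show ?case by (rule prv.equalE[OF equalE.IH(1)[OF equalE.prems] equalE.IH(2)[OF equalE.prems]])
qed

lemmas prv_weaken = prv_mono[OF order_refl]

lemma prv_Foralls_inst:
  "prv T H (ren e ((Forall ^^ n) p)) \<Longrightarrow> prv T H (ren (\<lambda>i. if i < n then g i else e (i - n)) p)"
proof (induction n arbitrary: e)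
  case 0
  then show ?case by simp
next
  case (Suc n)
  \<comment> \<open>The outermost of the n + 1 quantifiers binds variable n of \<open>p\<close>,
    hence the value \<open>g n\<close>. The other n quantifiers are left to the induction
    hypothesis, with this value put into the environment.\<close>
  have "prv T H (ren (case_nat (g n) (\<lambda>i. i)) (ren (up_var e) ((Forall ^^ n) p)))"
    using Suc.prems by (auto intro: prv.forallE)
  also have "case_nat (g n) (\<lambda>i. i) \<circ> up_var e = case_nat (g n) e"
    by (auto simp: up_var_def fun_eq_iff split: nat.splits)
  then have "ren (case_nat (g n) (\<lambda>i. i)) (ren (up_var e) ((Forall ^^ n) p))
      = ren (case_nat (g n) e) ((Forall ^^ n) p)" by (simp add: ren_ren)
  finally have "prv T H (ren (\<lambda>i. if i < n then g i else case_nat (g n) e (i - n)) p)"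
    by (rule Suc.IH)
  also have "(\<lambda>i. if i < n then g i else case_nat (g n) e (i - n))
      = (\<lambda>i. if i < Suc n then g i else e (i - Suc n))"
    by (auto simp: fun_eq_iff less_Suc_eq not_less split: nat.split)
      (metis Suc_diff_Suc Suc_le_eq diff_Suc_Suc diff_self_eq_0 le_neq_implies_less nat.inject not_less_eq_eq)+
  finally show ?case .
qed

text \<open>\<open>forallI\<close> replaces \<open>H\<close> by its shift and leaves
  \<open>T\<close> alone, so an induction on the number of quantifiers needs \<open>p\<close> to be
  provable from every \<open>H\<close>.\<close>

lemma prv_Foralls: "(\<And>H. prv T H p) \<Longrightarrow> prv T H ((Forall ^^ n) p)"
  by (induction n arbitrary: H) (auto intro: prv.forallI)

text \<open>The rule \<open>axiom\<close> yields an axiom only as it is written. Its finitely many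
  free variables are quantified, which is allowed because \<open>T\<close> is never shifted, and
  then instantiated by \<open>f\<close>. This is the base case for renaming whole
  derivations.\<close>

lemma prv_axiom_ren:
  assumes "p \<in> T"
  shows "prv T H (ren f p)"
proof -
  obtain n where n: "\<And>i. i \<in> free_vars p \<Longrightarrow> i < n"
    using finite_free_vars[of p] by (meson finite_nat_set_iff_bounded)
  have "prv T H (ren (\<lambda>i. i) ((Forall ^^ n) p))"
    unfolding ren_ident by (rule prv_Foralls) (rule prv.axiom[OF assms])
  then have "prv T H (ren (\<lambda>i. if i < n then f i else (i - n)) p)"
    by (rule prv_Foralls_inst)
  also have "ren (\<lambda>i. if i < n then f i else (i - n)) p = ren f p"
    by (rule ren_cong) (simp add: n)
  finally show ?thesis .
qed

lemma up_var_Suc: "up_var f \<circ> Suc = Suc \<circ> f"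
  by (simp add: fun_eq_iff)

lemma ren_inst_var: "ren f (inst_var t p) = inst_var (f t) (ren (up_var f) p)"
  by (auto simp: ren_ren intro!: ren_cong split: nat.splits)

lemma map_ren_Suc: "map (ren (up_var f)) (map (ren Suc) H) = map (ren Suc) (map (ren f) H)"
  by (simp add: ren_ren up_var_Suc)

lemma prv_ren: "prv T H p \<Longrightarrow> prv T (map (ren f) H) (ren f p)"
proof (induction arbitrary: f rule: prv.induct)
  case (axiom p H)
  then show ?case by (rule prv_axiom_ren)
next
  case (forallI H p)
  show ?case using forallI.IH[of "up_var f"] by (simp only: map_ren_Suc ren.simps prv.forallI)
next
  case (forallE H p t)
  show ?case using prv.forallE[of T "map (ren f) H" "ren (up_var f) p" "f t"] forallE.IH[of f]
    by (simp only: ren_inst_var ren.simps)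
next
  case (existsI H t p)
  show ?case using prv.existsI[of T "map (ren f) H" "f t" "ren (up_var f) p"] existsI.IH[of f]
    by (simp only: ren_inst_var ren.simps)
next
  case (existsE H p q)
  have "ren (up_var f) (ren Suc q) = ren Suc (ren f q)" by (simp only: ren_ren up_var_Suc)
  then show ?case
    using prv.existsE[of T "map (ren f) H" "ren (up_var f) p" "ren f q"] existsE.IH(1)[of f]
      existsE.IH(2)[of "up_var f"]
    by (simp only: list.map map_ren_Suc ren.simps)
next
  case (equalE H s t p)
  show ?case
    using prv.equalE[of T "map (ren f) H" "f s" "f t" "ren (up_var f) p"] equalE.IH(1)[of f] equalE.IH(2)[of f]
    by (simp only: ren_inst_var ren.simps)
next
  case (hyp p H)
  then show ?case by (simp add: prv.hyp)
next
  case (falsumE H p)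
  show ?case using falsumE.IH[of f] by (simp add: prv.falsumE)
next
  case (conjI H p q)
  show ?case using conjI.IH[of f] by (simp add: prv.conjI)
next
  case (conjE1 H p q)
  show ?case by (rule prv.conjE1) (rule conjE1.IH[of f, simplified])
next
  case (conjE2 H p q)
  show ?case by (rule prv.conjE2) (rule conjE2.IH[of f, simplified])
next
  case (disjI1 H p q)
  show ?case using disjI1.IH[of f] by (simp add: prv.disjI1)
next
  case (disjI2 H q p)
  show ?case using disjI2.IH[of f] by (simp add: prv.disjI2)
next
  case (disjE H p q r)
  show ?case by (rule prv.disjE) (rule disjE.IH[of f, simplified])+
next
  case (implI p H q)
  show ?case using implI.IH[of f] by (simp add: prv.implI)
next
  case (implE H p q)
  show ?case by (rule prv.implE) (rule implE.IH[of f, simplified])+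
next
  case (equalI H t)
  show ?case by (simp add: prv.equalI)
qed

section \<open>Fresh variables and the quantifier rules\<close>

lemma fresh_var: "finite A \<Longrightarrow> \<exists>a :: nat. a \<notin> A"
  by (rule ex_new_if_finite) simp_all

definition free_vars_list :: "fm list \<Rightarrow> nat set" where
  "free_vars_list H = (\<Union>p\<in>set H. free_vars p)"

lemma finite_free_vars_list: "finite (free_vars_list H)"
  by (simp add: free_vars_list_def finite_free_vars)

text \<open>Renames the fresh variable \<open>a\<close> to the variable that the next binder binds.\<close>

definition capture :: "nat \<Rightarrow> nat \<Rightarrow> nat" where
  "capture a i = (if i = a then 0 else Suc i)"

lemma map_ren_capture: "a \<notin> free_vars_list H \<Longrightarrow> map (ren (capture a)) H = map (ren Suc) H"
  by (auto simp: free_vars_list_def capture_def intro!: ren_cong)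

lemma ren_capture: "a \<notin> free_vars p \<Longrightarrow> ren (capture a) p = ren Suc p"
  by (auto simp: capture_def intro!: ren_cong)

text \<open>Freshness of \<open>a\<close> makes opening the body at \<open>a\<close> reversible: the
  only occurrences that \<open>capture a\<close> sends to 0 are those that came from the bound
  variable.\<close>

lemma ren_capture_body:
  assumes "a \<notin> free_vars (ren e (Forall p))"
  shows "ren (capture a) (ren (case_nat a e) p) = ren (up_var e) p"
  unfolding ren_ren
proof (rule ren_cong)
  fix i assume i: "i \<in> free_vars p"
  show "(capture a \<circ> case_nat a e) i = up_var e i"
  proof (cases i)
    case (Suc j)
    then have "e j \<in> free_vars (ren e (Forall p))"
      using i unfolding free_vars_ren by auto
    then show ?thesis using assms Suc by (auto simp: capture_def)
  qed (simp add: capture_def)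
qed

lemma inst_var_up: "inst_var a (ren (up_var e) p) = ren (case_nat a e) p"
  unfolding ren_ren by (rule ren_cong) (simp split: nat.split)

text \<open>Variables are the only terms, and a variable fresh for the hypotheses and the formula is
  generic: renaming it to 0 turns the proof of that one instance into a premise of
  \<open>forallI\<close>.\<close>

lemma prv_Forall_iff: "prv T H (ren e (Forall p)) \<longleftrightarrow> (\<forall>a. prv T H (ren (case_nat a e) p))"
proof
  assume "prv T H (ren e (Forall p))"
  then show "\<forall>a. prv T H (ren (case_nat a e) p)"
    using prv.forallE inst_var_up by (metis ren.simps(7))
next
  assume *: "\<forall>a. prv T H (ren (case_nat a e) p)"
  obtain a where a: "a \<notin> free_vars_list H \<union> free_vars (ren e (Forall p))"
    using fresh_var finite_free_vars_list finite_free_vars by (meson finite_UnI)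
  have "prv T (map (ren (capture a)) H) (ren (capture a) (ren (case_nat a e) p))"
    by (rule prv_ren) (use * in blast)
  then have "prv T (map (ren Suc) H) (ren (up_var e) p)"
    using a by (simp only: map_ren_capture ren_capture_body Un_iff de_Morgan_disj simp_thms)
  then show "prv T H (ren e (Forall p))" by (simp add: prv.forallI)
qed

lemma prv_Exists_elim:
  assumes "prv T H (ren e (Exists p))" and "\<And>a. prv T (ren (case_nat a e) p # H) r"
  shows "prv T H r"
proof -
  \<comment> \<open>\<open>Forall p\<close> stands in for \<open>Exists p\<close>: the two have the
    same free variables, and \<open>ren_capture_body\<close> is phrased with the former.\<close>
  obtain a where a: "a \<notin> free_vars_list H \<union> free_vars (ren e (Forall p)) \<union> free_vars r"
    using fresh_var finite_free_vars_list finite_free_vars by (meson finite_UnI)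
  have "prv T (map (ren (capture a)) (ren (case_nat a e) p # H)) (ren (capture a) r)"
    by (rule prv_ren) (rule assms(2))
  then have "prv T (ren (up_var e) p # map (ren Suc) H) (ren Suc r)"
    using a by (simp only: list.map map_ren_capture ren_capture_body ren_capture Un_iff de_Morgan_disj simp_thms)
  then show ?thesis using assms(1) by (auto intro: prv.existsE)
qed


section \<open>Interpretation of formulas by sets of contexts\<close>

abbreviation extended_by :: "fm list \<Rightarrow> fm list \<Rightarrow> bool" (infix "\<sqsubseteq>" 50) where
  "H \<sqsubseteq> H' \<equiv> set H \<subseteq> set H'"

type_synonym sem = "fm list \<Rightarrow> bool"

text \<open>A formula is interpreted by the set of contexts that prove it. Existential quantifiers and
  disjunctions are interpreted through their elimination rules, since a context that proves them
  need not prove an instance.\<close>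

definition sem_and :: "sem \<Rightarrow> sem \<Rightarrow> sem" where
  "sem_and P Q H \<longleftrightarrow> P H \<and> Q H"

definition sem_imp :: "sem \<Rightarrow> sem \<Rightarrow> sem" where
  "sem_imp P Q H \<longleftrightarrow> (\<forall>H'. H \<sqsubseteq> H' \<longrightarrow> P H' \<longrightarrow> Q H')"

definition sem_iff :: "sem \<Rightarrow> sem \<Rightarrow> sem" where
  "sem_iff P Q = sem_and (sem_imp P Q) (sem_imp Q P)"

definition sem_all :: "(nat \<Rightarrow> sem) \<Rightarrow> sem" where
  "sem_all P H \<longleftrightarrow> (\<forall>a. P a H)"

definition sem_or :: "fm set \<Rightarrow> sem \<Rightarrow> sem \<Rightarrow> sem" where
  "sem_or T P Q H \<longleftrightarrow> (\<forall>H' r. H \<sqsubseteq> H' \<longrightarrow>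
    (\<forall>H''. H' \<sqsubseteq> H'' \<longrightarrow> P H'' \<or> Q H'' \<longrightarrow> prv T H'' r) \<longrightarrow> prv T H' r)"

definition sem_ex :: "fm set \<Rightarrow> (nat \<Rightarrow> sem) \<Rightarrow> sem" where
  "sem_ex T P H \<longleftrightarrow> (\<forall>H' r. H \<sqsubseteq> H' \<longrightarrow>
    (\<forall>a H''. H' \<sqsubseteq> H'' \<longrightarrow> P a H'' \<longrightarrow> prv T H'' r) \<longrightarrow> prv T H' r)"

definition den :: "fm set \<Rightarrow> (nat \<Rightarrow> nat) \<Rightarrow> fm \<Rightarrow> sem" where
  "den T e p H \<longleftrightarrow> prv T H (ren e p)"

definition sem_mem :: "fm set \<Rightarrow> nat \<Rightarrow> nat \<Rightarrow> sem" where
  "sem_mem T a b H \<longleftrightarrow> prv T H (Mem a b)"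

definition sem_eq :: "fm set \<Rightarrow> nat \<Rightarrow> nat \<Rightarrow> sem" where
  "sem_eq T a b H \<longleftrightarrow> prv T H (Equal a b)"

definition sem_false :: "fm set \<Rightarrow> sem" where
  "sem_false T H \<longleftrightarrow> prv T H Falsum"

lemma den_simps [simp]:
  "den T e (Mem i j) = sem_mem T (e i) (e j)"
  "den T e (Equal i j) = sem_eq T (e i) (e j)"
  "den T e Falsum = sem_false T"
  by (simp_all add: fun_eq_iff den_def sem_mem_def sem_eq_def sem_false_def)

lemma den_Conj [simp]: "den T e (Conj p q) = sem_and (den T e p) (den T e q)"
  by (auto simp: fun_eq_iff den_def sem_and_def intro: prv.conjI prv.conjE1 prv.conjE2)

lemma den_Impl [simp]: "den T e (Impl p q) = sem_imp (den T e p) (den T e q)"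
proof (intro HOL.ext iffI)
  fix H assume "den T e (Impl p q) H"
  then show "sem_imp (den T e p) (den T e q) H"
    unfolding den_def sem_imp_def by (metis prv.implE prv_weaken ren.simps(6))
next
  fix H assume "sem_imp (den T e p) (den T e q) H"
  \<comment> \<open>The interpretation is evaluated at the generic extension, whose new hypothesis
    is the antecedent itself.\<close>
  then have "prv T (ren e p # H) (ren e q)"
    unfolding den_def sem_imp_def by (meson list.set_intros(1) prv.hyp set_subset_Cons)
  then show "den T e (Impl p q) H" by (simp add: den_def prv.implI)
qed

lemma den_Forall [simp]: "den T e (Forall p) = sem_all (\<lambda>a. den T (case_nat a e) p)"
  by (simp only: fun_eq_iff den_def sem_all_def prv_Forall_iff simp_thms)

lemma den_Disj [simp]: "den T e (Disj p q) = sem_or T (den T e p) (den T e q)"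
proof (intro HOL.ext iffI)
  fix H assume *: "den T e (Disj p q) H"
  show "sem_or T (den T e p) (den T e q) H"
    unfolding sem_or_def
  proof (intro allI impI)
    fix H' r assume "H \<sqsubseteq> H'"
      and **: "\<forall>H''. H' \<sqsubseteq> H'' \<longrightarrow> den T e p H'' \<or> den T e q H'' \<longrightarrow> prv T H'' r"
    then have "prv T H' (Disj (ren e p) (ren e q))"
      using * prv_weaken by (auto simp: den_def)
    moreover have "prv T (ren e p # H') r"
      using ** by (meson den_def list.set_intros(1) prv.hyp set_subset_Cons)
    moreover have "prv T (ren e q # H') r"
      using ** by (meson den_def list.set_intros(1) prv.hyp set_subset_Cons)
    ultimately show "prv T H' r" by (rule prv.disjE)
  qed
next
  fix H assume *: "sem_or T (den T e p) (den T e q) H"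
  show "den T e (Disj p q) H"
    unfolding den_def by (rule *[unfolded sem_or_def, rule_format]) (auto simp: den_def prv.disjI1 prv.disjI2)
qed

lemma den_Exists [simp]: "den T e (Exists p) = sem_ex T (\<lambda>a. den T (case_nat a e) p)"
proof (intro HOL.ext iffI)
  fix H assume *: "den T e (Exists p) H"
  show "sem_ex T (\<lambda>a. den T (case_nat a e) p) H"
    unfolding sem_ex_def
  proof (intro allI impI)
    fix H' r assume H': "H \<sqsubseteq> H'"
      and **: "\<forall>a H''. H' \<sqsubseteq> H'' \<longrightarrow> den T (case_nat a e) p H'' \<longrightarrow> prv T H'' r"
    show "prv T H' r"
    proof (rule prv_Exists_elim)
      show "prv T H' (ren e (Exists p))" using * H' prv_weaken by (auto simp: den_def)
      show "prv T (ren (case_nat a e) p # H') r" for a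
        using ** by (meson den_def list.set_intros(1) prv.hyp set_subset_Cons)
    qed
  qed
next
  fix H assume *: "sem_ex T (\<lambda>a. den T (case_nat a e) p) H"
  \<comment> \<open>The formula \<open>r\<close> of the elimination clause is taken to be the
    renamed existential formula itself, which every instance proves.\<close>
  show "den T e (Exists p) H"
    unfolding den_def
    by (rule *[unfolded sem_ex_def, rule_format]) (auto simp: den_def inst_var_up intro: prv.existsI)
qed

text \<open>Stable interpretations are those into which existential quantifiers can be eliminated.\<close>

definition persistent :: "sem \<Rightarrow> bool" where
  "persistent P \<longleftrightarrow> (\<forall>H H'. H \<sqsubseteq> H' \<longrightarrow> P H \<longrightarrow> P H')"

definition stable :: "fm set \<Rightarrow> sem \<Rightarrow> bool" where
  "stable T P \<longleftrightarrow> persistent P \<and>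
    (\<forall>F H. sem_ex T F H \<longrightarrow> (\<forall>a H'. H \<sqsubseteq> H' \<longrightarrow> F a H' \<longrightarrow> P H') \<longrightarrow> P H)"

lemma persistentD: "persistent P \<Longrightarrow> P H \<Longrightarrow> H \<sqsubseteq> H' \<Longrightarrow> P H'"
  by (auto simp: persistent_def)

lemma stable_persistent: "stable T P \<Longrightarrow> persistent P"
  by (simp add: stable_def)

lemmas weaken = persistentD[OF stable_persistent]

lemma sem_exE:
  "sem_ex T F H \<Longrightarrow> stable T P \<Longrightarrow> (\<And>a H'. H \<sqsubseteq> H' \<Longrightarrow> F a H' \<Longrightarrow> P H') \<Longrightarrow> P H"
  by (auto simp: stable_def)

lemma sem_exI: "F a H \<Longrightarrow> persistent (F a) \<Longrightarrow> sem_ex T F H"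
  unfolding sem_ex_def by (metis order_refl persistentD)

lemma persistent_ex: "persistent (sem_ex T F)"
  unfolding persistent_def sem_ex_def by (metis subset_trans)

lemma stable_prv: "stable T (\<lambda>H. prv T H p)"
  unfolding stable_def persistent_def
  by (auto intro: prv_weaken simp: sem_ex_def)

lemma stable_atoms [intro, simp]:
  "stable T (sem_mem T a b)" "stable T (sem_eq T a b)" "stable T (sem_false T)" "stable T (den T e p)"
  using stable_prv[of T "Mem a b"] stable_prv[of T "Equal a b"] stable_prv[of T Falsum]
    stable_prv[of T "ren e p"]
  by (simp_all add: sem_mem_def[abs_def] sem_eq_def[abs_def] sem_false_def[abs_def] den_def[abs_def])

lemma stable_and [intro, simp]: "stable T P \<Longrightarrow> stable T Q \<Longrightarrow> stable T (sem_and P Q)"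
  unfolding stable_def persistent_def sem_and_def by blast

lemma stable_all [intro, simp]: "(\<And>a. stable T (P a)) \<Longrightarrow> stable T (sem_all P)"
  unfolding stable_def persistent_def sem_all_def by blast

lemma stable_imp [intro, simp]:
  assumes "stable T P" "stable T Q" shows "stable T (sem_imp P Q)"
  unfolding stable_def
proof (intro HOL.conjI allI impI)
  show "persistent (sem_imp P Q)" by (auto simp: persistent_def sem_imp_def)
  fix F H assume F: "sem_ex T F H" and *: "\<forall>a H'. H \<sqsubseteq> H' \<longrightarrow> F a H' \<longrightarrow> sem_imp P Q H'"
  show "sem_imp P Q H"
    unfolding sem_imp_def
  proof (intro allI impI)
    fix H' assume H': "H \<sqsubseteq> H'" "P H'"
    show "Q H'"
    proof (rule sem_exE[OF persistentD[OF persistent_ex F H'(1)] assms(2)])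
      fix a H'' assume H'': "H' \<sqsubseteq> H''" "F a H''"
      with * H' have "sem_imp P Q H''" by blast
      moreover have "P H''" using weaken[OF assms(1)] H' H'' by blast
      ultimately show "Q H''" by (auto simp: sem_imp_def)
    qed
  qed
qed

lemma stable_iff [intro, simp]: "stable T P \<Longrightarrow> stable T Q \<Longrightarrow> stable T (sem_iff P Q)"
  by (simp add: sem_iff_def)

lemma stable_ex [intro, simp]: "stable T (sem_ex T F)"
  unfolding stable_def
proof (intro HOL.conjI allI impI persistent_ex)
  fix G H assume G: "sem_ex T G H" and *: "\<forall>a H'. H \<sqsubseteq> H' \<longrightarrow> G a H' \<longrightarrow> sem_ex T F H'"
  show "sem_ex T F H"
    unfolding sem_ex_def
  proof (intro allI impI)
    fix H' r assume H': "H \<sqsubseteq> H'"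
      and r: "\<forall>a H''. H' \<sqsubseteq> H'' \<longrightarrow> F a H'' \<longrightarrow> prv T H'' r"
    show "prv T H' r"
    proof (rule sem_exE[OF persistentD[OF persistent_ex G H'] stable_prv])
      fix a H'' assume H'': "H' \<sqsubseteq> H''" "G a H''"
      with * H' have "sem_ex T F H''" by blast
      with r H'' show "prv T H'' r" unfolding sem_ex_def by (meson order_refl subset_trans)
    qed
  qed
qed

lemma sem_orI2: "Q H \<Longrightarrow> persistent Q \<Longrightarrow> sem_or T P Q H"
  unfolding sem_or_def by (metis order_refl persistentD)

text \<open>A disjunction is an existential quantifier over indices, with 0 selecting
  \<open>P\<close> and every other index selecting \<open>Q\<close>; stability is inherited from
  \<open>sem_ex\<close>.\<close>

lemma stable_or [intro, simp]: "stable T (sem_or T P Q)"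
proof -
  have "(\<forall>H''. H' \<sqsubseteq> H'' \<longrightarrow> P H'' \<or> Q H'' \<longrightarrow> prv T H'' r) \<longleftrightarrow>
    (\<forall>a :: nat. \<forall>H''. H' \<sqsubseteq> H'' \<longrightarrow> (if a = 0 then P else Q) H'' \<longrightarrow> prv T H'' r)"
    (is "?L \<longleftrightarrow> ?R") for H' r
  proof
    assume R: ?R
    show ?L using R[rule_format, of _ 0] R[rule_format, of _ 1] by auto
  qed auto
  then have "sem_or T P Q = sem_ex T (\<lambda>a. if a = 0 then P else Q)"
    by (simp add: fun_eq_iff sem_or_def sem_ex_def)
  then show ?thesis by simp
qed


section \<open>Formal spaces in CZF\<close>

context
  fixes T :: "fm set" and \<delta> :: fm
begin

type_synonym sem_cls = "nat \<Rightarrow> sem"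

abbreviation "sem_ext Y K \<equiv> sem_all (\<lambda>x. sem_iff (sem_mem T x Y) (K x))"

definition "sem_subset x y = sem_all (\<lambda>z. sem_imp (sem_mem T z x) (sem_mem T z y))"

definition "sem_upair p x y = sem_ext p (\<lambda>z. sem_or T (sem_eq T z x) (sem_eq T z y))"

definition "sem_pair p x y = sem_ex T (\<lambda>u. sem_ex T (\<lambda>v.
  sem_and (sem_upair u x x) (sem_and (sem_upair v x y) (sem_upair p u v))))"

definition "sem_maps f x y = sem_ex T (\<lambda>p. sem_and (sem_mem T p f) (sem_pair p x y))"

text \<open>All indices from 1 on are sent to Y. For \<delta> with free variables among 0 and 1 this
  is its instance at a and Y, and the environment keeps the shape \<open>case_nat a e\<close> in
  which equals can be substituted for a.\<close>

definition "sem_cover_set a Y = den T (case_nat a (\<lambda>_. Y)) \<delta>"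

definition "sem_cover a K = sem_ex T (\<lambda>Y. sem_and (sem_ext Y K) (sem_cover_set a Y))"

definition "sem_set U = (\<lambda>x. sem_mem T x U)"

definition sem_empty :: sem_cls where "sem_empty = (\<lambda>x. sem_false T)"

abbreviation "sem_null S z \<equiv> sem_and (sem_mem T z S) (sem_cover z sem_empty)"

definition "sem_single a = (\<lambda>x. sem_eq T x a)"

definition "sem_covers K L = sem_all (\<lambda>u. sem_imp (K u) (sem_cover u L))"

definition "sem_down S K L = (\<lambda>d. sem_and (sem_mem T d S) (sem_and
    (sem_ex T (\<lambda>u. sem_and (K u) (sem_cover d (sem_single u))))
    (sem_ex T (\<lambda>v. sem_and (L v) (sem_cover d (sem_single v))))))"

definition "sem_compl S K = (\<lambda>a. sem_and (sem_mem T a S)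
    (sem_covers (sem_down S (sem_single a) K) sem_empty))"

definition "sem_dneg S a K = sem_covers (sem_compl S (sem_compl S (sem_single a)))
    (sem_compl S (sem_compl S K))"

definition "sem_space S = sem_and
  (sem_all (\<lambda>a. sem_all (\<lambda>U. sem_imp (sem_mem T a S) (sem_imp (sem_subset U S)
    (sem_imp (sem_mem T a U) (sem_cover a (sem_set U)))))))
  (sem_and
  (sem_all (\<lambda>a. sem_all (\<lambda>U. sem_all (\<lambda>V. sem_imp (sem_mem T a S) (sem_imp (sem_subset U S)
    (sem_imp (sem_subset V S) (sem_imp (sem_cover a (sem_set U))
      (sem_imp (sem_covers (sem_set U) (sem_set V)) (sem_cover a (sem_set V))))))))))
  (sem_and
  (sem_all (\<lambda>a. sem_all (\<lambda>U. sem_all (\<lambda>V. sem_imp (sem_mem T a S) (sem_imp (sem_subset U S)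
    (sem_imp (sem_subset V S) (sem_imp (sem_cover a (sem_set U)) (sem_imp (sem_cover a (sem_set V))
      (sem_cover a (sem_down S (sem_set U) (sem_set V)))))))))))
  (sem_all (\<lambda>U. sem_imp (sem_subset U S)
    (sem_ex T (\<lambda>Y. sem_ext Y (\<lambda>a. sem_and (sem_mem T a S) (sem_cover a (sem_set U)))))))))"

definition "sem_nontrivial S = sem_imp (sem_covers (sem_set S) sem_empty) (sem_false T)"

text \<open>The values of the presentation at a: V is C(a, i) for some i in I(a). Splitting this off
  from \<open>sem_basic_cover\<close> leaves V as the witness that uniformity is going to
  fix.\<close>

definition "sem_index I F a V = sem_ex T (\<lambda>A. sem_ex T (\<lambda>i. sem_ex T (\<lambda>p.
    sem_and (sem_maps I a A) (sem_and (sem_mem T i A) (sem_and (sem_pair p a i) (sem_maps F p V))))))"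

definition "sem_basic_cover I F a U = sem_ex T (\<lambda>A. sem_ex T (\<lambda>i. sem_ex T (\<lambda>p. sem_ex T (\<lambda>V.
    sem_and (sem_maps I a A) (sem_and (sem_mem T i A) (sem_and (sem_pair p a i)
      (sem_and (sem_maps F p V) (sem_subset V U))))))))"

definition "sem_presented S = sem_ex T (\<lambda>I. sem_ex T (\<lambda>D. sem_ex T (\<lambda>F.
    sem_all (\<lambda>a. sem_all (\<lambda>U. sem_imp (sem_mem T a S) (sem_imp (sem_subset U S)
      (sem_iff (sem_dneg S a (sem_set U)) (sem_basic_cover I F a U))))))))"

lemmas hoas_defs = fmem_def feq_def ffalse_def fand_def f_or_def fimp_def fiff_def fnot_def
  fall_def fex_def is_empty_def is_succ_def subseteq_def is_upair_def is_pair_def maps_to_def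
  is_function_def set_cls_def empty_cls_def single_cls_def covers_def down_cls_def
  pseudocompl_def formal_space_def nontrivial_def dneg_cover_def set_presented_def

lemmas sem_defs = sem_subset_def sem_upair_def sem_pair_def sem_maps_def sem_cover_def sem_set_def
  sem_empty_def sem_single_def sem_covers_def sem_down_def sem_compl_def sem_dneg_def sem_space_def
  sem_nontrivial_def sem_index_def sem_basic_cover_def sem_presented_def sem_iff_def

lemma den_ren: "den T e (ren f p) = den T (e \<circ> f) p"
  by (simp add: fun_eq_iff den_def ren_ren)

lemma den_cong: "(\<And>i. i \<in> free_vars p \<Longrightarrow> e i = e' i) \<Longrightarrow> den T e p = den T e' p"
  by (simp add: fun_eq_iff den_def ren_cong[of p e e'])

lemma den_inst_closed:
  assumes "free_vars \<delta> \<subseteq> {0, 1}"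
  shows "den T e (inst \<delta> [x, y] n) = sem_cover_set (e (x n)) (e (y n))"
  unfolding inst_def den_ren sem_cover_set_def by (rule den_cong) (use assms in auto)

lemma sem_ex_mono: "sem_ex T P H \<Longrightarrow> (\<And>a H'. P a H' \<Longrightarrow> Q a H') \<Longrightarrow> sem_ex T Q H"
  unfolding sem_ex_def by meson

context
  assumes \<delta>: "free_vars \<delta> \<subseteq> {0, 1}"
begin

text \<open>\<open>\<lambda>m. m - Suc 0\<close> is the variable that \<open>fex\<close> supplies
  for an outermost binder, and the formula is taken at depth 1. This is how the property occurs
  inside \<open>proves_of\<close>, with s as the value of the bound variable.\<close>

lemma den_formal_space:
  "den T (case_nat s e) (formal_space (\<lambda>m. m - Suc 0) (cover_of \<delta>) (Suc 0)) = sem_space s"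
  by (simp add: hoas_defs cover_of_def den_inst_closed[OF \<delta>] sem_defs)

lemma den_nontrivial:
  "den T (case_nat s e) (nontrivial (\<lambda>m. m - Suc 0) (cover_of \<delta>) (Suc 0)) = sem_nontrivial s"
  by (simp add: hoas_defs cover_of_def den_inst_closed[OF \<delta>] sem_defs)

lemma den_set_presented:
  assumes "den T (case_nat s e) (set_presented (\<lambda>m. m - Suc 0) (dneg_cover (\<lambda>m. m - Suc 0) (cover_of \<delta>)) (Suc 0)) H"
  shows "sem_presented s H"
  using assms unfolding sem_presented_def set_presented_def fex_def fand_def den_Exists den_Conj
  by (elim sem_ex_mono) (simp add: hoas_defs cover_of_def den_inst_closed[OF \<delta>],
      simp add: sem_defs, simp add: sem_and_def)

end

lemma den_inst1: "den T e (inst p [x] n) = den T (case_nat (e (x n)) (\<lambda>i. e (n + i))) p"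
  unfolding inst_def den_ren by (rule den_cong) (auto split: nat.split)

lemma den_inst2:
  "den T e (inst p [x, y] n) = den T (case_nat (e (x n)) (case_nat (e (y n)) (\<lambda>i. e (n + i)))) p"
  unfolding inst_def den_ren
  by (rule den_cong) (auto split: nat.split simp: less_Suc_eq numeral_2_eq_2)

section \<open>Reasoning rules for the interpretation\<close>

lemma sem_impD: "sem_imp P Q H \<Longrightarrow> H \<sqsubseteq> H' \<Longrightarrow> P H' \<Longrightarrow> Q H'"
  by (auto simp: sem_imp_def)

lemma sem_impI: "(\<And>H'. H \<sqsubseteq> H' \<Longrightarrow> P H' \<Longrightarrow> Q H') \<Longrightarrow> sem_imp P Q H"
  by (auto simp: sem_imp_def)

lemma sem_mp: "sem_imp P Q H \<Longrightarrow> P H \<Longrightarrow> Q H"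
  by (auto simp: sem_imp_def)

lemma sem_allD: "sem_all P H \<Longrightarrow> P a H"
  by (simp add: sem_all_def)

lemma sem_extD: "sem_ext Y K H \<Longrightarrow> H \<sqsubseteq> H' \<Longrightarrow> sem_mem T x Y H' \<longleftrightarrow> K x H'"
  by (auto simp: sem_all_def sem_iff_def sem_and_def sem_imp_def)

lemma sem_extI: "(\<And>x H'. H \<sqsubseteq> H' \<Longrightarrow> sem_mem T x Y H' \<longleftrightarrow> K x H') \<Longrightarrow> sem_ext Y K H"
  by (auto simp: sem_all_def sem_iff_def sem_and_def sem_imp_def)

lemma persistent_imp: "persistent (sem_imp P Q)"
  by (auto simp: persistent_def sem_imp_def)

lemma persistent_and: "persistent P \<Longrightarrow> persistent Q \<Longrightarrow> persistent (sem_and P Q)"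
  by (auto simp: persistent_def sem_and_def)

lemma persistent_all: "(\<And>a. persistent (P a)) \<Longrightarrow> persistent (sem_all P)"
  unfolding persistent_def sem_all_def by blast

lemma persistent_ext: "persistent (sem_ext Y K)"
  by (simp add: persistent_all persistent_and persistent_imp sem_iff_def)

lemma sem_eq_refl: "sem_eq T a a H"
  by (simp add: sem_eq_def prv.equalI)

lemma sem_false_elim: "sem_false T H \<Longrightarrow> den T e p H"
  by (simp add: sem_false_def den_def prv.falsumE)

lemma sem_eq_subst:
  assumes "sem_eq T a b H" "den T (case_nat b e) p H"
  shows "den T (case_nat a e) p H"
proof -
  have inst: "inst_var c (ren (case_nat 0 (\<lambda>i. Suc (e i))) p) = ren (case_nat c e) p" for c
    unfolding ren_ren by (rule ren_cong) (simp split: nat.split)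
  \<comment> \<open>Symmetry of equality: \<open>equalE\<close> rewrites from left to right only,
    and rewriting the first argument of a = a along a = b gives b = a.\<close>
  have "prv T H (inst_var a (Equal 0 (Suc a)))"
    by (simp add: prv.equalI)
  then have "prv T H (inst_var b (Equal 0 (Suc a)))"
    using assms(1) prv.equalE[of T H a b "Equal 0 (Suc a)"] by (simp add: sem_eq_def)
  then have "prv T H (Equal b a)" by simp
  then show ?thesis
    using assms(2) prv.equalE[of T H b a "ren (case_nat 0 (\<lambda>i. Suc (e i))) p"]
    by (simp add: den_def inst)
qed

lemma sem_coverI:
  "sem_ext Y K H \<Longrightarrow> sem_cover_set a Y H \<Longrightarrow> sem_cover a K H"
  unfolding sem_cover_def
  by (rule sem_exI[of _ Y])
    (simp_all add: sem_and_def[of _ _ H] sem_cover_set_def persistent_and persistent_ext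
      stable_persistent[of T "den T e p" for e p])

lemma stable_cover [intro, simp]: "stable T (sem_cover a K)"
  by (simp add: sem_cover_def)

lemma sem_coverE:
  assumes "sem_cover a K H" "stable T P"
    and "\<And>Y H'. H \<sqsubseteq> H' \<Longrightarrow> sem_ext Y K H' \<Longrightarrow> sem_cover_set a Y H' \<Longrightarrow> P H'"
  shows "P H"
  by (rule sem_exE[OF assms(1)[unfolded sem_cover_def] assms(2)]) (auto simp: sem_and_def[of _ _ "_ :: fm list"] intro: assms(3))

text \<open>A class is covered through some set with the same members, so the set found for K also
  serves for L.\<close>

lemma sem_cover_cong:
  assumes "sem_cover a K H" and "\<And>x H'. H \<sqsubseteq> H' \<Longrightarrow> K x H' \<longleftrightarrow> L x H'"
  shows "sem_cover a L H"
proof (rule sem_coverE[OF assms(1) stable_cover])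
  fix Y H' assume H': "H \<sqsubseteq> H'" and Y: "sem_ext Y K H'" "sem_cover_set a Y H'"
  show "sem_cover a L H'"
  proof (rule sem_coverI[OF sem_extI Y(2)])
    fix x H'' assume "H' \<sqsubseteq> H''"
    then show "sem_mem T x Y H'' \<longleftrightarrow> L x H''"
      using sem_extD[OF Y(1), of H''] assms(2)[of H''] H' by blast
  qed
qed

lemma sem_cover_subst:
  assumes "sem_eq T u v H" "sem_cover v K H"
  shows "sem_cover u K H"
proof (rule sem_coverE[OF assms(2) stable_cover])
  fix Y H' assume H': "H \<sqsubseteq> H'" and Y: "sem_ext Y K H'" "sem_cover_set v Y H'"
  have "sem_eq T u v H'" by (rule weaken[OF stable_atoms(2) assms(1) H'])
  then show "sem_cover u K H'"
    using sem_coverI[OF Y(1), of u] sem_eq_subst[of u v H' "\<lambda>_. Y" \<delta>] Y(2)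
    by (simp add: sem_cover_set_def)
qed

lemma stable_classes [intro, simp]:
  "stable T (sem_subset x y)" "stable T (sem_set U x)" "stable T (sem_empty x)"
  "stable T (sem_single a x)"
  "stable T (sem_upair x y z)" "stable T (sem_pair x y z)" "stable T (sem_maps x y z)"
  by (auto simp: sem_subset_def sem_set_def sem_empty_def sem_single_def sem_upair_def sem_pair_def sem_maps_def)

lemma stable_covers [intro, simp]: "(\<And>x. stable T (K x)) \<Longrightarrow> stable T (sem_covers K L)"
  by (auto simp: sem_covers_def)

lemma stable_down [intro, simp]: "stable T (sem_down S K L d)"
  by (auto simp: sem_down_def)

lemma stable_compl [intro, simp]: "stable T (sem_compl S K d)"
  by (auto simp: sem_compl_def)

lemma stable_space [intro, simp]: "stable T (sem_space S)"
  unfolding sem_space_def by (intro stable_and stable_all stable_imp stable_ex stable_cover stable_covers stable_classes stable_atoms)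

section \<open>Axioms of CZF and the uniformity principle in the interpretation\<close>

context
  assumes CZF: "CZF \<subseteq> T" and GUP: "GUP_CZF \<subseteq> T"
begin

lemma den_axiom: "p \<in> T \<Longrightarrow> den T e p H"
  by (simp add: den_def prv_axiom_ren)

lemma sem_separation:
  assumes "bounded_fm p"
  shows "sem_ex T (\<lambda>b. sem_ext b (\<lambda>x. sem_and (sem_mem T x a) (den T (case_nat x e) p))) H"
proof -
  have "den T e (separation p 0) H"
    by (rule den_axiom) (use assms CZF in \<open>auto simp: CZF_def\<close>)
  also have "den T e (separation p 0) = sem_all (\<lambda>a. sem_ex T (\<lambda>b. sem_ext b
      (\<lambda>x. sem_and (sem_mem T x a) (den T (case_nat x e) p))))"
    by (simp add: separation_def hoas_defs den_inst1 sem_iff_def)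
  finally show ?thesis by (rule sem_allD)
qed

lemma sem_pairing: "sem_ex T (\<lambda>z. sem_and (sem_mem T x z) (sem_mem T y z)) H"
proof -
  have "den T (\<lambda>i. i) (pairing 0) H"
    by (rule den_axiom) (use CZF in \<open>auto simp: CZF_def\<close>)
  also have "den T (\<lambda>i. i) (pairing 0) = sem_all (\<lambda>x. sem_all (\<lambda>y. sem_ex T (\<lambda>z. sem_and (sem_mem T x z) (sem_mem T y z))))"
    by (simp add: pairing_def hoas_defs)
  finally show ?thesis by (simp add: sem_all_def)
qed

abbreviation "sem_in_union z x \<equiv> sem_ex T (\<lambda>w. sem_and (sem_mem T w x) (sem_mem T z w))"

lemma sem_union: "sem_ex T (\<lambda>y. sem_ext y (\<lambda>z. sem_in_union z x)) H"
proof -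
  have "den T (\<lambda>i. i) (union 0) H"
    by (rule den_axiom) (use CZF in \<open>auto simp: CZF_def\<close>)
  also have "den T (\<lambda>i. i) (union 0) = sem_all (\<lambda>x. sem_ex T (\<lambda>y. sem_ext y (\<lambda>z. sem_in_union z x)))"
    by (simp add: union_def hoas_defs sem_iff_def)
  finally show ?thesis by (simp add: sem_all_def)
qed

text \<open>Uniformity is a scheme over formulas, so a relation between interpreted notions has to
  be exhibited as the denotation of some \<open>p\<close>. The uniform variable is index 0, the
  witness is index 1, and \<open>e\<close> carries the parameters.\<close>

lemma sem_GUP:
  assumes "sem_all (\<lambda>x. sem_ex T (\<lambda>y. sem_and (sem_mem T y I) (den T (case_nat x (case_nat y e)) p))) H"
  shows "sem_ex T (\<lambda>y. sem_and (sem_mem T y I) (sem_all (\<lambda>x. den T (case_nat x (case_nat y e)) p))) H"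
proof -
  let ?g = "(\<^bold>\<forall>I. (\<^bold>\<forall>x. \<^bold>\<exists>y. y \<^bold>\<in> I \<^bold>\<and> inst p [x, y]) \<^bold>\<longrightarrow>
    (\<^bold>\<exists>y. y \<^bold>\<in> I \<^bold>\<and> (\<^bold>\<forall>x. inst p [x, y]))) 0"
  have "den T e ?g H"
    by (rule den_axiom) (use GUP in \<open>auto simp: GUP_CZF_def\<close>)
  also have "den T e ?g = sem_all (\<lambda>I. sem_imp
      (sem_all (\<lambda>x. sem_ex T (\<lambda>y. sem_and (sem_mem T y I) (den T (case_nat x (case_nat y e)) p))))
      (sem_ex T (\<lambda>y. sem_and (sem_mem T y I) (sem_all (\<lambda>x. den T (case_nat x (case_nat y e)) p)))))"
    by (simp add: hoas_defs den_inst2)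
  finally show ?thesis using assms sem_mp sem_allD[of _ H I] by blast
qed

lemmas weaken_sem = weaken[OF stable_space] weaken[OF stable_cover] weaken[OF stable_atoms(1)]

text \<open>Pairing only provides a set that has a among its elements; the singleton is cut out of
  it by separation with the bounded formula x = a.\<close>

lemma sem_singleton_set: "sem_ex T (\<lambda>y. sem_ext y (sem_single a)) H"
proof (rule sem_exE[OF sem_pairing stable_ex])
  fix z H1 assume H1: "H \<sqsubseteq> H1" and z: "sem_and (sem_mem T a z) (sem_mem T a z) H1"
  have "sem_ex T (\<lambda>b. sem_ext b (\<lambda>x. sem_and (sem_mem T x z)
      (den T (case_nat x (\<lambda>_. a)) (Equal 0 (Suc 0))))) H1"
    by (rule sem_separation) (rule bounded_fm.intros)
  then show "sem_ex T (\<lambda>y. sem_ext y (sem_single a)) H1"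
  proof (rule sem_exE[OF _ stable_ex])
    fix b H2 assume H2: "H1 \<sqsubseteq> H2"
      and b: "sem_ext b (\<lambda>x. sem_and (sem_mem T x z) (den T (case_nat x (\<lambda>_. a)) (Equal 0 (Suc 0)))) H2"
    have "sem_ext b (sem_single a) H2"
    proof (rule sem_extI)
      fix x H3 assume H3: "H2 \<sqsubseteq> H3"
      have "sem_mem T a z H3"
        using z H2 H3 by (auto simp: sem_and_def intro: weaken[OF stable_atoms(1)])
      then have "sem_mem T x z H3" if "sem_eq T x a H3"
        using sem_eq_subst[OF that, of "\<lambda>_. z" "Mem 0 (Suc 0)"] by simp
      then show "sem_mem T x b H3 \<longleftrightarrow> sem_single a x H3"
        by (auto simp: sem_extD[OF b H3] sem_and_def sem_single_def)
    qed
    then show "sem_ex T (\<lambda>y. sem_ext y (sem_single a)) H2"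
      by (rule sem_exI) (rule persistent_ext)
  qed
qed

text \<open>Separation by \<open>Falsum\<close> from an arbitrary set; since every index denotes a
  set, one is always available.\<close>

lemma sem_empty_set: "sem_ex T (\<lambda>y. sem_ext y sem_empty) H"
proof -
  have "sem_ex T (\<lambda>b. sem_ext b (\<lambda>x. sem_and (sem_mem T x a) (den T (case_nat x (\<lambda>_. a)) Falsum))) H" for a
    by (rule sem_separation) (rule bounded_fm.intros)
  then show ?thesis
  proof (rule sem_exE[OF _ stable_ex])
    fix a b H2
    assume b: "sem_ext b (\<lambda>x. sem_and (sem_mem T x a) (den T (case_nat x (\<lambda>_. a)) Falsum)) H2"
    have "sem_ext b sem_empty H2"
    proof (rule sem_extI)
      fix x H3 assume H3: "H2 \<sqsubseteq> H3"
      have "sem_mem T x a H3" if "sem_false T H3"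
        using sem_false_elim[OF that, of "case_nat x (\<lambda>_. a)" "Mem 0 (Suc 0)"] by simp
      then show "sem_mem T x b H3 \<longleftrightarrow> sem_empty x H3"
        by (auto simp: sem_extD[OF b H3] sem_and_def sem_empty_def)
    qed
    then show "sem_ex T (\<lambda>y. sem_ext y sem_empty) H2"
      by (rule sem_exI) (rule persistent_ext)
  qed
qed

lemma sem_mem_subst: "sem_eq T x a H \<Longrightarrow> sem_mem T a z H \<Longrightarrow> sem_mem T x z H"
  using sem_eq_subst[of x a H "\<lambda>_. z" "Mem 0 (Suc 0)"] by simp

section \<open>Null points, pseudocomplements and the double negation cover in CZF\<close>

lemma sem_subsetI:
  "(\<And>z H'. H \<sqsubseteq> H' \<Longrightarrow> sem_mem T z x H' \<Longrightarrow> sem_mem T z y H') \<Longrightarrow> sem_subset x y H"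
  by (auto simp: sem_subset_def sem_all_def intro: sem_impI)

lemma sem_subsetD:
  "sem_subset x y H \<Longrightarrow> H \<sqsubseteq> H' \<Longrightarrow> sem_mem T z x H' \<Longrightarrow> sem_mem T z y H'"
  by (auto simp: sem_subset_def sem_all_def dest: sem_impD)

lemma sem_coversI:
  "(\<And>u H'. H \<sqsubseteq> H' \<Longrightarrow> K u H' \<Longrightarrow> sem_cover u L H') \<Longrightarrow> sem_covers K L H"
  by (auto simp: sem_covers_def sem_all_def intro: sem_impI)

lemma sem_coversD:
  "sem_covers K L H \<Longrightarrow> H \<sqsubseteq> H' \<Longrightarrow> K u H' \<Longrightarrow> sem_cover u L H'"
  by (auto simp: sem_covers_def sem_all_def dest: sem_impD)

lemma sem_cover_refl:
  "sem_space S H \<Longrightarrow> sem_mem T a S H \<Longrightarrow> sem_subset U S H \<Longrightarrow> sem_mem T a U H \<Longrightarrow> sem_cover a (sem_set U) H"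
  unfolding sem_space_def sem_and_def sem_all_def by (blast dest: sem_mp)

lemma sem_cover_trans:
  "sem_space S H \<Longrightarrow> sem_mem T a S H \<Longrightarrow> sem_subset U S H \<Longrightarrow> sem_subset V S H \<Longrightarrow>
    sem_cover a (sem_set U) H \<Longrightarrow> sem_covers (sem_set U) (sem_set V) H \<Longrightarrow> sem_cover a (sem_set V) H"
  unfolding sem_space_def sem_and_def[of _ _ H] sem_all_def by (blast dest: sem_mp)

lemma sem_single_self: "sem_single v v H"
  by (simp add: sem_single_def sem_eq_refl)

text \<open>Reflexivity of covers is stated for sets, whereas \<open>sem_single v\<close> is a
  class; the class is first realised by a set and replaced again afterwards.\<close>

lemma sem_cover_self:
  assumes S: "sem_space S H" and v: "sem_mem T v S H"
  shows "sem_cover v (sem_single v) H"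
proof (rule sem_exE[OF sem_singleton_set stable_cover])
  fix Y H1 assume H1: "H \<sqsubseteq> H1" and Y: "sem_ext Y (sem_single v) H1"
  have "sem_cover v (sem_set Y) H1"
  proof (rule sem_cover_refl)
    show "sem_space S H1" "sem_mem T v S H1" using S v H1 by (meson weaken_sem subset_trans)+
    show "sem_subset Y S H1"
    proof (rule sem_subsetI)
      fix z H2 assume H2: "H1 \<sqsubseteq> H2" "sem_mem T z Y H2"
      then have "sem_eq T z v H2" using sem_extD[OF Y] by (auto simp: sem_single_def)
      then show "sem_mem T z S H2" by (rule sem_mem_subst) (use v H1 H2 in \<open>meson weaken_sem subset_trans\<close>)
    qed
    show "sem_mem T v Y H1" using sem_extD[OF Y order_refl, of v] by (simp add: sem_single_def sem_eq_refl)
  qed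
  then show "sem_cover v (sem_single v) H1"
    by (rule sem_cover_cong) (use sem_extD[OF Y] in \<open>auto simp: sem_set_def\<close>)
qed

text \<open>Transitivity with the empty set as target. The cover of a by K itself supplies a set
  with the members of K, and the assumption on K places that set inside S.\<close>

lemma sem_cover_null_trans:
  assumes S: "sem_space S H" and a: "sem_mem T a S H" and K: "sem_cover a K H"
    and null: "\<And>u H'. H \<sqsubseteq> H' \<Longrightarrow> K u H' \<Longrightarrow> sem_mem T u S H' \<and> sem_cover u sem_empty H'"
  shows "sem_cover a sem_empty H"
proof (rule sem_coverE[OF K stable_cover])
  fix Y H1 assume H1: "H \<sqsubseteq> H1" and Y: "sem_ext Y K H1" "sem_cover_set a Y H1"
  show "sem_cover a sem_empty H1"
  proof (rule sem_exE[OF sem_empty_set stable_cover])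
    fix E H2 assume H2: "H1 \<sqsubseteq> H2" and E: "sem_ext E sem_empty H2"
    have YK: "sem_mem T x Y H' \<longleftrightarrow> K x H'" if "H2 \<sqsubseteq> H'" for x H'
      using sem_extD[OF Y(1)] that H2 by blast
    have "sem_cover a (sem_set E) H2"
    proof (rule sem_cover_trans)
      show "sem_space S H2" "sem_mem T a S H2" using S a H1 H2 by (meson weaken_sem subset_trans)+
      show "sem_subset Y S H2"
        by (rule sem_subsetI) (use YK null H1 H2 in blast)
      show "sem_subset E S H2"
      proof (rule sem_subsetI)
        fix z H3 assume "H2 \<sqsubseteq> H3" "sem_mem T z E H3"
        then have "sem_false T H3" using sem_extD[OF E] by (auto simp: sem_empty_def)
        then show "sem_mem T z S H3"
          using sem_false_elim[of H3 "case_nat z (\<lambda>_. S)" "Mem 0 (Suc 0)"] by simp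
      qed
      have "sem_cover a K H2" by (rule weaken_sem(2)[OF sem_coverI[OF Y] H2])
      then show "sem_cover a (sem_set Y) H2"
        by (rule sem_cover_cong) (simp add: YK sem_set_def)
      show "sem_covers (sem_set Y) (sem_set E) H2"
      proof (rule sem_coversI)
        fix u H3 assume H3: "H2 \<sqsubseteq> H3" "sem_set Y u H3"
        then have "sem_cover u sem_empty H3" using YK null[of H3 u] H1 H2 by (auto simp: sem_set_def)
        then show "sem_cover u (sem_set E) H3"
          by (rule sem_cover_cong) (use sem_extD[OF E] H3 in \<open>auto simp: sem_set_def\<close>)
      qed
    qed
    then show "sem_cover a sem_empty H2"
      by (rule sem_cover_cong) (use sem_extD[OF E] in \<open>auto simp: sem_set_def\<close>)
  qed
qed

text \<open>Such a d is covered by the singleton of some v in K, and this v is covered by the empty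
  set.\<close>

lemma sem_down_null:
  assumes S: "sem_space S H" and d: "sem_down S L K d H"
    and K: "\<And>v H'. H \<sqsubseteq> H' \<Longrightarrow> K v H' \<Longrightarrow> sem_mem T v S H' \<and> sem_cover v sem_empty H'"
  shows "sem_cover d sem_empty H"
proof -
  have d: "sem_mem T d S H" "sem_ex T (\<lambda>v. sem_and (K v) (sem_cover d (sem_single v))) H"
    using d by (simp_all add: sem_down_def sem_and_def)
  show ?thesis
  proof (rule sem_exE[OF d(2) stable_cover])
    fix v H1 assume H1: "H \<sqsubseteq> H1" and "sem_and (K v) (sem_cover d (sem_single v)) H1"
    then have v: "K v H1" "sem_cover d (sem_single v) H1" by (simp_all add: sem_and_def)
    show "sem_cover d sem_empty H1"
    proof (rule sem_cover_null_trans[of S _ _ "sem_single v"])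
      show "sem_space S H1" "sem_mem T d S H1" using S d H1 by (meson weaken_sem subset_trans)+
      show "sem_cover d (sem_single v) H1" by fact
      fix u H2 assume H2: "H1 \<sqsubseteq> H2" "sem_single v u H2"
      have "sem_mem T v S H2" "sem_cover v sem_empty H2"
        using K[OF H1 v(1)] H2(1) by (meson weaken_sem subset_trans)+
      then show "sem_mem T u S H2 \<and> sem_cover u sem_empty H2"
        using H2(2) by (auto simp: sem_single_def intro: sem_mem_subst sem_cover_subst)
    qed
  qed
qed

text \<open>As v covers itself, it serves as its own witness on both sides of the meet of {v} and K,
  and the points of that meet are null by the definition of K*.\<close>

lemma sem_compl_member_null:
  assumes S: "sem_space S H" and v: "sem_compl S K v H" "K v H" and K: "stable T (K v)"
  shows "sem_cover v sem_empty H"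
proof -
  have vS: "sem_mem T v S H" and *: "sem_covers (sem_down S (sem_single v) K) sem_empty H"
    using v(1) by (simp_all add: sem_compl_def sem_and_def)
  have self: "sem_cover v (sem_single v) H" by (rule sem_cover_self[OF S vS])
  have "sem_down S (sem_single v) K v H"
    unfolding sem_down_def sem_and_def[of _ _ H]
  proof (intro HOL.conjI vS)
    show "sem_ex T (\<lambda>u. sem_and (sem_single v u) (sem_cover v (sem_single u))) H"
      by (rule sem_exI[of _ v]) (auto simp: sem_and_def[of _ _ H] self sem_single_self
          intro!: stable_persistent stable_and)
    show "sem_ex T (\<lambda>u. sem_and (K u) (sem_cover v (sem_single u))) H"
      by (rule sem_exI[of _ v]) (use v(2) self K in \<open>auto simp: sem_and_def[of _ _ H] intro!: stable_persistent stable_and\<close>)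
  qed
  then show ?thesis using sem_coversD[OF *] by blast
qed

text \<open>If K* has only null points, then every point of S meets K* in null points only, so K**
  is all of S.\<close>

lemma sem_dneg_dense:
  assumes S: "sem_space S H" and K: "\<And>v H'. H \<sqsubseteq> H' \<Longrightarrow> sem_compl S K v H' \<Longrightarrow> sem_cover v sem_empty H'"
  shows "sem_dneg S a K H"
  unfolding sem_dneg_def
proof (rule sem_coversI)
  fix u H1 assume H1: "H \<sqsubseteq> H1" and u: "sem_compl S (sem_compl S (sem_single a)) u H1"
  then have uS: "sem_mem T u S H1" by (simp add: sem_compl_def sem_and_def)
  have S1: "sem_space S H1" using S H1 by (meson weaken_sem subset_trans)+
  \<comment> \<open>Reflexivity is applied to the set S, which has the same members as the class
    K**.\<close>
  have "sem_cover u (sem_set S) H1"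
    by (rule sem_cover_refl[OF S1 uS _ uS]) (rule sem_subsetI)
  then show "sem_cover u (sem_compl S (sem_compl S K)) H1"
  proof (rule sem_cover_cong)
    fix x H2 assume H2: "H1 \<sqsubseteq> H2"
    have "sem_covers (sem_down S (sem_single x) (sem_compl S K)) sem_empty H2"
    proof (rule sem_coversI)
      fix d H3 assume H3: "H2 \<sqsubseteq> H3" "sem_down S (sem_single x) (sem_compl S K) d H3"
      show "sem_cover d sem_empty H3"
      proof (rule sem_down_null[OF _ H3(2)])
        show "sem_space S H3" using S H1 H2 H3 by (meson weaken_sem subset_trans)+
        show "sem_mem T v S H' \<and> sem_cover v sem_empty H'"
          if "H3 \<sqsubseteq> H'" "sem_compl S K v H'" for v H'
          using that K[of H' v] H1 H2 H3 by (auto simp: sem_compl_def[of S K] sem_and_def)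
      qed
    qed
    then show "sem_set S x H2 \<longleftrightarrow> sem_compl S (sem_compl S K) x H2"
      by (auto simp: sem_set_def sem_compl_def[of S "sem_compl S K"] sem_and_def[of _ _ H2])
  qed
qed

text \<open>The point a belongs to {a}** and is therefore covered by K**. As K consists of null
  points, K* is all of S, so a point of K** also lies in K* and is null.\<close>

lemma sem_dneg_null:
  assumes S: "sem_space S H" and a: "sem_mem T a S H" and *: "sem_dneg S a K H"
    and K: "\<And>v H'. H \<sqsubseteq> H' \<Longrightarrow> K v H' \<Longrightarrow> sem_mem T v S H' \<and> sem_cover v sem_empty H'"
  shows "sem_cover a sem_empty H"
proof -
  have "sem_covers (sem_down S (sem_single a) (sem_compl S (sem_single a))) sem_empty H"
  proof (rule sem_coversI)
    fix d H1 assume H1: "H \<sqsubseteq> H1" and d: "sem_down S (sem_single a) (sem_compl S (sem_single a)) d H1"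
    then have dS: "sem_mem T d S H1"
      and da: "sem_ex T (\<lambda>u. sem_and (sem_single a u) (sem_cover d (sem_single u))) H1"
      and dv: "sem_ex T (\<lambda>v. sem_and (sem_compl S (sem_single a) v) (sem_cover d (sem_single v))) H1"
      by (simp_all add: sem_down_def sem_and_def[of _ _ H1])
    show "sem_cover d sem_empty H1"
    proof (rule sem_exE[OF dv stable_cover])
      fix v H2 assume H2: "H1 \<sqsubseteq> H2"
        and "sem_and (sem_compl S (sem_single a) v) (sem_cover d (sem_single v)) H2"
      then have v: "sem_covers (sem_down S (sem_single v) (sem_single a)) sem_empty H2"
        and dv: "sem_cover d (sem_single v) H2"
        by (simp_all add: sem_and_def[of _ _ H2] sem_compl_def)
      have "sem_down S (sem_single v) (sem_single a) d H2"
        unfolding sem_down_def sem_and_def[of _ _ H2]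
      proof (intro HOL.conjI)
        show "sem_mem T d S H2" using dS H2 by (meson weaken_sem subset_trans)+
        show "sem_ex T (\<lambda>u. sem_and (sem_single a u) (sem_cover d (sem_single u))) H2"
          by (rule weaken[OF stable_ex da H2])
        show "sem_ex T (\<lambda>u. sem_and (sem_single v u) (sem_cover d (sem_single u))) H2"
          by (rule sem_exI[of _ v]) (auto simp: sem_and_def[of _ _ H2] dv sem_single_self
              intro!: stable_persistent stable_and)
      qed
      then show "sem_cover d sem_empty H2" using sem_coversD[OF v] by blast
    qed
  qed
  then have "sem_compl S (sem_compl S (sem_single a)) a H"
    using a by (simp add: sem_compl_def[of S "sem_compl S (sem_single a)"] sem_and_def)
  then have "sem_cover a (sem_compl S (sem_compl S K)) H"
    using sem_coversD[OF *[unfolded sem_dneg_def]] by blast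
  then show ?thesis
  proof (rule sem_cover_null_trans[OF S a])
    fix u H1 assume H1: "H \<sqsubseteq> H1" and u: "sem_compl S (sem_compl S K) u H1"
    have S1: "sem_space S H1" using S H1 by (meson weaken_sem subset_trans)+
    have uS: "sem_mem T u S H1" using u by (simp add: sem_compl_def[of S "sem_compl S K"] sem_and_def)
    have "sem_covers (sem_down S (sem_single u) K) sem_empty H1"
    proof (rule sem_coversI)
      fix d H2 assume H2: "H1 \<sqsubseteq> H2" "sem_down S (sem_single u) K d H2"
      show "sem_cover d sem_empty H2"
      proof (rule sem_down_null[OF _ H2(2)])
        show "sem_space S H2" using S1 H2 by (meson weaken_sem subset_trans)+
      qed (use K H1 H2 in blast)
    qed
    then have "sem_compl S K u H1" using uS by (simp add: sem_compl_def sem_and_def)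
    then show "sem_mem T u S H1 \<and> sem_cover u sem_empty H1"
      using uS sem_compl_member_null[OF S1 u] by simp
  qed
qed

section \<open>Decisions about propositions represented by sets\<close>

definition inhab_form :: "var \<Rightarrow> form" where
  "inhab_form x = (\<^bold>\<exists>z. z \<^bold>\<in> x \<^bold>\<and> z \<^bold>= z)"

text \<open>Inhabitedness of x is the proposition P, membership in Z is nullity, and k stands for
  the first alternative exactly when it is inhabited. The conjunct z = z in
  \<open>inhab_form\<close> gives the quantifier the shape that \<open>bounded_fm\<close> requires,
  so separation applies to these formulas.\<close>

definition decision_form :: "var \<Rightarrow> var \<Rightarrow> var \<Rightarrow> var \<Rightarrow> form" where
  "decision_form k x z Z =
    ((inhab_form k \<^bold>\<longrightarrow> inhab_form x) \<^bold>\<and> ((\<^bold>\<not> inhab_form k) \<^bold>\<longrightarrow> inhab_form x \<^bold>\<longrightarrow> z \<^bold>\<in> Z))"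

definition decided_form :: "var \<Rightarrow> var \<Rightarrow> var \<Rightarrow> var \<Rightarrow> form" where
  "decided_form B x z Z = (\<^bold>\<exists>k. k \<^bold>\<in> B \<^bold>\<and> decision_form k x z Z)"

definition index_form :: "var \<Rightarrow> var \<Rightarrow> var \<Rightarrow> var \<Rightarrow> form" where
  "index_form I F a V =
    (\<^bold>\<exists>A. \<^bold>\<exists>i. \<^bold>\<exists>p. maps_to I a A \<^bold>\<and> i \<^bold>\<in> A \<^bold>\<and> is_pair p a i \<^bold>\<and> maps_to F p V)"

definition "sem_inhab x = sem_ex T (\<lambda>z. sem_and (sem_mem T z x) (sem_eq T z z))"

definition "sem_decision k x z Z = sem_and (sem_imp (sem_inhab k) (sem_inhab x))
  (sem_imp (sem_imp (sem_inhab k) (sem_false T)) (sem_imp (sem_inhab x) (sem_mem T z Z)))"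

definition "sem_decided B x z Z = sem_ex T (\<lambda>k. sem_and (sem_mem T k B) (sem_decision k x z Z))"

lemmas form_defs = inhab_form_def decision_form_def decided_form_def index_form_def hoas_defs

lemma stable_decision [intro, simp]:
  "stable T (sem_inhab x)" "stable T (sem_decision k x z Z)" "stable T (sem_decided B x z Z)"
  by (auto simp: sem_inhab_def sem_decision_def sem_decided_def)

lemma sem_inhabI: "sem_mem T z x H \<Longrightarrow> sem_inhab x H"
  unfolding sem_inhab_def
  by (rule sem_exI[of _ z]) (auto simp: sem_and_def[of _ _ H] sem_eq_refl intro!: stable_persistent stable_and)

lemma sem_inhab_empty: "sem_ext E sem_empty H \<Longrightarrow> sem_imp (sem_inhab E) (sem_false T) H"
proof (rule sem_impI)
  fix H1 assume E: "sem_ext E sem_empty H" and H1: "H \<sqsubseteq> H1" "sem_inhab E H1"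
  show "sem_false T H1"
    by (rule sem_exE[OF H1(2)[unfolded sem_inhab_def] stable_atoms(3)])
      (use sem_extD[OF E] H1(1) in \<open>auto simp: sem_and_def sem_empty_def\<close>)
qed

lemma sem_decided_uniform:
  assumes "sem_all (\<lambda>x. sem_decided B x z Z) H"
  shows "sem_mem T z Z H"
proof -
  \<comment> \<open>Free variables in the order of \<open>sem_GUP\<close>: 0 is the uniform x, 1 the
    choice k, 2 the point z and 3 the set Z.\<close>
  let ?p = "decision_form (\<lambda>n. Suc n) (\<lambda>n. n) (\<lambda>n. Suc (Suc n)) (\<lambda>n. Suc (Suc (Suc n))) 0"
  let ?e = "case_nat z (\<lambda>_. Z)"
  have p: "den T (case_nat x (case_nat y ?e)) ?p = sem_decision y x z Z" for x y
    by (simp add: form_defs sem_decision_def sem_inhab_def)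
  have "sem_ex T (\<lambda>y. sem_and (sem_mem T y B) (sem_all (\<lambda>x. den T (case_nat x (case_nat y ?e)) ?p))) H"
    by (rule sem_GUP) (use assms in \<open>simp add: p sem_decided_def\<close>)
  then show ?thesis
    unfolding p
  proof (rule sem_exE[OF _ stable_atoms(1)])
    fix k H1
    assume "sem_and (sem_mem T k B) (sem_all (\<lambda>x. sem_decision k x z Z)) H1"
    then have k: "sem_decision k x z Z H1" for x by (simp add: sem_and_def sem_all_def)
    show "sem_mem T z Z H1"
    proof (rule sem_exE[OF sem_empty_set stable_atoms(1)])
      fix E H2 assume H2: "H1 \<sqsubseteq> H2" and E: "sem_ext E sem_empty H2"
      \<comment> \<open>At the empty set, the false proposition, an inhabited k would make that set
        inhabited.\<close>
      have nk: "sem_imp (sem_inhab k) (sem_false T) H2"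
      proof (rule sem_impI)
        fix H3 assume H3: "H2 \<sqsubseteq> H3" "sem_inhab k H3"
        have "sem_imp (sem_inhab k) (sem_inhab E) H1" using k[of E] by (simp add: sem_decision_def sem_and_def)
        then have "sem_inhab E H3" by (rule sem_impD) (use H2 H3 in auto)
        then show "sem_false T H3" using sem_inhab_empty[OF E] H3 by (auto dest: sem_impD)
      qed
      \<comment> \<open>The singleton of z plays the true proposition; any inhabited set would
        do.\<close>
      show "sem_mem T z Z H2"
      proof (rule sem_exE[OF sem_singleton_set stable_atoms(1)])
        fix Y H3 assume H3: "H2 \<sqsubseteq> H3" and Y: "sem_ext Y (sem_single z) H3"
        have "sem_inhab Y H3"
          using sem_extD[OF Y order_refl, of z] by (auto simp: sem_single_def sem_eq_refl intro: sem_inhabI)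
        moreover have "sem_decision k Y z Z H3" using weaken[OF stable_decision(2) k] H2 H3 by blast
        moreover have "sem_imp (sem_inhab k) (sem_false T) H3"
          by (rule persistentD[OF persistent_imp nk H3])
        ultimately show "sem_mem T z Z H3" by (auto simp: sem_decision_def sem_and_def dest: sem_mp)
      qed
    qed
  qed
qed

lemma sem_compl_decided_null:
  assumes S: "sem_space S H"
    and U: "sem_ext U (\<lambda>z. sem_and (sem_mem T z S) (sem_decided B x z Z)) H"
    and Z: "sem_ext Z (sem_null S) H"
    and B: "sem_mem T k0 B H" "sem_mem T k1 B H"
      "sem_imp (sem_inhab k0) (sem_false T) H" "sem_inhab k1 H"
    and v: "sem_compl S (sem_set U) v H"
  shows "sem_cover v sem_empty H"
proof -
  have vS: "sem_mem T v S H" using v by (simp add: sem_compl_def sem_and_def)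
  have null: "sem_cover v sem_empty H1" if H1: "H \<sqsubseteq> H1" and "sem_decided B x v Z H1" for H1
  proof (rule sem_compl_member_null)
    show "sem_space S H1" by (rule weaken_sem(1)[OF S H1])
    show "sem_compl S (sem_set U) v H1" by (rule weaken[OF stable_compl v H1])
    show "sem_set U v H1"
      unfolding sem_set_def sem_extD[OF U H1] using that weaken_sem(3)[OF vS H1]
      by (simp add: sem_and_def)
  qed simp
  have decided: "sem_decided B x v Z H1" if "sem_mem T k B H1" "sem_decision k x v Z H1" for k H1
    unfolding sem_decided_def
    by (rule sem_exI[of _ k]) (use that in \<open>auto simp: sem_and_def[of _ _ H1] intro!: stable_persistent stable_and\<close>)
  \<comment> \<open>The inhabited element k1 selects the first alternative, available at stages
    where x is inhabited. Its second clause holds because k1 cannot be uninhabited.\<close>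
  have "sem_cover v sem_empty H1" if H1: "H \<sqsubseteq> H1" and x: "sem_inhab x H1" for H1
  proof (rule null[OF H1], rule decided)
    show "sem_mem T k1 B H1" by (rule weaken_sem(3)[OF B(2) H1])
    have k1: "sem_inhab k1 H1" by (rule weaken[OF stable_decision(1) B(4) H1])
    show "sem_decision k1 x v Z H1"
      unfolding sem_decision_def sem_and_def[of _ _ H1]
    proof (intro HOL.conjI sem_impI)
      show "sem_inhab x H'" if "H1 \<sqsubseteq> H'" for H' using weaken[OF stable_decision(1) x that] .
      fix H2 H3 assume "H1 \<sqsubseteq> H2" "sem_imp (sem_inhab k1) (sem_false T) H2" "H2 \<sqsubseteq> H3"
      then have "sem_false T H3" using weaken[OF stable_decision(1) k1] by (auto dest: sem_impD)
      then show "sem_mem T v Z H3"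
        using sem_false_elim[of H3 "case_nat v (\<lambda>_. Z)" "Mem 0 (Suc 0)"] by simp
    qed
  qed
  note null_if = this
  \<comment> \<open>The uninhabited element k0 selects the second alternative, whose content is
    \<open>null_if\<close>.\<close>
  show ?thesis
  proof (rule null[OF order_refl], rule decided[OF B(1)])
    show "sem_decision k0 x v Z H"
      unfolding sem_decision_def sem_and_def[of _ _ H]
    proof (intro HOL.conjI sem_impI)
      fix H1 assume "H \<sqsubseteq> H1" "sem_inhab k0 H1"
      then have "sem_false T H1" using B(3) by (auto dest: sem_impD)
      \<comment> \<open>Ex falso is available for denotations of formulas, so inhabitedness is
        written as the denotation of \<open>inhab_form\<close>.\<close>
      then show "sem_inhab x H1"
        using sem_false_elim[of H1 "\<lambda>_. x" "inhab_form (\<lambda>n. n) 0"]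
        by (simp add: form_defs sem_inhab_def)
    next
      fix H1 H2 assume H: "H \<sqsubseteq> H1" "H1 \<sqsubseteq> H2" and "sem_inhab x H2"
      then have "sem_cover v sem_empty H2" using null_if by blast
      moreover have "sem_mem T v S H2" using weaken_sem(3)[OF vS] H by blast
      ultimately show "sem_mem T v Z H2"
        using sem_extD[OF Z, of H2] H by (auto simp: sem_and_def)
    qed
  qed
qed

section \<open>Basic covers and the values of the presentation\<close>

lemma stable_index [intro, simp]: "stable T (sem_index I F a V)"
  by (simp add: sem_index_def)

text \<open>The set of indices, the index and the pair naming a value are packed into
  \<open>sem_index\<close>, so that later arguments see no witness other than V.\<close>

lemma sem_basic_coverE:
  assumes "sem_basic_cover I F a U H" "stable T P"
    and "\<And>V H'. H \<sqsubseteq> H' \<Longrightarrow> sem_index I F a V H' \<Longrightarrow> sem_subset V U H' \<Longrightarrow> P H'"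
  shows "P H"
proof -
  let ?q = "\<lambda>A i p V. sem_and (sem_maps I a A) (sem_and (sem_mem T i A) (sem_and (sem_pair p a i) (sem_maps F p V)))"
  show ?thesis
  proof (rule sem_exE[OF assms(1)[unfolded sem_basic_cover_def] assms(2)],
      erule sem_exE[OF _ assms(2)], erule sem_exE[OF _ assms(2)], erule sem_exE[OF _ assms(2)])
    fix A H1 i H2 p H3 V H4
    assume H: "H \<sqsubseteq> H1" "H1 \<sqsubseteq> H2" "H2 \<sqsubseteq> H3" "H3 \<sqsubseteq> H4"
      and *: "sem_and (sem_maps I a A) (sem_and (sem_mem T i A) (sem_and (sem_pair p a i)
        (sem_and (sem_maps F p V) (sem_subset V U)))) H4"
    then have "?q A i p V H4" and V: "sem_subset V U H4" by (simp_all add: sem_and_def)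
    have "sem_ex T (\<lambda>p. ?q A i p V) H4"
      by (rule sem_exI[where F="\<lambda>p. ?q A i p V", of p]) (use \<open>?q A i p V H4\<close> in \<open>auto intro!: stable_persistent stable_and\<close>)
    then have "sem_ex T (\<lambda>i. sem_ex T (\<lambda>p. ?q A i p V)) H4"
      by (rule sem_exI[where F="\<lambda>i. sem_ex T (\<lambda>p. ?q A i p V)"]) (rule persistent_ex)
    then have "sem_index I F a V H4"
      unfolding sem_index_def
      by (rule sem_exI[where F="\<lambda>A. sem_ex T (\<lambda>i. sem_ex T (\<lambda>p. ?q A i p V))"]) (rule persistent_ex)
    then show "P H4" using assms(3)[of H4 V] V H by blast
  qed
qed

lemma sem_basic_coverI:
  assumes V: "sem_index I F a V H" "sem_subset V U H"
  shows "sem_basic_cover I F a U H"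
proof -
  let ?q = "\<lambda>A i p V. sem_and (sem_maps I a A) (sem_and (sem_mem T i A) (sem_and (sem_pair p a i)
    (sem_and (sem_maps F p V) (sem_subset V U))))"
  have st: "stable T (sem_basic_cover I F a U)" by (simp add: sem_basic_cover_def)
  show ?thesis
  proof (rule sem_exE[OF V(1)[unfolded sem_index_def] st],
      erule sem_exE[OF _ st], erule sem_exE[OF _ st])
    fix A H1 i H2 p H3
    assume H: "H \<sqsubseteq> H1" "H1 \<sqsubseteq> H2" "H2 \<sqsubseteq> H3"
      and *: "sem_and (sem_maps I a A) (sem_and (sem_mem T i A) (sem_and (sem_pair p a i) (sem_maps F p V))) H3"
    have "sem_subset V U H3" by (rule weaken[OF stable_classes(1) V(2)]) (use H in blast)
    with * have "?q A i p V H3" by (simp add: sem_and_def)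
    then have "sem_ex T (\<lambda>V. ?q A i p V) H3"
      by (rule sem_exI[where F="\<lambda>V. ?q A i p V"]) (auto intro!: stable_persistent stable_and)
    then have "sem_ex T (\<lambda>p. sem_ex T (\<lambda>V. ?q A i p V)) H3"
      by (rule sem_exI[where F="\<lambda>p. sem_ex T (\<lambda>V. ?q A i p V)"]) (rule persistent_ex)
    then have "sem_ex T (\<lambda>i. sem_ex T (\<lambda>p. sem_ex T (\<lambda>V. ?q A i p V))) H3"
      by (rule sem_exI[where F="\<lambda>i. sem_ex T (\<lambda>p. sem_ex T (\<lambda>V. ?q A i p V))"]) (rule persistent_ex)
    then show "sem_basic_cover I F a U H3"
      unfolding sem_basic_cover_def
      by (rule sem_exI[where F="\<lambda>A. sem_ex T (\<lambda>i. sem_ex T (\<lambda>p. sem_ex T (\<lambda>V. ?q A i p V)))"]) (rule persistent_ex)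
  qed
qed

lemma sem_union_memI:
  assumes "sem_ext R (\<lambda>z. sem_in_union z F) H"
    and "H \<sqsubseteq> H'" "sem_mem T w F H'" "sem_mem T z w H'"
  shows "sem_mem T z R H'"
  unfolding sem_extD[OF assms(1,2)]
  by (rule sem_exI[of _ w]) (use assms(3,4) in \<open>auto simp: sem_and_def[of _ _ H'] intro!: stable_persistent stable_and\<close>)

lemma sem_upair_memI:
  assumes "sem_upair p x y H"
  shows "sem_mem T y p H"
  unfolding sem_extD[OF assms[unfolded sem_upair_def] order_refl]
  by (rule sem_orI2) (rule sem_eq_refl, rule stable_persistent[OF stable_atoms(2)])

text \<open>The double union of \<open>F\<close> contains all values of \<open>F\<close>, because the value \<open>V\<close> is an element of the
  element \<open>{p, V}\<close> of an ordered pair. Applying the uniformity principle to this set instead of the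
  index set of \<open>a\<close> avoids any appeal to the uniqueness of function values.\<close>

lemma sem_maps_mem:
  assumes R1: "sem_ext R1 (\<lambda>z. sem_in_union z F) H"
    and R: "sem_ext R (\<lambda>z. sem_in_union z R1) H"
    and V: "sem_maps F p V H"
  shows "sem_mem T V R H"
proof (rule sem_exE[OF V[unfolded sem_maps_def] stable_atoms(1)])
  fix q H1 assume H1: "H \<sqsubseteq> H1" and "sem_and (sem_mem T q F) (sem_pair q p V) H1"
  then have q: "sem_mem T q F H1" "sem_pair q p V H1" by (simp_all add: sem_and_def)
  show "sem_mem T V R H1"
  proof (rule sem_exE[OF q(2)[unfolded sem_pair_def] stable_atoms(1)], erule sem_exE[OF _ stable_atoms(1)])
    fix u H2 v H3 assume H: "H1 \<sqsubseteq> H2" "H2 \<sqsubseteq> H3"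
      and "sem_and (sem_upair u p p) (sem_and (sem_upair v p V) (sem_upair q u v)) H3"
    then have "sem_mem T V v H3" "sem_mem T v q H3" by (auto simp: sem_and_def intro: sem_upair_memI)
    moreover have H3: "H \<sqsubseteq> H3" using H H1 by blast
    moreover have "sem_mem T q F H3" by (rule weaken_sem(3)[OF q(1)]) (use H in blast)
    ultimately show "sem_mem T V R H3" using sem_union_memI[OF R1 H3] sem_union_memI[OF R H3] by blast
  qed
qed

lemma sem_index_mem:
  assumes R1: "sem_ext R1 (\<lambda>z. sem_in_union z F) H"
    and R: "sem_ext R (\<lambda>z. sem_in_union z R1) H"
    and V: "sem_index I F a V H"
  shows "sem_mem T V R H"
proof (rule sem_exE[OF V[unfolded sem_index_def] stable_atoms(1)], erule sem_exE[OF _ stable_atoms(1)],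
    erule sem_exE[OF _ stable_atoms(1)])
  fix A H1 i H2 p H3
  assume "H \<sqsubseteq> H1" "H1 \<sqsubseteq> H2" "H2 \<sqsubseteq> H3"
    and p: "sem_and (sem_maps I a A) (sem_and (sem_mem T i A) (sem_and (sem_pair p a i) (sem_maps F p V))) H3"
  then have H3: "H \<sqsubseteq> H3" by blast
  have "sem_maps F p V H3" using p by (simp add: sem_and_def)
  then show "sem_mem T V R H3"
    by (rule sem_maps_mem[OF persistentD[OF persistent_ext R1 H3] persistentD[OF persistent_ext R H3]])
qed

text \<open>The last condition on formal spaces, applied to the empty set, collects the null points
  into a set. Membership in that set is atomic and may occur in bounded separation, unlike the
  statement of being covered.\<close>

lemma sem_null_set:
  assumes S: "sem_space S H"
  shows "sem_ex T (\<lambda>Z. sem_ext Z (sem_null S)) H"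
proof (rule sem_exE[OF sem_empty_set stable_ex])
  fix E H1 assume H1: "H \<sqsubseteq> H1" and E: "sem_ext E sem_empty H1"
  have "sem_subset E S H1"
  proof (rule sem_subsetI)
    fix z H2 assume "H1 \<sqsubseteq> H2" "sem_mem T z E H2"
    then have "sem_false T H2" using sem_extD[OF E] by (auto simp: sem_empty_def)
    then show "sem_mem T z S H2"
      using sem_false_elim[of H2 "case_nat z (\<lambda>_. S)" "Mem 0 (Suc 0)"] by simp
  qed
  moreover have "sem_space S H1" by (rule weaken_sem(1)[OF S H1])
  ultimately have "sem_ex T (\<lambda>Z. sem_ext Z (\<lambda>z. sem_and (sem_mem T z S) (sem_cover z (sem_set E)))) H1"
    unfolding sem_space_def sem_and_def[of _ _ H1] sem_all_def[of _ H1] by (blast dest: sem_mp)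
  then show "sem_ex T (\<lambda>Z. sem_ext Z (sem_null S)) H1"
  proof (rule sem_exE[OF _ stable_ex])
    fix Z H2 assume H2: "H1 \<sqsubseteq> H2"
      and Z: "sem_ext Z (\<lambda>z. sem_and (sem_mem T z S) (sem_cover z (sem_set E))) H2"
    have "sem_ext Z (sem_null S) H2"
    proof (rule sem_extI)
      fix z H3 assume H3: "H2 \<sqsubseteq> H3"
      have eq: "sem_set E x H' \<longleftrightarrow> sem_empty x H'" if "H3 \<sqsubseteq> H'" for x H'
        unfolding sem_set_def by (rule sem_extD[OF E]) (use that H2 H3 in blast)
      have "sem_cover z (sem_set E) H3 \<longleftrightarrow> sem_cover z sem_empty H3"
        using sem_cover_cong[of z "sem_set E" H3 sem_empty] sem_cover_cong[of z sem_empty H3 "sem_set E"] eq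
        by blast
      then show "sem_mem T z Z H3 \<longleftrightarrow> sem_and (sem_mem T z S) (sem_cover z sem_empty) H3"
        unfolding sem_extD[OF Z H3] by (simp add: sem_and_def)
    qed
    then show "sem_ex T (\<lambda>Z. sem_ext Z (sem_null S)) H2"
      by (rule sem_exI[where F="\<lambda>Z. sem_ext Z (sem_null S)"])
        (rule persistent_ext)
  qed
qed

text \<open>The empty set E and its singleton are the two choices. Pairing provides a set containing
  both and possibly more; this does no harm, since a choice is judged only by being
  inhabited.\<close>

lemma sem_two_element_set:
  assumes "stable T P"
    and "\<And>B k0 k1 H'. H \<sqsubseteq> H' \<Longrightarrow> sem_mem T k0 B H' \<Longrightarrow> sem_mem T k1 B H' \<Longrightarrow>
      sem_imp (sem_inhab k0) (sem_false T) H' \<Longrightarrow> sem_inhab k1 H' \<Longrightarrow> P H'"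
  shows "P H"
proof (rule sem_exE[OF sem_empty_set assms(1)], rule sem_exE[OF sem_singleton_set assms(1)],
    rule sem_exE[OF sem_pairing assms(1)])
  fix E H1 Y H2 B H3
  assume H: "H \<sqsubseteq> H1" "H1 \<sqsubseteq> H2" "H2 \<sqsubseteq> H3"
    and E: "sem_ext E sem_empty H1" and Y: "sem_ext Y (sem_single E) H2"
    and B: "sem_and (sem_mem T E B) (sem_mem T Y B) H3"
  have "sem_mem T E Y H3" using sem_extD[OF Y H(3)] by (simp add: sem_single_self)
  moreover have "sem_imp (sem_inhab E) (sem_false T) H3"
    by (rule persistentD[OF persistent_imp sem_inhab_empty[OF E]]) (use H in blast)
  ultimately show "P H3"
    using assms(2)[of H3 E B Y] B H sem_inhabI[of E Y H3] by (auto simp: sem_and_def)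
qed

text \<open>Separation is applicable because the search for k ranges over the set B, inhabitedness
  is a bounded quantifier and nullity is membership in Z.\<close>

lemma sem_decided_set:
  "sem_ex T (\<lambda>U. sem_ext U (\<lambda>z. sem_and (sem_mem T z S) (sem_decided B x z Z))) H"
proof -
  \<comment> \<open>Variable 0 is the separated z; 1, 2 and 3 are the parameters B, x and Z.\<close>
  let ?p = "decided_form (\<lambda>n. Suc n) (\<lambda>n. Suc (Suc n)) (\<lambda>n. n) (\<lambda>n. Suc (Suc (Suc n))) 0"
  have p: "den T (case_nat z (case_nat B (case_nat x (\<lambda>_. Z)))) ?p = sem_decided B x z Z" for z
    by (simp add: form_defs sem_decided_def sem_decision_def sem_inhab_def)
  have "bounded_fm ?p"
    by (simp add: form_defs) (intro bounded_fm.intros)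
  from sem_separation[OF this, of S "case_nat B (case_nat x (\<lambda>_. Z))" H]
  show ?thesis unfolding p .
qed

section \<open>Collapse of a set-presented double negation space in CZF\<close>

lemma sem_presentedE:
  assumes "sem_presented S H" "stable T P"
    and "\<And>I F H'. H \<sqsubseteq> H' \<Longrightarrow>
      (\<And>a U H''. H' \<sqsubseteq> H'' \<Longrightarrow> sem_mem T a S H'' \<Longrightarrow> sem_subset U S H'' \<Longrightarrow>
        sem_dneg S a (sem_set U) H'' \<longleftrightarrow> sem_basic_cover I F a U H'') \<Longrightarrow> P H'"
  shows "P H"
proof (rule sem_exE[OF assms(1)[unfolded sem_presented_def] assms(2)],
    erule sem_exE[OF _ assms(2)], erule sem_exE[OF _ assms(2)])
  fix I H1 D H2 F H3
  assume H: "H \<sqsubseteq> H1" "H1 \<sqsubseteq> H2" "H2 \<sqsubseteq> H3"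
    and *: "sem_all (\<lambda>a. sem_all (\<lambda>U. sem_imp (sem_mem T a S) (sem_imp (sem_subset U S)
      (sem_iff (sem_dneg S a (sem_set U)) (sem_basic_cover I F a U))))) H3"
  show "P H3"
  proof (rule assms(3))
    fix a U H4 assume H4: "H3 \<sqsubseteq> H4" "sem_mem T a S H4" "sem_subset U S H4"
    have "sem_imp (sem_mem T a S) (sem_imp (sem_subset U S)
      (sem_iff (sem_dneg S a (sem_set U)) (sem_basic_cover I F a U))) H3"
      using * by (simp add: sem_all_def)
    then have "sem_iff (sem_dneg S a (sem_set U)) (sem_basic_cover I F a U) H4"
      using H4 by (blast dest: sem_impD sem_mp)
    then show "sem_dneg S a (sem_set U) H4 \<longleftrightarrow> sem_basic_cover I F a U H4"
      by (auto simp: sem_iff_def sem_and_def dest: sem_mp)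
  qed (use H in blast)
qed

text \<open>Inclusion of V in the subset belonging to x is spelled out pointwise: for each x that
  subset is only known to exist, and since variables are the only terms, nothing in the language
  names it as a function of x. The witness V ranges over the double union of F.\<close>

lemma sem_uniform_index:
  assumes *: "\<And>x. sem_ex T (\<lambda>V. sem_and (sem_index I F a V)
      (sem_all (\<lambda>z. sem_imp (sem_mem T z V) (sem_decided B x z Z)))) H"
  shows "sem_ex T (\<lambda>V. sem_all (\<lambda>x. sem_and (sem_index I F a V)
      (sem_all (\<lambda>z. sem_imp (sem_mem T z V) (sem_decided B x z Z))))) H"
proof (rule sem_exE[OF sem_union[of F] stable_ex], rule sem_exE[OF sem_union stable_ex])
  fix R1 H1 R H2
  assume H: "H \<sqsubseteq> H1" "H1 \<sqsubseteq> H2"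
    and R1: "sem_ext R1 (\<lambda>z. sem_in_union z F) H1"
    and R: "sem_ext R (\<lambda>z. sem_in_union z R1) H2"
  let ?q = "\<lambda>x V. sem_and (sem_index I F a V) (sem_all (\<lambda>z. sem_imp (sem_mem T z V) (sem_decided B x z Z)))"
  \<comment> \<open>Index 0 is the uniform x and index 1 the witness V, as \<open>sem_GUP\<close>
    demands; 2 to 6 are the parameters in the order of \<open>?e\<close>.\<close>
  let ?V = "\<lambda>n. Suc n" and ?x = "\<lambda>n. n" and ?I = "\<lambda>n. Suc (Suc n)" and ?F = "\<lambda>n. Suc (Suc (Suc n))"
    and ?a = "\<lambda>n. Suc (Suc (Suc (Suc n)))" and ?B = "\<lambda>n. Suc (Suc (Suc (Suc (Suc n))))"
    and ?Z = "\<lambda>n. Suc (Suc (Suc (Suc (Suc (Suc n)))))"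
  let ?p = "(index_form ?I ?F ?a ?V \<^bold>\<and> (\<^bold>\<forall>z. z \<^bold>\<in> ?V \<^bold>\<longrightarrow> decided_form ?B ?x z ?Z)) 0"
  let ?e = "case_nat I (case_nat F (case_nat a (case_nat B (\<lambda>_. Z))))"
  have p: "den T (case_nat x (case_nat V ?e)) ?p = ?q x V" for x V
    by (simp add: form_defs sem_decided_def sem_decision_def sem_inhab_def sem_index_def
      sem_maps_def sem_pair_def sem_upair_def sem_iff_def)
  have "sem_ex T (\<lambda>V. sem_and (sem_mem T V R) (sem_all (\<lambda>x. den T (case_nat x (case_nat V ?e)) ?p))) H2"
  proof (rule sem_GUP)
    show "sem_all (\<lambda>x. sem_ex T (\<lambda>V. sem_and (sem_mem T V R) (den T (case_nat x (case_nat V ?e)) ?p))) H2"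
      unfolding p sem_all_def[of _ H2]
    proof (intro allI)
      fix x
      have "sem_ex T (?q x) H2" using persistentD[OF persistent_ex *[of x]] H by blast
      then show "sem_ex T (\<lambda>V. sem_and (sem_mem T V R) (?q x V)) H2"
      proof (rule sem_exE[OF _ stable_ex])
        fix V H3 assume H3: "H2 \<sqsubseteq> H3" and V: "?q x V H3"
        have "sem_mem T V R H3"
          by (rule sem_index_mem[OF persistentD[OF persistent_ext R1] persistentD[OF persistent_ext R H3]])
            (use V H H3 in \<open>auto simp: sem_and_def\<close>)
        with V have "sem_and (sem_mem T V R) (?q x V) H3" by (simp add: sem_and_def)
        then show "sem_ex T (\<lambda>V. sem_and (sem_mem T V R) (?q x V)) H3"
          by (rule sem_exI[where F="\<lambda>V. sem_and (sem_mem T V R) (?q x V)"]) (simp add: stable_persistent[of T])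
      qed
    qed
  qed
  then show "sem_ex T (\<lambda>V. sem_all (\<lambda>x. ?q x V)) H2"
    unfolding p by (rule sem_ex_mono) (simp add: sem_and_def)
qed

lemma sem_presented_null:
  assumes S: "sem_space S H" and "sem_presented S H" and a: "sem_mem T a S H"
  shows "sem_cover a sem_empty H"
proof (rule sem_presentedE[OF assms(2) stable_cover])
  fix I F H1 assume H1: "H \<sqsubseteq> H1"
    and pres: "\<And>a U H''. H1 \<sqsubseteq> H'' \<Longrightarrow> sem_mem T a S H'' \<Longrightarrow> sem_subset U S H'' \<Longrightarrow>
        sem_dneg S a (sem_set U) H'' \<longleftrightarrow> sem_basic_cover I F a U H''"
  have S1: "sem_space S H1" by (rule weaken_sem(1)[OF S H1])
  show "sem_cover a sem_empty H1"
  proof (rule sem_exE[OF sem_null_set[OF S1] stable_cover], rule sem_two_element_set[OF stable_cover])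
    fix Z H2 B k0 k1 H3
    assume H: "H1 \<sqsubseteq> H2" "H2 \<sqsubseteq> H3"
      and Z2: "sem_ext Z (sem_null S) H2"
      and B: "sem_mem T k0 B H3" "sem_mem T k1 B H3"
        "sem_imp (sem_inhab k0) (sem_false T) H3" "sem_inhab k1 H3"
    have Z: "sem_ext Z (sem_null S) H3"
      by (rule persistentD[OF persistent_ext Z2 H(2)])
    have S3: "sem_space S H3" and a3: "sem_mem T a S H3"
      using weaken_sem(1)[OF S] weaken_sem(3)[OF a] H H1 by blast+
    let ?q = "\<lambda>x V. sem_and (sem_index I F a V) (sem_all (\<lambda>z. sem_imp (sem_mem T z V) (sem_decided B x z Z)))"
    have "sem_ex T (?q x) H3" for x
    proof (rule sem_exE[OF sem_decided_set[of S B x Z] stable_ex])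
      fix U H4 assume H4: "H3 \<sqsubseteq> H4"
        and U: "sem_ext U (\<lambda>z. sem_and (sem_mem T z S) (sem_decided B x z Z)) H4"
      have "sem_dneg S a (sem_set U) H4"
      proof (rule sem_dneg_dense[OF weaken_sem(1)[OF S3 H4]])
        fix v H5 assume H5: "H4 \<sqsubseteq> H5" and v: "sem_compl S (sem_set U) v H5"
        have H35: "H3 \<sqsubseteq> H5" using H4 H5 by blast
        show "sem_cover v sem_empty H5"
          by (rule sem_compl_decided_null[OF weaken_sem(1)[OF S3 H35] persistentD[OF persistent_ext U H5]
                persistentD[OF persistent_ext Z H35] weaken_sem(3)[OF B(1) H35] weaken_sem(3)[OF B(2) H35]
                persistentD[OF persistent_imp B(3) H35] weaken[OF stable_decision(1) B(4) H35] v])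
      qed
      moreover have "sem_subset U S H4"
        by (rule sem_subsetI) (use sem_extD[OF U] in \<open>auto simp: sem_and_def\<close>)
      moreover have "sem_mem T a S H4" by (rule weaken_sem(3)[OF a3 H4])
      ultimately have "sem_basic_cover I F a U H4" using pres H H4 by blast
      then show "sem_ex T (?q x) H4"
      proof (rule sem_basic_coverE[OF _ stable_ex])
        fix V H5 assume H5: "H4 \<sqsubseteq> H5" and V: "sem_index I F a V H5" "sem_subset V U H5"
        have "sem_all (\<lambda>z. sem_imp (sem_mem T z V) (sem_decided B x z Z)) H5"
          unfolding sem_all_def
        proof (intro allI sem_impI)
          fix z H6 assume H6: "H5 \<sqsubseteq> H6" "sem_mem T z V H6"
          then have "sem_mem T z U H6" by (rule sem_subsetD[OF V(2)])
          then show "sem_decided B x z Z H6" using sem_extD[OF U, of H6 z] H5 H6 by (auto simp: sem_and_def)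
        qed
        then have "?q x V H5" using V by (simp add: sem_and_def)
        then show "sem_ex T (?q x) H5"
          by (rule sem_exI[where F="?q x"]) (simp add: stable_persistent[of T])
      qed
    qed
    then have "sem_ex T (\<lambda>V. sem_all (\<lambda>x. ?q x V)) H3" by (rule sem_uniform_index)
    then show "sem_cover a sem_empty H3"
    proof (rule sem_exE[OF _ stable_cover])
      fix V H4 assume H4: "H3 \<sqsubseteq> H4" and "sem_all (\<lambda>x. ?q x V) H4"
      then have V: "sem_index I F a V H4"
        and dec: "\<And>x z. sem_imp (sem_mem T z V) (sem_decided B x z Z) H4"
        by (simp_all add: sem_all_def sem_and_def)
      \<comment> \<open>Second use of uniformity, separately for each z in V: such a z is decided
        for every x, hence null.\<close>
      have "sem_subset V Z H4"
      proof (rule sem_subsetI, rule sem_decided_uniform)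
        fix z H5 assume "H4 \<sqsubseteq> H5" "sem_mem T z V H5"
        then show "sem_all (\<lambda>x. sem_decided B x z Z) H5"
          using sem_impD[OF dec] by (auto simp: sem_all_def)
      qed
      then have "sem_basic_cover I F a Z H4" by (rule sem_basic_coverI[OF V])
      moreover have "sem_subset Z S H4"
        by (rule sem_subsetI) (use sem_extD[OF Z] H4 in \<open>auto simp: sem_and_def\<close>)
      \<comment> \<open>The presentation is now read in the other direction: Z contains a basic
        cover of a.\<close>
      ultimately have "sem_dneg S a (sem_set Z) H4"
        using pres[of H4 a Z] weaken_sem(3)[OF a3 H4] H H4 by blast
      then show "sem_cover a sem_empty H4"
      proof (rule sem_dneg_null[OF weaken_sem(1)[OF S3 H4] weaken_sem(3)[OF a3 H4]])
        fix v H5 assume H5: "H4 \<sqsubseteq> H5" "sem_set Z v H5"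
        then show "sem_mem T v S H5 \<and> sem_cover v sem_empty H5"
          using sem_extD[OF Z, of H5 v] H4 by (auto simp: sem_set_def sem_and_def)
      qed
    qed
  qed
qed

lemma sem_presented_inconsistent:
  assumes "sem_space S H" "sem_nontrivial S H" "sem_presented S H"
  shows "sem_false T H"
proof -
  have "sem_covers (sem_set S) sem_empty H"
  proof (rule sem_coversI)
    fix u H1 assume H1: "H \<sqsubseteq> H1" "sem_set S u H1"
    have "stable T (sem_presented S)" by (simp add: sem_presented_def)
    then have "sem_presented S H1" using assms(3) H1(1) by (rule weaken)
    then show "sem_cover u sem_empty H1"
      using sem_presented_null[OF weaken_sem(1)[OF assms(1) H1(1)]] H1(2) by (simp add: sem_set_def)
  qed
  then show ?thesis using assms(2) sem_mp by (simp add: sem_nontrivial_def) blast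
qed

end

end

section \<open>From provability in T to the interpretation\<close>

lemma den_inst_closed1:
  assumes "free_vars \<sigma> \<subseteq> {0}"
  shows "den T e (inst \<sigma> [x] n) = den T (case_nat (e (x n)) (\<lambda>i. i)) \<sigma>"
  unfolding den_inst1 by (rule den_cong) (use assms in auto)

lemma proves_of_sem:
  assumes \<sigma>: "free_vars \<sigma> \<subseteq> {0}" and "T \<subseteq> T'" "proves_of T \<sigma> P"
  defines "Q \<equiv> \<lambda>s. den T' (case_nat s (\<lambda>i. i)) \<sigma>"
  shows "sem_ex T' (\<lambda>s. sem_and (Q s)
    (sem_and (sem_all (\<lambda>x. sem_imp (Q x) (sem_eq T' x s)))
      (den T' (case_nat s (\<lambda>i. i)) (P (\<lambda>m. m - Suc 0) (Suc 0))))) []"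
proof -
  let ?A = "(\<^bold>\<exists>S. inst \<sigma> [S] \<^bold>\<and> (\<^bold>\<forall>X. inst \<sigma> [X] \<^bold>\<longrightarrow> X \<^bold>= S) \<^bold>\<and> P S) 0"
  have "prv T' [] ?A"
    using assms(3) unfolding proves_of_def by (rule prv_mono[OF assms(2)]) simp
  then have "den T' (\<lambda>i. i) ?A []" by (simp add: den_def ren_ident)
  then show ?thesis
    by (simp add: hoas_defs den_inst_closed1[OF \<sigma>] Q_def)
qed

theorem dneg_not_presented_CZF:
  assumes "CZF \<subseteq> T" and "consistent_CZF_ext (T \<union> GUP_CZF)"
    and \<sigma>: "free_vars \<sigma> \<subseteq> {0}" and \<delta>: "free_vars \<delta> \<subseteq> {0, 1}"
    and space: "proves_of T \<sigma> (\<lambda>S. formal_space S (cover_of \<delta>))"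
    and nontriv: "proves_of T \<sigma> (\<lambda>S. nontrivial S (cover_of \<delta>))"
  shows "\<not> proves_of T \<sigma> (\<lambda>S. set_presented S (dneg_cover S (cover_of \<delta>)))"
proof
  assume pres: "proves_of T \<sigma> (\<lambda>S. set_presented S (dneg_cover S (cover_of \<delta>)))"
  \<comment> \<open>The proofs in T are read in the theory with uniformity added, whose consistency
    is what will be contradicted.\<close>
  let ?T = "T \<union> GUP_CZF" and ?i = "\<lambda>i. i :: nat"
  have T: "T \<subseteq> ?T" "CZF \<subseteq> ?T" "GUP_CZF \<subseteq> ?T" using assms(1) by auto
  let ?Q = "\<lambda>s. den ?T (case_nat s ?i) \<sigma>"
  \<comment> \<open>Each of the three provable statements introduces its own set satisfying
    \<sigma>. The uniqueness part identifies these sets, so that all the properties can be gathered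
    at one s.\<close>
  have transfer: "den ?T (case_nat s ?i) p H"
    if "?Q s H" "sem_all (\<lambda>x. sem_imp (?Q x) (sem_eq ?T x s')) H" "den ?T (case_nat s' ?i) p H" for s s' p H
    using that sem_eq_subst[of ?T s s' H ?i p] by (auto simp: sem_all_def dest: sem_mp)
  have "sem_false ?T []"
  proof (rule sem_exE[OF proves_of_sem[OF \<sigma> T(1) space] stable_atoms(3)])
    fix s H1
    assume "sem_and (?Q s) (sem_and (sem_all (\<lambda>x. sem_imp (?Q x) (sem_eq ?T x s)))
      (den ?T (case_nat s ?i) (formal_space (\<lambda>m. m - Suc 0) (cover_of \<delta>) (Suc 0)))) H1"
    then have s: "?Q s H1" "sem_space ?T \<delta> s H1"
      by (simp_all add: sem_and_def den_formal_space[OF \<delta>])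
    note n = persistentD[OF persistent_ex proves_of_sem[OF \<sigma> T(1) nontriv], of H1, simplified]
    show "sem_false ?T H1"
    proof (rule sem_exE[OF n stable_atoms(3)])
      fix s' H2
      assume H2: "H1 \<sqsubseteq> H2" and *: "sem_and (?Q s') (sem_and (sem_all (\<lambda>x. sem_imp (?Q x) (sem_eq ?T x s')))
        (den ?T (case_nat s' ?i) (nontrivial (\<lambda>m. m - Suc 0) (cover_of \<delta>) (Suc 0)))) H2"
      have s2: "?Q s H2" "sem_space ?T \<delta> s H2"
        using weaken[OF stable_atoms(4) s(1) H2] weaken[OF stable_space s(2) H2] .
      have "den ?T (case_nat s ?i) (nontrivial (\<lambda>m. m - Suc 0) (cover_of \<delta>) (Suc 0)) H2"
        using * by (intro transfer[OF s2(1), of s']) (simp_all add: sem_and_def)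
      then have nt: "sem_nontrivial ?T \<delta> s H2" by (simp add: den_nontrivial[OF \<delta>])
      note p = persistentD[OF persistent_ex proves_of_sem[OF \<sigma> T(1) pres], of H2, simplified]
      show "sem_false ?T H2"
      proof (rule sem_exE[OF p stable_atoms(3)])
        fix s' H3
        let ?p = "set_presented (\<lambda>m. m - Suc 0) (dneg_cover (\<lambda>m. m - Suc 0) (cover_of \<delta>)) (Suc 0)"
        assume H3: "H2 \<sqsubseteq> H3" and *: "sem_and (?Q s') (sem_and
          (sem_all (\<lambda>x. sem_imp (?Q x) (sem_eq ?T x s'))) (den ?T (case_nat s' ?i) ?p)) H3"
        have s3: "?Q s H3" "sem_space ?T \<delta> s H3"
          using weaken[OF stable_atoms(4) s2(1) H3] weaken[OF stable_space s2(2) H3] .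
        have "den ?T (case_nat s ?i) ?p H3"
          using * by (intro transfer[OF s3(1), of s']) (simp_all add: sem_and_def)
        then have "sem_presented ?T \<delta> s H3" by (rule den_set_presented[OF \<delta>])
        moreover have "sem_nontrivial ?T \<delta> s H3"
          using persistentD[OF persistent_imp nt[unfolded sem_nontrivial_def] H3]
          by (simp add: sem_nontrivial_def)
        ultimately show "sem_false ?T H3"
          using sem_presented_inconsistent[OF T(2,3) s3(2)] by blast
      qed
    qed
  qed
  then show False using assms(2) by (simp add: consistent_CZF_ext_def sem_false_def)
qed


section \<open>Substitution in the terms of type theory\<close>

lemma up_tm_simps [simp]:
  "up_tm s 0 = Var 0" "up_tm s (Suc i) = ren_tm Suc (s i)"
  "up_tm s (numeral k) = ren_tm Suc (s (pred_numeral k))"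
  by (simp_all add: up_tm_def)

lemma ren_tm_subst: "ren_tm f a = subst_tm (\<lambda>i. Var (f i)) a"
proof (induction a arbitrary: f)
  case (Lam a)
  have "(\<lambda>i. Var (up_var f i)) = up_tm (\<lambda>i. Var (f i))"
    by (auto simp: fun_eq_iff up_var_def up_tm_def split: nat.split)
  then show ?case by (simp add: Lam)
qed simp_all

lemma subst_tm_ren: "subst_tm s (ren_tm f a) = subst_tm (\<lambda>i. s (f i)) a"
proof (induction a arbitrary: f s)
  case (Lam a)
  have "(\<lambda>i. up_tm s (up_var f i)) = up_tm (\<lambda>i. s (f i))"
    by (auto simp: fun_eq_iff up_var_def up_tm_def split: nat.split)
  then show ?case by (simp add: Lam)
qed simp_all

lemma ren_tm_ren: "ren_tm f (ren_tm g a) = ren_tm (\<lambda>i. f (g i)) a"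
  unfolding ren_tm_subst[of f] subst_tm_ren by (simp add: ren_tm_subst)

lemma ren_tm_subst_tm: "ren_tm f (subst_tm s a) = subst_tm (\<lambda>i. ren_tm f (s i)) a"
proof (induction a arbitrary: f s)
  case (Lam a)
  have "(\<lambda>i. ren_tm (up_var f) (up_tm s i)) = up_tm (\<lambda>i. ren_tm f (s i))"
    by (auto simp: fun_eq_iff up_var_def up_tm_def ren_tm_ren split: nat.split)
  then show ?case by (simp add: Lam)
qed simp_all

text \<open>\<open>up_tm\<close> contains a shift, so the case of an abstraction has to move a
  renaming past a substitution on either side. This is why the laws mixing renaming and substitution
  precede this one.\<close>

lemma subst_tm_subst: "subst_tm s (subst_tm t a) = subst_tm (\<lambda>i. subst_tm s (t i)) a"
proof (induction a arbitrary: s t)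
  case (Lam a)
  have "(\<lambda>i. subst_tm (up_tm s) (up_tm t i)) = up_tm (\<lambda>i. subst_tm s (t i))"
    by (auto simp: fun_eq_iff up_tm_def subst_tm_ren ren_tm_subst_tm split: nat.split)
  then show ?case by (simp add: Lam)
qed simp_all

lemma up_tm_Var: "up_tm Var = Var"
  by (auto simp: fun_eq_iff up_tm_def split: nat.split)

lemma subst_tm_Var [simp]: "subst_tm Var a = a"
  by (induction a) (simp_all add: up_tm_Var)

lemma subst_ty_Var [simp]: "subst_ty Var A = A"
  by (induction A) (simp_all add: up_tm_Var)

lemma up_tm_subst: "(\<lambda>i. subst_tm (up_tm s) (up_tm t i)) = up_tm (\<lambda>i. subst_tm s (t i))"
  by (auto simp: fun_eq_iff up_tm_def subst_tm_ren ren_tm_subst_tm split: nat.split)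

lemma subst_ty_subst: "subst_ty s (subst_ty t A) = subst_ty (\<lambda>i. subst_tm s (t i)) A"
  by (induction A arbitrary: s t) (simp_all add: subst_tm_subst up_tm_subst)

lemma subst_tm_cong: "(\<And>i. i \<in> free_vars_tm a \<Longrightarrow> s i = t i) \<Longrightarrow> subst_tm s a = subst_tm t a"
proof (induction a arbitrary: s t)
  case (App a b)
  then show ?case by (metis UnI1 UnI2 free_vars_tm.simps(3) subst_tm.simps(3))
next
  case (Lam a)
  have "subst_tm (up_tm s) a = subst_tm (up_tm t) a"
  proof (rule Lam.IH)
    fix i assume "i \<in> free_vars_tm a"
    then show "up_tm s i = up_tm t i" using Lam.prems by (cases i) auto
  qed
  then show ?case by simp
qed simp_all

lemma subst_tm_closed: "closed_tm a \<Longrightarrow> subst_tm s a = a"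
  using subst_tm_cong[of a s Var] by (simp add: closed_tm_def)

lemma ren_tm_closed: "closed_tm a \<Longrightarrow> ren_tm f a = a"
  by (simp add: ren_tm_subst subst_tm_closed)

text \<open>Only \<open>ext\<close> refers to \<open>R\<close>, and there inclusion is all that
  matters. This moves derivations from R to R with the uniformity constants.\<close>

lemma der_mono:
  assumes "R \<subseteq> R'"
  shows "der R J \<Longrightarrow> der R' J"
proof (induction rule: der.induct)
  case (ext Js J)
  then show ?case using assms by (blast intro: der.ext)
next
  case (subst \<Gamma> J \<Delta> s)
  show ?case by (rule der.subst[OF subst.IH])
next
  case (subst_eq_ty \<Gamma> A \<Delta> s t)
  show ?case by (rule der.subst_eq_ty[OF subst_eq_ty.IH])
next
  case (subst_eq_tm \<Gamma> a A \<Delta> s t)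
  show ?case by (rule der.subst_eq_tm[OF subst_eq_tm.IH])
next
  case var
  show ?case by (rule der.var[OF var.IH var.hyps(2)])
qed (rule der.empty der.prim der.law, assumption?
  | rule der.extend der.ty_refl der.ty_sym der.ty_trans der.tm_refl der.tm_sym der.tm_trans der.conv der.conv_eq der.set_form
    der.el_form der.el_eq der.fun_form der.fun_eq der.abs der.abs_eq der.app der.app_eq der.beta der.eta,
    assumption+)+

abbreviation lift :: "tm \<Rightarrow> tm" where
  "lift a \<equiv> ren_tm Suc a"

abbreviation lift_ty :: "ty \<Rightarrow> ty" where
  "lift_ty A \<equiv> subst_ty (\<lambda>i. Var (Suc i)) A"

lemma sub1_lift [simp]: "subst_tm (case_nat a s) (lift b) = subst_tm s b"
  by (simp add: subst_tm_ren)

lemma up_tm_lift: "subst_tm (up_tm s) (lift a) = lift (subst_tm s a)"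
  by (simp add: subst_tm_ren ren_tm_subst_tm)

lemma ren_up_lift [simp]: "ren_tm (up_var f) (lift a) = lift (ren_tm f a)"
  by (simp add: ren_tm_ren)

declare up_tm_lift [simp]

text \<open>Weakening arises both as a renaming and as a substitution of variables. This rule and
  the two after it choose iterated \<open>lift\<close> as the common normal form of terms.\<close>

lemma subst_tm_Suc [simp]: "subst_tm (\<lambda>i. Var (Suc i)) a = lift a"
  by (simp add: ren_tm_subst)

lemma subst_tm_Suc2 [simp]: "subst_tm (\<lambda>i. Var (Suc (Suc i))) a = lift (lift a)"
  by (simp only: ren_tm_ren) (simp add: ren_tm_subst[of "\<lambda>i. Suc (Suc i)"])

lemma subst_tm_Suc3 [simp]: "subst_tm (\<lambda>i. Var (Suc (Suc (Suc i)))) a = lift (lift (lift a))"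
  by (simp only: ren_tm_ren) (simp add: ren_tm_subst[of "\<lambda>i. Suc (Suc (Suc i))"])

lemmas hoas_ty_defs = Fun_def arrow_def SET_def El_def tapp_def cn_def bound_def tlam_def

abbreviation FALSE :: tm where "FALSE \<equiv> Const (Prim (Fin 0))"
abbreviation UNIT :: tm where "UNIT \<equiv> Const (Prim (Fin 1))"
abbreviation PI' :: "tm \<Rightarrow> tm \<Rightarrow> tm" where "PI' A F \<equiv> App (App (Const (Prim PI)) A) F"
abbreviation SIG' :: "tm \<Rightarrow> tm \<Rightarrow> tm" where "SIG' A F \<equiv> App (App (Const (Prim SIG)) A) F"
abbreviation ID' :: "tm \<Rightarrow> tm \<Rightarrow> tm \<Rightarrow> tm" where
  "ID' A a b \<equiv> App (App (App (Const (Prim ID)) A) a) b"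
abbreviation PAIR' :: "tm \<Rightarrow> tm \<Rightarrow> tm \<Rightarrow> tm \<Rightarrow> tm" where
  "PAIR' A F a b \<equiv> App (App (App (App (Const (Prim PAIR)) A) F) a) b"
abbreviation SPLIT' :: "tm \<Rightarrow> tm \<Rightarrow> tm \<Rightarrow> tm \<Rightarrow> tm \<Rightarrow> tm" where
  "SPLIT' A F C d p \<equiv> App (App (App (App (App (Const (Prim SPLIT)) A) F) C) d) p"


section \<open>Logic in extensions of CTT\<close>

locale ctt_rules =
  fixes R :: "rule set"
begin

definition wfc :: "ctx \<Rightarrow> bool" where
  "wfc \<Gamma> \<longleftrightarrow> der R (\<Gamma>, Wf)"

text \<open>Well-formedness of the context is part of the judgements: since the additional rules are
  arbitrary, it cannot be recovered from a derivation.\<close>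

definition tj :: "ctx \<Rightarrow> tm \<Rightarrow> ty \<Rightarrow> bool" where
  "tj \<Gamma> a A \<longleftrightarrow> wfc \<Gamma> \<and> der R (\<Gamma>, HasType a A)"

definition eqj :: "ctx \<Rightarrow> tm \<Rightarrow> tm \<Rightarrow> ty \<Rightarrow> bool" where
  "eqj \<Gamma> a b A \<longleftrightarrow> wfc \<Gamma> \<and> der R (\<Gamma>, EqTerm a b A)"

text \<open>Only the existence of proof terms matters. Forgetting them turns typing into natural
  deduction, while points, indices and codes stay explicit.\<close>

definition tr :: "ctx \<Rightarrow> tm \<Rightarrow> bool" where
  "tr \<Gamma> A \<longleftrightarrow> (\<exists>t. tj \<Gamma> t (TEl A))"

text \<open>Context morphisms serve as the later stages: weakening, instantiation and their
  composites are instances, so a single substitution rule transports every judgement.\<close>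

definition mor :: "ctx \<Rightarrow> (nat \<Rightarrow> tm) \<Rightarrow> ctx \<Rightarrow> bool" where
  "mor \<Delta> s \<Gamma> \<longleftrightarrow> wfc \<Delta> \<and>
    (\<forall>i<length \<Gamma>. der R (\<Delta>, HasType (s i) (subst_ty s (weaken (Suc i) (\<Gamma> ! i)))))"

abbreviation isset :: "ctx \<Rightarrow> tm \<Rightarrow> bool" where
  "isset \<Gamma> A \<equiv> tj \<Gamma> A TSet"

abbreviation fam :: "ctx \<Rightarrow> tm \<Rightarrow> tm \<Rightarrow> bool" where
  "fam \<Gamma> A F \<equiv> tj \<Gamma> F (TFun (TEl A) TSet)"

section \<open>Structural rules for typing, equality and truth\<close>

lemma tj_wfc: "tj \<Gamma> a A \<Longrightarrow> wfc \<Gamma>"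
  by (simp add: tj_def)

lemma mor_wfc: "mor \<Delta> s \<Gamma> \<Longrightarrow> wfc \<Delta>"
  by (simp add: mor_def)

lemma tj_subst: "tj \<Gamma> a A \<Longrightarrow> mor \<Delta> s \<Gamma> \<Longrightarrow> tj \<Delta> (subst_tm s a) (subst_ty s A)"
  using der.subst[of R \<Gamma> "HasType a A" \<Delta> s] by (auto simp: tj_def mor_def wfc_def)

lemma eqj_subst: "eqj \<Gamma> a b A \<Longrightarrow> mor \<Delta> s \<Gamma> \<Longrightarrow> eqj \<Delta> (subst_tm s a) (subst_tm s b) (subst_ty s A)"
  using der.subst[of R \<Gamma> "EqTerm a b A" \<Delta> s] by (auto simp: eqj_def mor_def wfc_def)

lemma tr_subst: "tr \<Gamma> A \<Longrightarrow> mor \<Delta> s \<Gamma> \<Longrightarrow> tr \<Delta> (subst_tm s A)"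
  unfolding tr_def using tj_subst by fastforce

lemma isset_subst: "isset \<Gamma> A \<Longrightarrow> mor \<Delta> s \<Gamma> \<Longrightarrow> isset \<Delta> (subst_tm s A)"
  using tj_subst by fastforce

lemma mor_Var: "wfc \<Gamma> \<Longrightarrow> mor \<Gamma> Var \<Gamma>"
  using der.var[of R \<Gamma>] by (auto simp: mor_def wfc_def)

lemma mor_lift: "wfc (A # \<Gamma>) \<Longrightarrow> mor (A # \<Gamma>) (\<lambda>i. Var (Suc i)) \<Gamma>"
  using der.var[of R "A # \<Gamma>" "Suc _"] by (auto simp: mor_def wfc_def subst_ty_subst)

lemma mor_cons: "mor \<Delta> s \<Gamma> \<Longrightarrow> tj \<Delta> a (subst_ty s A) \<Longrightarrow> mor \<Delta> (case_nat a s) (A # \<Gamma>)"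
  by (auto simp: mor_def tj_def less_Suc_eq_0_disj subst_ty_subst)

lemma mor_comp: "mor \<Theta> t \<Delta> \<Longrightarrow> mor \<Delta> s \<Gamma> \<Longrightarrow> mor \<Theta> (\<lambda>i. subst_tm t (s i)) \<Gamma>"
  unfolding mor_def wfc_def
proof (intro HOL.conjI allI impI)
  fix i assume *: "der R (\<Theta>, Wf) \<and> (\<forall>i<length \<Delta>. der R (\<Theta>, HasType (t i) (subst_ty t (weaken (Suc i) (\<Delta> ! i)))))"
    "der R (\<Delta>, Wf) \<and> (\<forall>i<length \<Gamma>. der R (\<Delta>, HasType (s i) (subst_ty s (weaken (Suc i) (\<Gamma> ! i)))))"
    "i < length \<Gamma>"
  then have "der R (\<Theta>, subst_stmt t (HasType (s i) (subst_ty s (weaken (Suc i) (\<Gamma> ! i)))))"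
    by (intro der.subst[of R \<Delta>]) auto
  then show "der R (\<Theta>, HasType (subst_tm t (s i)) (subst_ty (\<lambda>i. subst_tm t (s i)) (weaken (Suc i) (\<Gamma> ! i))))"
    by (simp add: subst_ty_subst)
qed auto

lemma wfc_Nil: "wfc []"
  by (simp add: wfc_def der.empty)

lemma mor_Nil: "wfc \<Delta> \<Longrightarrow> mor \<Delta> s []"
  by (simp add: mor_def)

lemma mor_sub1: "tj \<Gamma> a A \<Longrightarrow> mor \<Gamma> (sub1 a) (A # \<Gamma>)"
  by (rule mor_cons) (auto intro: mor_Var tj_wfc)

lemma wfc_SET: "wfc \<Gamma> \<Longrightarrow> wfc (TSet # \<Gamma>)"
  by (simp add: wfc_def der.extend der.set_form)

lemma wfc_El: "isset \<Gamma> A \<Longrightarrow> wfc (TEl A # \<Gamma>)"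
  by (simp add: wfc_def tj_def der.extend der.el_form)

lemma wfc_El_family: "isset \<Gamma> A \<Longrightarrow> tj (TEl A # \<Gamma>) B TSet \<Longrightarrow> wfc (TFun (TEl A) (TEl B) # \<Gamma>)"
  by (simp add: wfc_def tj_def der.extend der.el_form der.fun_form)

lemma wfc_fam: "isset \<Gamma> A \<Longrightarrow> wfc (TFun (TEl A) TSet # \<Gamma>)"
  using wfc_El[of \<Gamma> A] by (simp add: wfc_def tj_def der.extend der.el_form der.fun_form der.set_form)

lemma tj_Var0: "wfc (A # \<Gamma>) \<Longrightarrow> tj (A # \<Gamma>) (Var 0) (lift_ty A)"
  using der.var[of R "A # \<Gamma>" 0] by (simp add: tj_def wfc_def)

lemma tj_Var: "wfc \<Gamma> \<Longrightarrow> i < length \<Gamma> \<Longrightarrow> A = weaken (Suc i) (\<Gamma> ! i) \<Longrightarrow> tj \<Gamma> (Var i) A"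
  using der.var[of R \<Gamma> i] by (simp add: tj_def wfc_def)

lemma tj_lift: "tj \<Gamma> a B \<Longrightarrow> wfc (A # \<Gamma>) \<Longrightarrow> tj (A # \<Gamma>) (lift a) (lift_ty B)"
  using tj_subst[OF _ mor_lift] by simp

lemma isset_lift: "isset \<Gamma> B \<Longrightarrow> wfc (A # \<Gamma>) \<Longrightarrow> isset (A # \<Gamma>) (lift B)"
  using tj_lift by fastforce

lemma fam_lift: "fam \<Gamma> B F \<Longrightarrow> wfc (A # \<Gamma>) \<Longrightarrow> fam (A # \<Gamma>) (lift B) (lift F)"
  using tj_lift[of \<Gamma> F "TFun (TEl B) TSet"] by simp

lemma el_lift: "tj \<Gamma> a (TEl B) \<Longrightarrow> wfc (A # \<Gamma>) \<Longrightarrow> tj (A # \<Gamma>) (lift a) (TEl (lift B))"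
  using tj_lift[of \<Gamma> a "TEl B"] by simp

lemma tr_lift: "tr \<Gamma> B \<Longrightarrow> wfc (A # \<Gamma>) \<Longrightarrow> tr (A # \<Gamma>) (lift B)"
  using el_lift unfolding tr_def by blast

lemma el_Var0: "isset \<Gamma> A \<Longrightarrow> tj (TEl A # \<Gamma>) (Var 0) (TEl (lift A))"
  using tj_Var0[OF wfc_El] by simp

text \<open>The rule \<open>prim\<close> types a constant in the empty context only. Into that
  context every substitution is a morphism, in particular \<open>Var\<close>, which leaves constant
  and type literally unchanged.\<close>

lemma tj_prim: "wfc \<Gamma> \<Longrightarrow> legal_prim c \<Longrightarrow> A = prim_type c 0 \<Longrightarrow> tj \<Gamma> (Const (Prim c)) A"
  using tj_subst[OF _ mor_Nil, of "Const (Prim c)" "prim_type c 0" \<Gamma> Var] der.prim[of c R] wfc_Nil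
  by (simp add: tj_def)

lemma tj_app: "tj \<Gamma> c (TFun A B) \<Longrightarrow> tj \<Gamma> a A \<Longrightarrow> B' = subst_ty (sub1 a) B \<Longrightarrow> tj \<Gamma> (App c a) B'"
  by (auto simp: tj_def intro: der.app)

lemma tj_abs: "wfc \<Gamma> \<Longrightarrow> tj (A # \<Gamma>) b B \<Longrightarrow> tj \<Gamma> (Lam b) (TFun A B)"
  by (auto simp: tj_def intro: der.abs)

lemma tj_conv: "tj \<Gamma> t (TEl a) \<Longrightarrow> eqj \<Gamma> a b TSet \<Longrightarrow> tj \<Gamma> t (TEl b)"
  by (auto simp: tj_def eqj_def intro: der.conv der.el_eq)

lemma eqj_conv: "eqj \<Gamma> t u (TEl a) \<Longrightarrow> eqj \<Gamma> a b TSet \<Longrightarrow> eqj \<Gamma> t u (TEl b)"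
  by (auto simp: tj_def eqj_def intro: der.conv_eq der.el_eq)

lemma tr_conv: "tr \<Gamma> a \<Longrightarrow> eqj \<Gamma> a b TSet \<Longrightarrow> tr \<Gamma> b"
  unfolding tr_def using tj_conv by blast

lemma eqj_refl: "tj \<Gamma> a A \<Longrightarrow> eqj \<Gamma> a a A"
  by (auto simp: tj_def eqj_def intro: der.tm_refl)

lemma eqj_sym: "eqj \<Gamma> a b A \<Longrightarrow> eqj \<Gamma> b a A"
  by (auto simp: eqj_def intro: der.tm_sym)

lemma eqj_trans: "eqj \<Gamma> a b A \<Longrightarrow> eqj \<Gamma> b c A \<Longrightarrow> eqj \<Gamma> a c A"
  by (auto simp: eqj_def intro: der.tm_trans)

lemma eqj_app: "eqj \<Gamma> c c' (TFun A B) \<Longrightarrow> eqj \<Gamma> a a' A \<Longrightarrow> B' = subst_ty (sub1 a) B \<Longrightarrow>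
    eqj \<Gamma> (App c a) (App c' a') B'"
  by (auto simp: eqj_def intro: der.app_eq)

lemma eqj_beta: "tj (A # \<Gamma>) b B \<Longrightarrow> tj \<Gamma> a A \<Longrightarrow> b' = subst_tm (sub1 a) b \<Longrightarrow> B' = subst_ty (sub1 a) B \<Longrightarrow>
    eqj \<Gamma> (App (Lam b) a) b' B'"
  by (auto simp: tj_def eqj_def intro: der.beta)

lemma eqj_beta_set: "isset (TEl A # \<Gamma>) B \<Longrightarrow> tj \<Gamma> a (TEl A) \<Longrightarrow>
    eqj \<Gamma> (App (Lam B) a) (subst_tm (sub1 a) B) TSet"
  by (rule eqj_beta, assumption, assumption) simp_all

section \<open>Products, disjoint unions and falsity\<close>

lemma fam_app: "fam \<Gamma> A F \<Longrightarrow> tj \<Gamma> a (TEl A) \<Longrightarrow> isset \<Gamma> (App F a)"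
  by (rule tj_app, assumption, assumption) simp

lemma fam_Lam: "isset \<Gamma> A \<Longrightarrow> isset (TEl A # \<Gamma>) B \<Longrightarrow> fam \<Gamma> A (Lam B)"
  by (rule tj_abs) (auto intro: tj_wfc)

lemma isset_PI: "isset \<Gamma> A \<Longrightarrow> fam \<Gamma> A F \<Longrightarrow> isset \<Gamma> (PI' A F)"
  and isset_SIG: "isset \<Gamma> A \<Longrightarrow> fam \<Gamma> A F \<Longrightarrow> isset \<Gamma> (SIG' A F)"
  by ((rule tj_app)+, rule tj_prim, auto simp: hoas_ty_defs intro: tj_wfc)+

lemma isset_ID: "isset \<Gamma> A \<Longrightarrow> tj \<Gamma> a (TEl A) \<Longrightarrow> tj \<Gamma> b (TEl A) \<Longrightarrow> isset \<Gamma> (ID' A a b)"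
  by ((rule tj_app)+, rule tj_prim, auto simp: hoas_ty_defs intro: tj_wfc)

lemma fam_app_Var: "isset \<Gamma> A \<Longrightarrow> fam \<Gamma> A F \<Longrightarrow> isset (TEl A # \<Gamma>) (App (lift F) (Var 0))"
  using fam_app[OF fam_lift el_Var0] wfc_El by blast

lemma const_fam:
  assumes "isset \<Gamma> A" "isset \<Gamma> B"
  shows "fam \<Gamma> A (Lam (lift B))"
  using assms by (intro fam_Lam isset_lift wfc_El)

lemma const_fam_eq:
  assumes "isset \<Gamma> A" "isset \<Gamma> B" "tj \<Gamma> a (TEl A)"
  shows "eqj \<Gamma> (App (Lam (lift B)) a) B TSet"
  using eqj_beta_set[OF isset_lift[OF assms(2) wfc_El[OF assms(1)]] assms(3)] by simp

lemma tr_PI_I: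
  assumes "isset \<Gamma> A" "fam \<Gamma> A F" "tr (TEl A # \<Gamma>) (App (lift F) (Var 0))"
  shows "tr \<Gamma> (PI' A F)"
proof -
  obtain t where t: "tj (TEl A # \<Gamma>) t (TEl (App (lift F) (Var 0)))" using assms(3) by (auto simp: tr_def)
  have "tj \<Gamma> (App (App (App (Const (Prim LAMBDA)) A) F) (Lam t)) (TEl (PI' A F))"
    by ((rule tj_app)+, rule tj_prim)
      (use assms t in \<open>auto simp: hoas_ty_defs intro: tj_wfc tj_abs\<close>)
  then show ?thesis by (auto simp: tr_def)
qed

text \<open>Elements of \<open>PI\<close> are not applied directly but eliminated by
  \<open>FUNSPLIT\<close>. Application to a is the case of the constant motive
  \<open>App F a\<close> with the branch that sends y to y a.\<close>

lemma tr_PI_E: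
  assumes "isset \<Gamma> A" "fam \<Gamma> A F" "tr \<Gamma> (PI' A F)" "tj \<Gamma> a (TEl A)"
  shows "tr \<Gamma> (App F a)"
proof -
  obtain p where p: "tj \<Gamma> p (TEl (PI' A F))" using assms(3) by (auto simp: tr_def)
  let ?B = "App F a" and ?X = "TFun (TEl A) (TEl (App (lift F) (Var 0)))"
  have wf: "wfc \<Gamma>" using assms(1) tj_wfc by blast
  have wfX: "wfc (?X # \<Gamma>)" by (intro wfc_El_family assms fam_app_Var)
  have B: "isset \<Gamma> ?B" by (rule fam_app[OF assms(2,4)])
  have lam: "tj (?X # \<Gamma>) (App (App (App (Const (Prim LAMBDA)) (lift A)) (lift F)) (Var 0))
      (TEl (PI' (lift A) (lift F)))"
    by ((rule tj_app)+, rule tj_prim[OF wfX])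
      (auto simp: hoas_ty_defs intro: isset_lift[OF assms(1) wfX] fam_lift[OF assms(2) wfX]
        tj_Var0[OF wfX, simplified])
  have "tj (?X # \<Gamma>) (App (Var 0) (lift a)) (TEl (lift ?B))"
    by (rule tj_app[OF tj_Var0[OF wfX, simplified] el_lift[OF assms(4) wfX]]) simp
  \<comment> \<open>\<open>FUNSPLIT\<close> expects the branch at the motive applied to a canonical
    element, which is a redex of the constant family. The type is expanded to that redex here and
    contracted after the elimination.\<close>
  then have "tj (?X # \<Gamma>) (App (Var 0) (lift a)) (TEl (App (Lam (lift (lift ?B)))
      (App (App (App (Const (Prim LAMBDA)) (lift A)) (lift F)) (Var 0))))"
    by (rule tj_conv[OF _ eqj_sym[OF const_fam_eq[OF _ isset_lift[OF B wfX] lam]]])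
      (intro isset_PI isset_lift[OF assms(1) wfX] fam_lift[OF assms(2) wfX])
  then have d: "tj \<Gamma> (Lam (App (Var 0) (lift a))) (TFun ?X (TEl (App (Lam (lift (lift ?B)))
      (App (App (App (Const (Prim LAMBDA)) (lift A)) (lift F)) (Var 0)))))"
    by (rule tj_abs[OF wf])
  have "tj \<Gamma> (App (App (App (App (App (Const (Prim FUNSPLIT)) A) F) (Lam (lift ?B)))
      (Lam (App (Var 0) (lift a)))) p) (TEl (App (Lam (lift ?B)) p))"
    by ((rule tj_app)+, rule tj_prim[OF wf])
      (use d p assms const_fam[OF isset_PI[OF assms(1,2)] B] in \<open>auto simp: hoas_ty_defs\<close>)
  then have "tj \<Gamma> (App (App (App (App (App (Const (Prim FUNSPLIT)) A) F) (Lam (lift ?B)))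
      (Lam (App (Var 0) (lift a)))) p) (TEl ?B)"
    by (rule tj_conv[OF _ const_fam_eq[OF isset_PI[OF assms(1,2)] B p]])
  then show ?thesis by (auto simp: tr_def)
qed

lemma der_subst: "der R (\<Theta>, J) \<Longrightarrow> mor \<Delta> s \<Theta> \<Longrightarrow> der R (\<Delta>, subst_stmt s J)"
  using der.subst[of R \<Theta> J \<Delta> s] by (auto simp: mor_def wfc_def)

lemma tj_PAIR:
  assumes "isset \<Gamma> A" "fam \<Gamma> A F" "tj \<Gamma> a (TEl A)" "tj \<Gamma> b (TEl (App F a))"
  shows "tj \<Gamma> (PAIR' A F a b) (TEl (SIG' A F))"
  by ((rule tj_app)+, rule tj_prim)
    (use assms in \<open>auto simp: hoas_ty_defs intro: tj_wfc\<close>)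

lemma tj_SPLIT:
  assumes "isset \<Gamma> A" "fam \<Gamma> A F" "fam \<Gamma> (SIG' A F) C" "tj \<Gamma> p (TEl (SIG' A F))"
    and "tj \<Gamma> d (TFun (TEl A) (TFun (TEl (App (lift F) (Var 0)))
      (TEl (App (lift (lift C)) (PAIR' (lift (lift A)) (lift (lift F)) (Var 1) (Var 0))))))"
  shows "tj \<Gamma> (SPLIT' A F C d p) (TEl (App C p))"
  by ((rule tj_app)+, rule tj_prim)
    (use assms in \<open>auto simp: hoas_ty_defs intro: tj_wfc\<close>)

lemma eqj_SPLIT:
  assumes "isset \<Gamma> A" "fam \<Gamma> A F" "fam \<Gamma> (SIG' A F) C" "tj \<Gamma> a (TEl A)" "tj \<Gamma> b (TEl (App F a))"
    and "tj \<Gamma> d (TFun (TEl A) (TFun (TEl (App (lift F) (Var 0)))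
      (TEl (App (lift (lift C)) (PAIR' (lift (lift A)) (lift (lift F)) (Var 1) (Var 0))))))"
  shows "eqj \<Gamma> (SPLIT' A F C d (PAIR' A F a b)) (App (App d a) b) (TEl (App C (PAIR' A F a b)))"
proof -
  \<comment> \<open>The six hypotheses of the law, the latest first: variables 5 to 0 are A, B, C,
    d, a and b, for which the morphism \<open>m\<close> puts the actual arguments.\<close>
  let ?T = "[TEl (App (Var 3) (Var 0)), TEl (Var 3),
     TFun (TEl (Var 2)) (TFun (TEl (App (Var 2) (Var 0))) (TEl (App (Var 2) (PAIR' (Var 4) (Var 3) (Var 1) (Var 0))))),
     TFun (TEl (SIG' (Var 1) (Var 0))) TSet, TFun (TEl (Var 0)) TSet, TSet]"
  have m: "mor \<Gamma> (case_nat b (case_nat a (case_nat d (case_nat C (case_nat F (case_nat A Var)))))) ?T"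
    by ((rule mor_cons)+, rule mor_Nil) (use assms in \<open>simp_all add: tj_wfc\<close>)
  have "der R (?T, EqTerm (SPLIT' (Var 5) (Var 4) (Var 3) (Var 2) (PAIR' (Var 5) (Var 4) (Var 1) (Var 0)))
      (App (App (Var 2) (Var 1)) (Var 0)) (TEl (App (Var 3) (PAIR' (Var 5) (Var 4) (Var 1) (Var 0)))))"
    using der.law[OF laws.split, of R]
    by (simp only: law_judgement.simps list.size add_0_right add_Suc_right
        Fun_def arrow_def SET_def El_def tapp_def) (simp add: cn_def bound_def eval_nat_numeral)
  from der_subst[OF this m] show ?thesis
    using assms(1) by (simp add: eqj_def tj_wfc)
qed

definition FST :: "tm \<Rightarrow> tm \<Rightarrow> tm \<Rightarrow> tm" where
  "FST A F p = SPLIT' A F (Lam (lift A)) (Lam (Lam (Var 1))) p"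

lemma subst_FST [simp]: "subst_tm s (FST A F p) = FST (subst_tm s A) (subst_tm s F) (subst_tm s p)"
  by (simp add: FST_def)

lemma lift_FST [simp]: "lift (FST A F p) = FST (lift A) (lift F) (lift p)"
  using subst_FST[of "\<lambda>i. Var (Suc i)" A F p] by simp

lemma FST_branch:
  assumes "isset \<Gamma> A" "fam \<Gamma> A F"
  shows "tj \<Gamma> (Lam (Lam (Var 1))) (TFun (TEl A) (TFun (TEl (App (lift F) (Var 0)))
      (TEl (App (lift (lift (Lam (lift A)))) (PAIR' (lift (lift A)) (lift (lift F)) (Var 1) (Var 0))))))"
proof -
  have wf: "wfc \<Gamma>" using assms tj_wfc by blast
  have wf1: "wfc (TEl A # \<Gamma>)" by (rule wfc_El[OF assms(1)])
  have wf2: "wfc (TEl (App (lift F) (Var 0)) # TEl A # \<Gamma>)" by (rule wfc_El[OF fam_app_Var[OF assms]])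
  let ?G = "TEl (App (lift F) (Var 0)) # TEl A # \<Gamma>"
  have A2: "isset ?G (lift (lift A))" and F2: "fam ?G (lift (lift A)) (lift (lift F))"
    by (intro isset_lift fam_lift assms wf1 wf2)+
  have a: "tj ?G (Var 1) (TEl (lift (lift A)))" by (rule tj_Var[OF wf2]) simp_all
  have b: "tj ?G (Var 0) (TEl (App (lift (lift F)) (Var 1)))"
    using tj_Var0[OF wf2] by simp
  have "tj ?G (Var 1) (TEl (App (Lam (lift (lift (lift A)))) (PAIR' (lift (lift A)) (lift (lift F)) (Var 1) (Var 0))))"
    by (rule tj_conv[OF a eqj_sym[OF const_fam_eq[OF isset_SIG[OF A2 F2] A2 tj_PAIR[OF A2 F2 a b]]]])
  then show ?thesis by (auto intro!: tj_abs wf wf1)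
qed

lemma tj_FST:
  assumes "isset \<Gamma> A" "fam \<Gamma> A F" "tj \<Gamma> p (TEl (SIG' A F))"
  shows "tj \<Gamma> (FST A F p) (TEl A)"
  unfolding FST_def
  by (rule tj_conv[OF tj_SPLIT const_fam_eq[OF isset_SIG[OF assms(1,2)] assms(1,3)]])
    (intro assms const_fam isset_SIG FST_branch)+

lemma eqj_FST_PAIR:
  assumes "isset \<Gamma> A" "fam \<Gamma> A F" "tj \<Gamma> a (TEl A)" "tj \<Gamma> b (TEl (App F a))"
  shows "eqj \<Gamma> (FST A F (PAIR' A F a b)) a (TEl A)"
proof -
  let ?G = "TEl (App (lift F) (Var 0)) # TEl A # \<Gamma>"
  have wf1: "wfc (TEl A # \<Gamma>)" by (rule wfc_El[OF assms(1)])
  have wf2: "wfc ?G" by (rule wfc_El[OF fam_app_Var[OF assms(1,2)]])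
  have v: "tj ?G (Var 1) (TEl (lift (lift A)))" by (rule tj_Var[OF wf2]) simp_all
  have "eqj \<Gamma> (App (Lam (Lam (Var 1))) a) (Lam (lift a)) (TFun (TEl (App F a)) (TEl (lift A)))"
    by (rule eqj_beta[OF tj_abs[OF wf1 v] assms(3)]) simp_all
  then have 1: "eqj \<Gamma> (App (App (Lam (Lam (Var 1))) a) b) (App (Lam (lift a)) b) (TEl A)"
    by (rule eqj_app[OF _ eqj_refl[OF assms(4)]]) simp
  have 2: "eqj \<Gamma> (App (Lam (lift a)) b) a (TEl A)"
    by (rule eqj_beta[OF el_lift[OF assms(3) wfc_El[OF fam_app[OF assms(2,3)]]] assms(4)]) simp_all
  have p: "tj \<Gamma> (PAIR' A F a b) (TEl (SIG' A F))" by (rule tj_PAIR[OF assms])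
  have S: "isset \<Gamma> (SIG' A F)" by (rule isset_SIG[OF assms(1,2)])
  have "eqj \<Gamma> (FST A F (PAIR' A F a b)) (App (App (Lam (Lam (Var 1))) a) b) (TEl A)"
    unfolding FST_def
    by (rule eqj_conv[OF eqj_SPLIT[OF assms(1,2) const_fam[OF S assms(1)] assms(3,4) FST_branch[OF assms(1,2)]]
          const_fam_eq[OF S assms(1) p]])
  from eqj_trans[OF this eqj_trans[OF 1 2]] show ?thesis .
qed

text \<open>The type of the second projection mentions the first one, so the motive is a family over the
  disjoint union.\<close>

lemma tr_SIG_E:
  assumes A: "isset \<Gamma> A" and F: "fam \<Gamma> A F" and "tr \<Gamma> (SIG' A F)"
  obtains a where "tj \<Gamma> a (TEl A)" "tr \<Gamma> (App F a)"
proof -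
  obtain p where p: "tj \<Gamma> p (TEl (SIG' A F))" using assms(3) by (auto simp: tr_def)
  define snd_fam where "snd_fam A F = Lam (App (lift F) (FST (lift A) (lift F) (Var 0)))" for A F
  have lift_fam: "lift (snd_fam A F) = snd_fam (lift A) (lift F)" for A F
    by (simp add: snd_fam_def FST_def)
  have body: "isset (TEl (SIG' A F) # \<Gamma>) (App (lift F) (FST (lift A) (lift F) (Var 0)))"
    if "isset \<Gamma> A" "fam \<Gamma> A F" for \<Gamma> A F
  proof -
    have wf: "wfc (TEl (SIG' A F) # \<Gamma>)" by (intro wfc_El isset_SIG that)
    have "tj (TEl (SIG' A F) # \<Gamma>) (Var 0) (TEl (SIG' (lift A) (lift F)))"
      using el_Var0[OF isset_SIG[OF that]] by simp
    then show ?thesis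
      by (intro fam_app[OF fam_lift[OF that(2) wf]] tj_FST isset_lift[OF that(1) wf] fam_lift[OF that(2) wf])
  qed
  have fam: "fam \<Gamma> (SIG' A F) (snd_fam A F)" if "isset \<Gamma> A" "fam \<Gamma> A F" for \<Gamma> A F
    unfolding snd_fam_def by (intro fam_Lam isset_SIG body that)
  have eq: "eqj \<Gamma> (App (snd_fam A F) p) (App F (FST A F p)) TSet"
    if "isset \<Gamma> A" "fam \<Gamma> A F" "tj \<Gamma> p (TEl (SIG' A F))" for \<Gamma> A F p
    using eqj_beta_set[OF body[OF that(1,2)] that(3)] by (simp add: snd_fam_def)
  let ?G = "TEl (App (lift F) (Var 0)) # TEl A # \<Gamma>"
  have wf: "wfc \<Gamma>" using A tj_wfc by blast
  have wf1: "wfc (TEl A # \<Gamma>)" by (rule wfc_El[OF A])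
  have wf2: "wfc ?G" by (rule wfc_El[OF fam_app_Var[OF A F]])
  have A2: "isset ?G (lift (lift A))" and F2: "fam ?G (lift (lift A)) (lift (lift F))"
    by (intro isset_lift fam_lift A F wf1 wf2)+
  have a: "tj ?G (Var 1) (TEl (lift (lift A)))" by (rule tj_Var[OF wf2]) simp_all
  have b: "tj ?G (Var 0) (TEl (App (lift (lift F)) (Var 1)))"
    using tj_Var0[OF wf2] by simp
  let ?p = "PAIR' (lift (lift A)) (lift (lift F)) (Var 1) (Var 0)"
  have pair: "tj ?G ?p (TEl (SIG' (lift (lift A)) (lift (lift F))))" by (rule tj_PAIR[OF A2 F2 a b])
  \<comment> \<open>The first projection of a pair computes, so the motive at the pair equals the
    type of the second component. This is what types the branch that returns its second
    argument.\<close>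
  have "eqj ?G (App (lift (lift F)) (FST (lift (lift A)) (lift (lift F)) ?p)) (App (lift (lift F)) (Var 1)) TSet"
    by (rule eqj_app[OF eqj_refl[OF F2] eqj_FST_PAIR[OF A2 F2 a b]]) simp
  with eq[OF A2 F2 pair] have "eqj ?G (App (snd_fam (lift (lift A)) (lift (lift F))) ?p) (App (lift (lift F)) (Var 1)) TSet"
    by (rule eqj_trans)
  from tj_conv[OF b eqj_sym[OF this]]
  have "tj \<Gamma> (Lam (Lam (Var 0))) (TFun (TEl A) (TFun (TEl (App (lift F) (Var 0)))
      (TEl (App (lift (lift (snd_fam A F))) ?p))))"
    by (auto simp: lift_fam intro!: tj_abs wf wf1)
  from tj_conv[OF tj_SPLIT[OF A F fam[OF A F] p this] eq[OF A F p]]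
  have "tr \<Gamma> (App F (FST A F p))" by (auto simp: tr_def)
  with tj_FST[OF A F p] show ?thesis by (rule that)
qed

lemma tr_SIG_I:
  assumes "isset \<Gamma> A" "fam \<Gamma> A F" "tj \<Gamma> a (TEl A)" "tr \<Gamma> (App F a)"
  shows "tr \<Gamma> (SIG' A F)"
  using assms(4) tj_PAIR[OF assms(1-3)] by (auto simp: tr_def)

lemma tr_FALSE_E:
  assumes "tr \<Gamma> (FALSE)" "isset \<Gamma> B"
  shows "tr \<Gamma> B"
proof -
  obtain t where t: "tj \<Gamma> t (TEl (FALSE))" using assms(1) by (auto simp: tr_def)
  have wf: "wfc \<Gamma>" using t tj_wfc by blast
  have N: "isset \<Gamma> (FALSE)" by (rule tj_prim[OF wf]) (simp_all add: hoas_ty_defs)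
  have "tj \<Gamma> (App (App (Const (Prim (Case 0))) (Lam (lift B))) t) (TEl (App (Lam (lift B)) t))"
    by ((rule tj_app)+, rule tj_prim[OF wf])
      (use t const_fam[OF N assms(2)] in \<open>auto simp: hoas_ty_defs\<close>)
  from tj_conv[OF this const_fam_eq[OF N assms(2) t]] show ?thesis by (auto simp: tr_def)
qed

lemma isset_Fin: "wfc \<Gamma> \<Longrightarrow> isset \<Gamma> (Const (Prim (Fin n)))"
  by (rule tj_prim) (simp_all add: hoas_ty_defs)

lemma tr_TRUE: "wfc \<Gamma> \<Longrightarrow> tr \<Gamma> UNIT"
  unfolding tr_def by (rule exI[of _ "Const (Prim (Elt 1 0))"], rule tj_prim) (simp_all add: hoas_ty_defs)

section \<open>Identity sets, universe codes and the uniformity constants\<close>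

lemma tr_REFL:
  assumes "isset \<Gamma> A" "tj \<Gamma> a (TEl A)"
  shows "tr \<Gamma> (ID' A a a)"
proof -
  have "tj \<Gamma> (App (App (Const (Prim REFL)) A) a) (TEl (ID' A a a))"
    by ((rule tj_app)+, rule tj_prim) (use assms in \<open>auto simp: hoas_ty_defs intro: tj_wfc\<close>)
  then show ?thesis by (auto simp: tr_def)
qed

lemma isset_Univ: "wfc \<Gamma> \<Longrightarrow> isset \<Gamma> (Const (Prim (Univ n)))"
  by (rule tj_prim) (simp_all add: hoas_ty_defs)

lemma isset_Dec: "tj \<Gamma> k (TEl (Const (Prim (Univ n)))) \<Longrightarrow> isset \<Gamma> (App (Const (Prim (Dec n))) k)"
  by (rule tj_app, rule tj_prim) (auto simp: hoas_ty_defs intro: tj_wfc)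

lemma tj_CFin: "wfc \<Gamma> \<Longrightarrow> tj \<Gamma> (Const (Prim (CFin n k))) (TEl (Const (Prim (Univ n))))"
  by (rule tj_prim) (simp_all add: hoas_ty_defs)

lemma eqj_Dec_CFin:
  "wfc \<Gamma> \<Longrightarrow> eqj \<Gamma> (App (Const (Prim (Dec n))) (Const (Prim (CFin n k)))) (Const (Prim (Fin k))) TSet"
  using der_subst[OF der.law[OF laws.dec_fin, simplified] mor_Nil, of \<Gamma> Var n k]
  by (simp add: hoas_ty_defs eqj_def)

text \<open>Weakening fixes variable 0 of the body and raises the others by two; instantiating with
  the newest variable lowers these by one, so the composite is the identity.\<close>

lemma eqj_beta_lift:
  assumes "tj (A # \<Gamma>) b B" "wfc (lift_ty A # A # \<Gamma>)"
  shows "eqj (A # \<Gamma>) (App (lift (Lam b)) (Var 0)) b B"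
proof -
  have wf: "wfc (A # \<Gamma>)" using assms(1) tj_wfc by blast
  let ?s = "case_nat (Var 0) (\<lambda>i. Var (Suc (Suc i)))"
  have "mor (lift_ty A # A # \<Gamma>) (\<lambda>i. Var (Suc (Suc i))) \<Gamma>"
    using mor_comp[OF mor_lift[OF assms(2)] mor_lift[OF wf]] by simp
  moreover have "tj (lift_ty A # A # \<Gamma>) (Var 0) (subst_ty (\<lambda>i. Var (Suc (Suc i))) A)"
    using tj_Var0[OF assms(2)] by (simp add: subst_ty_subst)
  ultimately have "mor (lift_ty A # A # \<Gamma>) ?s (A # \<Gamma>)"
    by (rule mor_cons)
  from tj_subst[OF assms(1) this]
  have b: "tj (lift_ty A # A # \<Gamma>) (subst_tm ?s b) (subst_ty ?s B)" .
  have ren: "ren_tm (up_var Suc) b = subst_tm ?s b"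
    unfolding ren_tm_subst by (rule subst_tm_cong) (simp add: up_var_def split: nat.split)
  have s: "(\<lambda>i. subst_tm (case_nat (Var 0) Var) (?s i)) = Var"
    by (simp add: fun_eq_iff split: nat.split)
  have v: "tj (A # \<Gamma>) (Var 0) (lift_ty A)" by (rule tj_Var0[OF wf])
  show ?thesis
    by (simp add: ren) (rule eqj_beta[OF b v], simp_all add: subst_tm_subst subst_ty_subst s)
qed

text \<open>A motive for \<open>IDPEEL\<close>: to x, y and a proof that x equals y it assigns the
  proposition that G y implies G x.\<close>

definition transport :: "tm \<Rightarrow> tm" where
  "transport G = Lam (Lam (Lam (PI' (App (lift (lift (lift G))) (Var 1))
    (Lam (App (lift (lift (lift (lift G)))) (Var 3))))))"

lemma subst_transport [simp]: "subst_tm s (transport G) = transport (subst_tm s G)"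
  by (simp add: transport_def eval_nat_numeral)

lemma lift_transport [simp]: "lift (transport G) = transport (lift G)"
  using subst_transport[of "\<lambda>i. Var (Suc i)" G] by simp

lemma transport:
  assumes A: "isset \<Gamma> A" and G: "fam \<Gamma> A G"
  shows "tj \<Gamma> (transport G) (TFun (TEl A) (TFun (TEl (lift A)) (TFun (TEl (ID' (lift (lift A)) (Var 1) (Var 0))) TSet)))"
    and "tj \<Gamma> a (TEl A) \<Longrightarrow> tj \<Gamma> b (TEl A) \<Longrightarrow> tj \<Gamma> e (TEl (ID' A a b)) \<Longrightarrow>
      eqj \<Gamma> (App (App (App (transport G) a) b) e) (PI' (App G b) (Lam (lift (App G a)))) TSet"
proof -
  let ?G1 = "TEl A # \<Gamma>" let ?G2 = "TEl (lift A) # ?G1"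
  let ?G3 = "TEl (ID' (lift (lift A)) (Var 1) (Var 0)) # ?G2"
  have wf: "wfc \<Gamma>" using A tj_wfc by blast
  have wf1: "wfc ?G1" by (rule wfc_El[OF A])
  have A1: "isset ?G1 (lift A)" by (rule isset_lift[OF A wf1])
  have wf2: "wfc ?G2" by (rule wfc_El[OF A1])
  have A2: "isset ?G2 (lift (lift A))" by (rule isset_lift[OF A1 wf2])
  have ID2: "isset ?G2 (ID' (lift (lift A)) (Var 1) (Var 0))"
    by (rule isset_ID[OF A2]) (rule tj_Var[OF wf2], simp_all)+
  have wf3: "wfc ?G3" by (rule wfc_El[OF ID2])
  have A3: "isset ?G3 (lift (lift (lift A)))" by (rule isset_lift[OF A2 wf3])
  have G3: "fam ?G3 (lift (lift (lift A))) (lift (lift (lift G)))"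
    by (intro fam_lift G wf1 wf2 wf3)
  have x: "tj ?G3 (Var 2) (TEl (lift (lift (lift A))))"
    by (rule tj_Var[OF wf3]) (simp_all add: eval_nat_numeral)
  have y: "tj ?G3 (Var 1) (TEl (lift (lift (lift A))))"
    by (rule tj_Var[OF wf3]) simp_all
  have Gy: "isset ?G3 (App (lift (lift (lift G))) (Var 1))" by (rule fam_app[OF G3 y])
  have Gx: "isset ?G3 (App (lift (lift (lift G))) (Var 2))" by (rule fam_app[OF G3 x])
  have body: "isset ?G3 (PI' (App (lift (lift (lift G))) (Var 1)) (Lam (App (lift (lift (lift (lift G)))) (Var 3))))"
    using isset_PI[OF Gy const_fam[OF Gy Gx]] by (simp add: eval_nat_numeral)
  have t3: "tj ?G2 (Lam (PI' (App (lift (lift (lift G))) (Var 1)) (Lam (App (lift (lift (lift (lift G)))) (Var 3)))))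
      (TFun (TEl (ID' (lift (lift A)) (Var 1) (Var 0))) TSet)" by (rule tj_abs[OF wf2 body])
  have t2: "tj ?G1 (Lam (Lam (PI' (App (lift (lift (lift G))) (Var 1)) (Lam (App (lift (lift (lift (lift G)))) (Var 3))))))
      (TFun (TEl (lift A)) (TFun (TEl (ID' (lift (lift A)) (Var 1) (Var 0))) TSet))"
    by (rule tj_abs[OF wf1 t3])
  show "tj \<Gamma> (transport G) (TFun (TEl A) (TFun (TEl (lift A)) (TFun (TEl (ID' (lift (lift A)) (Var 1) (Var 0))) TSet)))"
    unfolding transport_def by (rule tj_abs[OF wf t2])
  assume a: "tj \<Gamma> a (TEl A)" and b: "tj \<Gamma> b (TEl A)" and e: "tj \<Gamma> e (TEl (ID' A a b))"
  have ma: "mor \<Gamma> (case_nat a Var) ?G1" by (rule mor_cons[OF mor_Var[OF wf]]) (simp add: a)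
  have mb: "mor \<Gamma> (case_nat b (case_nat a Var)) ?G2" by (rule mor_cons[OF ma]) (simp add: b)
  have lift_a: "tj (TEl A # \<Gamma>) (lift a) (TEl (lift A))" by (rule el_lift[OF a wf1])
  have mb': "mor (TEl A # \<Gamma>) (case_nat (Var 0) (case_nat (lift a) (\<lambda>i. Var (Suc i)))) ?G2"
    by (intro mor_cons mor_lift wf1) (simp_all add: lift_a el_Var0[OF A])
  have ID1: "isset (TEl A # \<Gamma>) (ID' (lift A) (lift a) (Var 0))"
    by (rule isset_ID[OF A1 lift_a el_Var0[OF A]])
  have "eqj \<Gamma> (App (transport G) a) (Lam (Lam (PI' (App (lift (lift G)) (Var 1)) (Lam (App (lift (lift (lift G))) (lift (lift (lift a))))))))
      (TFun (TEl A) (TFun (TEl (ID' (lift A) (lift a) (Var 0))) TSet))"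
    unfolding transport_def by (rule eqj_beta[OF t2 a]) (simp_all add: eval_nat_numeral)
  then have 1: "eqj \<Gamma> (App (App (transport G) a) b)
      (App (Lam (Lam (PI' (App (lift (lift G)) (Var 1)) (Lam (App (lift (lift (lift G))) (lift (lift (lift a)))))))) b)
      (TFun (TEl (ID' A a b)) TSet)"
    by (rule eqj_app[OF _ eqj_refl[OF b]]) simp
  have t3': "tj ?G1 (Lam (PI' (App (lift (lift G)) (Var 1)) (Lam (App (lift (lift (lift G))) (lift (lift (lift a)))))))
      (TFun (TEl (ID' (lift A) (lift a) (Var 0))) TSet)"
    using tj_subst[OF t3 mb'] by (simp add: eval_nat_numeral)
  have 2: "eqj \<Gamma> (App (Lam (Lam (PI' (App (lift (lift G)) (Var 1)) (Lam (App (lift (lift (lift G))) (lift (lift (lift a)))))))) b)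
      (Lam (PI' (App (lift G) (lift b)) (Lam (App (lift (lift G)) (lift (lift a))))))
      (TFun (TEl (ID' A a b)) TSet)"
    by (rule eqj_beta[OF t3' b]) simp_all
  have 3: "eqj \<Gamma> (App (App (App (transport G) a) b) e)
      (App (Lam (PI' (App (lift G) (lift b)) (Lam (App (lift (lift G)) (lift (lift a)))))) e) TSet"
    by (rule eqj_app[OF eqj_trans[OF 1 2] eqj_refl[OF e]]) simp
  have Ge: "isset (TEl (ID' A a b) # \<Gamma>) (PI' (App (lift G) (lift b)) (Lam (App (lift (lift G)) (lift (lift a)))))"
    using isset_lift[OF isset_PI[OF fam_app[OF G b] const_fam[OF fam_app[OF G b] fam_app[OF G a]]]
        wfc_El[OF isset_ID[OF A a b]]] by simp
  have 4: "eqj \<Gamma> (App (Lam (PI' (App (lift G) (lift b)) (Lam (App (lift (lift G)) (lift (lift a)))))) e)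
      (PI' (App G b) (Lam (lift (App G a)))) TSet"
    by (rule eqj_beta[OF Ge e]) simp_all
  show "eqj \<Gamma> (App (App (App (transport G) a) b) e) (PI' (App G b) (Lam (lift (App G a)))) TSet"
    by (rule eqj_trans[OF 3 4])
qed

text \<open>Eliminating the identity proof leaves the reflexive case, in which the motive is G x
  implies G x, proved by the identity.\<close>

lemma tr_transport:
  assumes A: "isset \<Gamma> A" and G: "fam \<Gamma> A G" and a: "tj \<Gamma> a (TEl A)" and b: "tj \<Gamma> b (TEl A)"
    and "tr \<Gamma> (ID' A a b)" "tr \<Gamma> (App G b)"
  shows "tr \<Gamma> (App G a)"
proof -
  obtain e where e: "tj \<Gamma> e (TEl (ID' A a b))" using assms(5) by (auto simp: tr_def)
  have wf: "wfc \<Gamma>" using A tj_wfc by blast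
  let ?G1 = "TEl A # \<Gamma>" and ?r = "App (App (Const (Prim REFL)) (lift A)) (Var 0)"
  have wf1: "wfc ?G1" by (rule wfc_El[OF A])
  have A1: "isset ?G1 (lift A)" and G1: "fam ?G1 (lift A) (lift G)" by (intro isset_lift fam_lift A G wf1)+
  have x: "tj ?G1 (Var 0) (TEl (lift A))" by (rule el_Var0[OF A])
  have Gx: "isset ?G1 (App (lift G) (Var 0))" by (rule fam_app[OF G1 x])
  have r: "tj ?G1 ?r (TEl (ID' (lift A) (Var 0) (Var 0)))"
    by ((rule tj_app)+, rule tj_prim[OF wf1]) (use A1 x in \<open>auto simp: hoas_ty_defs\<close>)
  have "tr (TEl (App (lift G) (Var 0)) # ?G1) (lift (App (lift G) (Var 0)))"
    using el_Var0[OF Gx] by (auto simp: tr_def)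
  then have "tr (TEl (App (lift G) (Var 0)) # ?G1) (App (lift (Lam (lift (App (lift G) (Var 0))))) (Var 0))"
    by (rule tr_conv)
      (use eqj_sym[OF const_fam_eq[OF isset_lift[OF Gx wfc_El[OF Gx]] isset_lift[OF Gx wfc_El[OF Gx]] el_Var0[OF Gx]]]
        in simp)
  then have "tr ?G1 (PI' (App (lift G) (Var 0)) (Lam (lift (App (lift G) (Var 0)))))"
    by (rule tr_PI_I[OF Gx const_fam[OF Gx Gx]])
  then have "tr ?G1 (App (App (App (transport (lift G)) (Var 0)) (Var 0)) ?r)"
    by (rule tr_conv) (rule eqj_sym[OF transport(2)[OF A1 G1 x x r]])
  then obtain d where "tj ?G1 d (TEl (App (App (App (transport (lift G)) (Var 0)) (Var 0)) ?r))"
    by (auto simp: tr_def)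
  then have d: "tj \<Gamma> (Lam d) (TFun (TEl A) (TEl (App (App (App (transport (lift G)) (Var 0)) (Var 0)) ?r)))"
    by (rule tj_abs[OF wf])
  have "tj \<Gamma> (App (App (App (App (App (App (Const (Prim IDPEEL)) A) (transport G)) (Lam d)) a) b) e)
      (TEl (App (App (App (transport G) a) b) e))"
    by ((rule tj_app)+, rule tj_prim[OF wf])
      (use A a b e d transport(1)[OF A G] in \<open>auto simp: hoas_ty_defs\<close>)
  then have "tr \<Gamma> (PI' (App G b) (Lam (lift (App G a))))"
    unfolding tr_def using tj_conv[OF _ transport(2)[OF A G a b e]] by blast
  note Gb = fam_app[OF G b] and Ga = fam_app[OF G a]
  obtain t where t: "tj \<Gamma> t (TEl (App G b))" using assms(6) by (auto simp: tr_def)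
  have "tr \<Gamma> (App (Lam (lift (App G a))) t)"
    by (rule tr_PI_E[OF Gb const_fam[OF Gb Ga]]) fact+
  then show ?thesis by (rule tr_conv) (rule const_fam_eq[OF Gb Ga t])
qed

text \<open>The principle for CTT requires a function F choosing an index for each proposition.
  Disjoint unions have projections, so a witness k exists as a term in the context extended by a
  proposition variable; abstracting over that variable gives F, an instance of type-theoretic
  choice.\<close>

lemma tr_GUP:
  assumes GUP: "GUP_CTT \<subseteq> R" and I: "isset \<Gamma> I" and Q: "isset (TEl (lift I) # TSet # \<Gamma>) Q"
    and *: "tr (TSet # \<Gamma>) (SIG' (lift I) (Lam Q))"
  obtains i where "tj \<Gamma> i (TEl I)" "tr (TSet # \<Gamma>) (subst_tm (sub1 (lift i)) Q)"
proof -
  have wf: "wfc \<Gamma>" using I tj_wfc by blast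
  have wf1: "wfc (TSet # \<Gamma>)" by (rule wfc_SET[OF wf])
  have wf2: "wfc (TSet # TSet # \<Gamma>)" by (rule wfc_SET[OF wf1])
  have I1: "isset (TSet # \<Gamma>) (lift I)" by (rule isset_lift[OF I wf1])
  have F: "fam (TSet # \<Gamma>) (lift I) (Lam Q)" by (rule fam_Lam[OF I1 Q])
  obtain k where k: "tj (TSet # \<Gamma>) k (TEl (lift I))" "tr (TSet # \<Gamma>) (App (Lam Q) k)"
    using tr_SIG_E[OF I1 F *] .
  obtain t where t: "tj (TSet # \<Gamma>) t (TEl (App (Lam Q) k))" using k(2) by (auto simp: tr_def)
  let ?R = "Lam (Lam Q)" and ?F = "Lam k"
  have R: "tj \<Gamma> ?R (TFun TSet (TFun (TEl (lift I)) TSet))" by (rule tj_abs[OF wf F])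
  have Fk: "tj \<Gamma> ?F (TFun TSet (TEl (lift I)))" by (rule tj_abs[OF wf k(1)])
  \<comment> \<open>In the types of the constants, R and F occur applied to the proposition
    variable. These two equations reduce R P (F P) to \<open>Q\<close> at \<open>k\<close>, so the
    given proof \<open>t\<close> can be converted to the required type.\<close>
  have Req: "eqj (TSet # \<Gamma>) (App (lift ?R) (Var 0)) (Lam Q) (TFun (TEl (lift I)) TSet)"
    by (rule eqj_beta_lift[OF F]) (simp add: wf2)
  have Feq: "eqj (TSet # \<Gamma>) (App (lift ?F) (Var 0)) k (TEl (lift I))"
    by (rule eqj_beta_lift[OF k(1)]) (simp add: wf2)
  have "eqj (TSet # \<Gamma>) (App (App (lift ?R) (Var 0)) (App (lift ?F) (Var 0))) (App (Lam Q) k) TSet"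
    by (rule eqj_app[OF Req Feq]) simp
  from tj_conv[OF t eqj_sym[OF this]]
  have h: "tj \<Gamma> (Lam t) (TFun TSet (TEl (App (App (lift ?R) (Var 0)) (App (lift ?F) (Var 0)))))"
    by (rule tj_abs[OF wf])
  define Rt Ft where "Rt = ?R" and "Ft = ?F"
  note facts = R[folded Rt_def] Fk[folded Ft_def] h[folded Rt_def Ft_def]
  have "der R ([], HasType (Const GUP_point) (fst GUP_CTT_types 0))"
    by (rule der.ext[of "[]"]) (use GUP in \<open>auto simp: GUP_CTT_def\<close>)
  then have point: "tj \<Gamma> (Const GUP_point) (fst GUP_CTT_types 0)"
    using tj_subst[OF _ mor_Nil[OF wf], of "Const GUP_point" "fst GUP_CTT_types 0" Var] wfc_Nil
    by (simp add: tj_def)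
  have "der R ([], HasType (Const GUP_proof) (snd GUP_CTT_types 0))"
    by (rule der.ext[of "[]"]) (use GUP in \<open>auto simp: GUP_CTT_def\<close>)
  then have pf: "tj \<Gamma> (Const GUP_proof) (snd GUP_CTT_types 0)"
    using tj_subst[OF _ mor_Nil[OF wf], of "Const GUP_proof" "snd GUP_CTT_types 0" Var] wfc_Nil
    by (simp add: tj_def)
  have point': "tj \<Gamma> (Const GUP_point) (TFun TSet (TFun (TFun TSet (TFun (TEl (Var 1)) TSet))
    (TFun (TFun TSet (TEl (Var 2))) (TFun (TFun TSet (TEl (App (App (Var 2) (Var 0)) (App (Var 1) (Var 0)))))
      (TEl (Var 3))))))"
    using point by (simp add: GUP_CTT_types_def hoas_ty_defs eval_nat_numeral)
  have pf': "tj \<Gamma> (Const GUP_proof) (TFun TSet (TFun (TFun TSet (TFun (TEl (Var 1)) TSet))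
    (TFun (TFun TSet (TEl (Var 2))) (TFun (TFun TSet (TEl (App (App (Var 2) (Var 0)) (App (Var 1) (Var 0)))))
      (TFun TSet (TEl (App (App (Var 3) (Var 0))
        (App (App (App (App (Const GUP_point) (Var 4)) (Var 3)) (Var 2)) (Var 1)))))))))"
    using pf by (simp add: GUP_CTT_types_def hoas_ty_defs eval_nat_numeral)
  define p where "p = App (App (App (App (Const GUP_point) I) Rt) Ft) (Lam t)"
  have p: "tj \<Gamma> p (TEl I)"
    unfolding p_def
    by ((rule tj_app)+, rule point')
      (use I facts in \<open>auto simp: hoas_ty_defs\<close>)
  have q: "tj \<Gamma> (App (App (App (App (Const GUP_proof) I) Rt) Ft) (Lam t))
      (TFun TSet (TEl (App (App (lift Rt) (Var 0)) (lift p))))"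
    unfolding p_def
    by ((rule tj_app)+, rule pf')
      (use I facts in \<open>auto simp: hoas_ty_defs\<close>)
  have V: "tj (TSet # \<Gamma>) (Var 0) TSet" using tj_Var0[OF wf1] by simp
  define q where "q = App (App (App (App (Const GUP_proof) I) Rt) Ft) (Lam t)"
  have "tj (TSet # \<Gamma>) (lift q) (TFun TSet (TEl (App (App (lift (lift Rt)) (Var 0)) (lift (lift p)))))"
    using tj_lift[OF q[folded q_def] wf1] by simp
  then have "tj (TSet # \<Gamma>) (App (lift q) (Var 0)) (TEl (App (App (lift Rt) (Var 0)) (lift p)))"
    by (rule tj_app[OF _ V]) simp
  moreover have "eqj (TSet # \<Gamma>) (App (App (lift Rt) (Var 0)) (lift p)) (App (Lam Q) (lift p)) TSet"
    unfolding Rt_def by (rule eqj_app[OF Req eqj_refl[OF el_lift[OF p wf1]]]) simp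
  moreover have "eqj (TSet # \<Gamma>) (App (Lam Q) (lift p)) (subst_tm (sub1 (lift p)) Q) TSet"
    by (rule eqj_beta_set[OF Q el_lift[OF p wf1]])
  ultimately have "tr (TSet # \<Gamma>) (subst_tm (sub1 (lift p)) Q)"
    unfolding tr_def using tj_conv by blast
  with p show ?thesis by (rule that)
qed

end

section \<open>Natural deduction for truth\<close>

definition Imp :: "tm \<Rightarrow> tm \<Rightarrow> tm" where "Imp P Q = PI' P (Lam (lift Q))"
definition And :: "tm \<Rightarrow> tm \<Rightarrow> tm" where "And P Q = SIG' P (Lam (lift Q))"

lemma subst_Imp [simp]: "subst_tm s (Imp P Q) = Imp (subst_tm s P) (subst_tm s Q)"
  and subst_And [simp]: "subst_tm s (And P Q) = And (subst_tm s P) (subst_tm s Q)"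
  by (simp_all add: Imp_def And_def)

lemma lift_Imp [simp]: "lift (Imp P Q) = Imp (lift P) (lift Q)"
  and lift_And [simp]: "lift (And P Q) = And (lift P) (lift Q)"
  by (simp_all add: Imp_def And_def)

context ctt_rules
begin

lemma isset_Imp: "isset \<Gamma> P \<Longrightarrow> isset \<Gamma> Q \<Longrightarrow> isset \<Gamma> (Imp P Q)"
  and isset_And: "isset \<Gamma> P \<Longrightarrow> isset \<Gamma> Q \<Longrightarrow> isset \<Gamma> (And P Q)"
  by (simp_all add: Imp_def And_def isset_PI isset_SIG const_fam)

text \<open>The premises of the introduction rules range over all substitutions into the context, as in
  Kripke semantics, which keeps weakening and de Bruijn indices out of the later arguments.\<close>

lemma tr_All_I:
  assumes A: "isset \<Gamma> A" and B: "isset (TEl A # \<Gamma>) B"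
    and *: "\<And>\<Delta> s a. mor \<Delta> s \<Gamma> \<Longrightarrow> tj \<Delta> a (TEl (subst_tm s A)) \<Longrightarrow> tr \<Delta> (subst_tm (case_nat a s) B)"
  shows "tr \<Gamma> (PI' A (Lam B))"
proof (rule tr_PI_I[OF A fam_Lam[OF A B]])
  have wf: "wfc (TEl A # \<Gamma>)" by (rule wfc_El[OF A])
  \<comment> \<open>The generic instance of the premise: weakening together with the new variable,
    which as a substitution is the identity.\<close>
  have "case_nat (Var 0) (\<lambda>i. Var (Suc i)) = Var" by (simp add: fun_eq_iff split: nat.split)
  then have "tr (TEl A # \<Gamma>) B"
    using *[OF mor_lift[OF wf], of "Var 0"] el_Var0[OF A] by simp
  then show "tr (TEl A # \<Gamma>) (App (lift (Lam B)) (Var 0))"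
    by (rule tr_conv[OF _ eqj_sym[OF eqj_beta_lift[OF B]]]) (simp add: wfc_El[OF isset_lift[OF A wf]])
qed

lemma tr_All_E:
  assumes "isset \<Gamma> A" "isset (TEl A # \<Gamma>) B" "tr \<Gamma> (PI' A (Lam B))" "tj \<Gamma> a (TEl A)"
  shows "tr \<Gamma> (subst_tm (sub1 a) B)"
  using tr_conv[OF tr_PI_E[OF assms(1) fam_Lam[OF assms(1,2)] assms(3,4)] eqj_beta_set[OF assms(2,4)]] .

lemma tr_Ex_I:
  assumes "isset \<Gamma> A" "isset (TEl A # \<Gamma>) B" "tj \<Gamma> a (TEl A)" "tr \<Gamma> (subst_tm (sub1 a) B)"
  shows "tr \<Gamma> (SIG' A (Lam B))"
  by (rule tr_SIG_I[OF assms(1) fam_Lam[OF assms(1,2)] assms(3)])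
    (rule tr_conv[OF assms(4) eqj_sym[OF eqj_beta_set[OF assms(2,3)]]])

lemma tr_Ex_E:
  assumes "isset \<Gamma> A" "isset (TEl A # \<Gamma>) B" "tr \<Gamma> (SIG' A (Lam B))"
  obtains a where "tj \<Gamma> a (TEl A)" "tr \<Gamma> (subst_tm (sub1 a) B)"
  using tr_SIG_E[OF assms(1) fam_Lam[OF assms(1,2)] assms(3)] tr_conv eqj_beta_set[OF assms(2)] by metis

lemma tr_Imp_I:
  assumes P: "isset \<Gamma> P" and Q: "isset \<Gamma> Q"
    and *: "\<And>\<Delta> s. mor \<Delta> s \<Gamma> \<Longrightarrow> tr \<Delta> (subst_tm s P) \<Longrightarrow> tr \<Delta> (subst_tm s Q)"
  shows "tr \<Gamma> (Imp P Q)"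
  unfolding Imp_def by (rule tr_All_I[OF P isset_lift[OF Q wfc_El[OF P]]]) (auto simp: tr_def intro: *[unfolded tr_def])

lemma tr_Imp_E:
  assumes "isset \<Gamma> P" "isset \<Gamma> Q" "tr \<Gamma> (Imp P Q)" "tr \<Gamma> P"
  shows "tr \<Gamma> Q"
proof -
  obtain t where "tj \<Gamma> t (TEl P)" using assms(4) by (auto simp: tr_def)
  from tr_All_E[OF assms(1) isset_lift[OF assms(2) wfc_El[OF assms(1)]] assms(3)[unfolded Imp_def] this]
  show ?thesis by simp
qed

lemma tr_And_I:
  assumes "isset \<Gamma> P" "isset \<Gamma> Q" "tr \<Gamma> P" "tr \<Gamma> Q"
  shows "tr \<Gamma> (And P Q)"
proof -
  obtain t where "tj \<Gamma> t (TEl P)" using assms(3) by (auto simp: tr_def)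
  from tr_Ex_I[OF assms(1) isset_lift[OF assms(2) wfc_El[OF assms(1)]] this] assms(4)
  show ?thesis by (simp add: And_def)
qed

lemma tr_And_E:
  assumes "isset \<Gamma> P" "isset \<Gamma> Q" "tr \<Gamma> (And P Q)"
  shows "tr \<Gamma> P" "tr \<Gamma> Q"
proof -
  obtain t where "tj \<Gamma> t (TEl P)" "tr \<Gamma> (subst_tm (sub1 t) (lift Q))"
    by (rule tr_Ex_E[OF assms(1) isset_lift[OF assms(2) wfc_El[OF assms(1)]] assms(3)[unfolded And_def]])
  then show "tr \<Gamma> P" "tr \<Gamma> Q" by (auto simp: tr_def)
qed

end


section \<open>Formal spaces in CTT\<close>

text \<open>For closed S and C, this and the following are the terms to which the notions in
  higher-order abstract syntax unfold. As functions on terms they can be shown to commute with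
  substitution.\<close>

definition tm_cover :: "tm \<Rightarrow> tm \<Rightarrow> tm \<Rightarrow> tm" where
  "tm_cover C a U = App (App C a) U"

definition tm_covers :: "tm \<Rightarrow> tm \<Rightarrow> tm \<Rightarrow> tm \<Rightarrow> tm" where
  "tm_covers S C U V = PI' S (Lam (Imp (App (lift U) (Var 0)) (tm_cover C (Var 0) (lift V))))"

definition tm_single :: "tm \<Rightarrow> tm \<Rightarrow> tm" where
  "tm_single S a = Lam (ID' S (Var 0) (lift a))"

definition tm_below :: "tm \<Rightarrow> tm \<Rightarrow> tm \<Rightarrow> tm \<Rightarrow> tm" where
  "tm_below S C U d = SIG' S (Lam (And (App (lift U) (Var 0)) (tm_cover C (lift d) (tm_single S (Var 0)))))"

definition tm_down :: "tm \<Rightarrow> tm \<Rightarrow> tm \<Rightarrow> tm \<Rightarrow> tm" where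
  "tm_down S C U V = Lam (And (tm_below S C (lift U) (Var 0)) (tm_below S C (lift V) (Var 0)))"

definition tm_empty :: tm where
  "tm_empty = Lam FALSE"

definition tm_compl :: "tm \<Rightarrow> tm \<Rightarrow> tm \<Rightarrow> tm" where
  "tm_compl S C U = Lam (tm_covers S C (tm_down S C (tm_single S (Var 0)) (lift U)) tm_empty)"

section \<open>Typing and truth rules for covers and pseudocomplements in CTT\<close>

locale ctt_cover = ctt_rules +
  fixes S C :: tm
  assumes closed: "closed_tm S" "closed_tm C"
    and S0: "tj [] S TSet"
    and C0: "tj [] C (TFun (TEl S) (TFun (TFun (TEl S) TSet) TSet))"
begin

lemma closed_simps [simp]:
  "subst_tm s S = S" "subst_tm s C = C" "ren_tm f S = S" "ren_tm f C = C"
  by (simp_all add: closed subst_tm_closed ren_tm_closed)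

abbreviation "el \<Gamma> a \<equiv> tj \<Gamma> a (TEl S)"
abbreviation "sub \<Gamma> U \<equiv> fam \<Gamma> S U"
abbreviation "cover \<equiv> tm_cover C"
abbreviation "cover_all \<equiv> tm_covers S C"
abbreviation "single \<equiv> tm_single S"
abbreviation "below \<equiv> tm_below S C"
abbreviation "down \<equiv> tm_down S C"
abbreviation "compl \<equiv> tm_compl S C"

lemma subst_cover [simp]: "subst_tm s (cover a U) = cover (subst_tm s a) (subst_tm s U)"
  by (simp add: tm_cover_def)

lemma lift_cover [simp]: "lift (cover a U) = cover (lift a) (lift U)"
  using subst_cover[of "\<lambda>i. Var (Suc i)"] by simp

lemma subst_cover_all [simp]: "subst_tm s (cover_all U V) = cover_all (subst_tm s U) (subst_tm s V)"
  by (simp add: tm_covers_def)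

lemma lift_cover_all [simp]: "lift (cover_all U V) = cover_all (lift U) (lift V)"
  using subst_cover_all[of "\<lambda>i. Var (Suc i)"] by simp

lemma subst_single [simp]: "subst_tm s (single a) = single (subst_tm s a)"
  by (simp add: tm_single_def)

lemma lift_single [simp]: "lift (single a) = single (lift a)"
  using subst_single[of "\<lambda>i. Var (Suc i)"] by simp

lemma subst_below [simp]: "subst_tm s (below U a) = below (subst_tm s U) (subst_tm s a)"
  by (simp add: tm_below_def)

lemma subst_down [simp]: "subst_tm s (down U V) = down (subst_tm s U) (subst_tm s V)"
  by (simp add: tm_down_def)

lemma subst_empty [simp]: "subst_tm s (tm_empty) = tm_empty"
  by (simp add: tm_empty_def)

lemma lift_empty [simp]: "lift (tm_empty) = tm_empty"
  using subst_empty[of "\<lambda>i. Var (Suc i)"] by simp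

lemma subst_compl [simp]: "subst_tm s (compl U) = compl (subst_tm s U)"
  by (simp add: tm_compl_def)

lemma lift_compl [simp]: "lift (compl U) = compl (lift U)"
  using subst_compl[of "\<lambda>i. Var (Suc i)"] by simp

lemma isset_S: "wfc \<Gamma> \<Longrightarrow> isset \<Gamma> S"
  using tj_subst[OF S0 mor_Nil, of \<Gamma> Var] by simp

lemma wfc_S: "wfc \<Gamma> \<Longrightarrow> wfc (TEl S # \<Gamma>)"
  by (rule wfc_El[OF isset_S])

lemma isset_cover: "el \<Gamma> a \<Longrightarrow> sub \<Gamma> U \<Longrightarrow> isset \<Gamma> (cover a U)"
  unfolding tm_cover_def
  by ((rule tj_app)+, rule tj_subst[OF C0 mor_Nil, of _ Var, simplified]) (auto intro: tj_wfc)

lemma sub_lift: "sub \<Gamma> U \<Longrightarrow> wfc (A # \<Gamma>) \<Longrightarrow> sub (A # \<Gamma>) (lift U)"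
  using fam_lift[where B = S] by simp

lemma el_lift': "el \<Gamma> a \<Longrightarrow> wfc (A # \<Gamma>) \<Longrightarrow> el (A # \<Gamma>) (lift a)"
  using el_lift[where B = S] by simp

lemma el_Var0': "wfc \<Gamma> \<Longrightarrow> el (TEl S # \<Gamma>) (Var 0)"
  using el_Var0[OF isset_S] by simp

lemma el_subst: "el \<Gamma> a \<Longrightarrow> mor \<Delta> s \<Gamma> \<Longrightarrow> el \<Delta> (subst_tm s a)"
  using tj_subst[of \<Gamma> a "TEl S" \<Delta> s] by simp

lemma sub_subst: "sub \<Gamma> U \<Longrightarrow> mor \<Delta> s \<Gamma> \<Longrightarrow> sub \<Delta> (subst_tm s U)"
  using tj_subst[of \<Gamma> U "TFun (TEl S) TSet" \<Delta> s] by simp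

lemma isset_covers_body:
  assumes "sub \<Gamma> U" "sub \<Gamma> V"
  shows "isset (TEl S # \<Gamma>) (Imp (App (lift U) (Var 0)) (cover (Var 0) (lift V)))"
proof -
  have wf: "wfc \<Gamma>" using assms tj_wfc by blast
  show ?thesis
    by (intro isset_Imp fam_app[OF sub_lift[OF assms(1) wfc_S[OF wf]]] isset_cover el_Var0' sub_lift assms wfc_S wf)
qed

lemma isset_covers: "sub \<Gamma> U \<Longrightarrow> sub \<Gamma> V \<Longrightarrow> isset \<Gamma> (cover_all U V)"
  unfolding tm_covers_def by (intro isset_PI fam_Lam isset_S isset_covers_body) (auto intro: tj_wfc)

lemma isset_single_body: "el \<Gamma> a \<Longrightarrow> isset (TEl S # \<Gamma>) (ID' S (Var 0) (lift a))"
  by (intro isset_ID isset_S el_Var0' el_lift' wfc_S) (auto intro: tj_wfc)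

lemma sub_single: "el \<Gamma> a \<Longrightarrow> sub \<Gamma> (single a)"
  unfolding tm_single_def by (intro fam_Lam isset_S isset_single_body) (auto intro: tj_wfc)

lemma isset_below_body:
  assumes "sub \<Gamma> U" "el \<Gamma> d"
  shows "isset (TEl S # \<Gamma>) (And (App (lift U) (Var 0)) (cover (lift d) (single (Var 0))))"
proof -
  have wf: "wfc \<Gamma>" using assms tj_wfc by blast
  show ?thesis
    by (intro isset_And fam_app[OF sub_lift[OF assms(1) wfc_S[OF wf]]] isset_cover el_Var0' el_lift' sub_single assms wfc_S wf)
qed

lemma isset_below: "sub \<Gamma> U \<Longrightarrow> el \<Gamma> d \<Longrightarrow> isset \<Gamma> (below U d)"
  unfolding tm_below_def by (intro isset_SIG fam_Lam isset_S isset_below_body) (auto intro: tj_wfc)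

lemma isset_down_body:
  assumes "sub \<Gamma> U" "sub \<Gamma> V"
  shows "isset (TEl S # \<Gamma>) (And (below (lift U) (Var 0)) (below (lift V) (Var 0)))"
proof -
  have wf: "wfc \<Gamma>" using assms tj_wfc by blast
  show ?thesis by (intro isset_And isset_below el_Var0' sub_lift assms wfc_S wf)
qed

lemma sub_down: "sub \<Gamma> U \<Longrightarrow> sub \<Gamma> V \<Longrightarrow> sub \<Gamma> (down U V)"
  unfolding tm_down_def by (intro fam_Lam isset_S isset_down_body) (auto intro: tj_wfc)

lemma sub_empty: "wfc \<Gamma> \<Longrightarrow> sub \<Gamma> tm_empty"
  unfolding tm_empty_def by (intro fam_Lam isset_S isset_Fin wfc_S)

lemma isset_compl_body:
  assumes "sub \<Gamma> U"
  shows "isset (TEl S # \<Gamma>) (cover_all (down (single (Var 0)) (lift U)) tm_empty)"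
proof -
  have wf: "wfc \<Gamma>" using assms tj_wfc by blast
  show ?thesis by (intro isset_covers sub_down sub_empty sub_single el_Var0' sub_lift assms wfc_S wf)
qed

lemma sub_compl: "sub \<Gamma> U \<Longrightarrow> sub \<Gamma> (compl U)"
  unfolding tm_compl_def by (intro fam_Lam isset_S isset_compl_body) (auto intro: tj_wfc)

lemma tr_covers_I:
  assumes U: "sub \<Gamma> U" and V: "sub \<Gamma> V"
    and *: "\<And>\<Delta> s u. mor \<Delta> s \<Gamma> \<Longrightarrow> el \<Delta> u \<Longrightarrow> tr \<Delta> (App (subst_tm s U) u) \<Longrightarrow> tr \<Delta> (cover u (subst_tm s V))"
  shows "tr \<Gamma> (cover_all U V)"
  unfolding tm_covers_def
proof (rule tr_All_I[OF isset_S isset_covers_body[OF U V]])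
  show "wfc \<Gamma>" using U tj_wfc by blast
  fix \<Delta> s a assume s: "mor \<Delta> s \<Gamma>" and a: "tj \<Delta> a (TEl (subst_tm s S))"
  then have a: "el \<Delta> a" by simp
  have "tr \<Delta> (Imp (App (subst_tm s U) a) (cover a (subst_tm s V)))"
  proof (rule tr_Imp_I)
    show "isset \<Delta> (App (subst_tm s U) a)" by (rule fam_app[OF sub_subst[OF U s] a])
    show "isset \<Delta> (cover a (subst_tm s V))" by (rule isset_cover[OF a sub_subst[OF V s]])
    fix \<Theta> t assume t: "mor \<Theta> t \<Delta>" and "tr \<Theta> (subst_tm t (App (subst_tm s U) a))"
    then show "tr \<Theta> (subst_tm t (cover a (subst_tm s V)))"
      using *[OF mor_comp[OF t s] el_subst[OF a t]] by (simp add: subst_tm_subst)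
  qed
  then show "tr \<Delta> (subst_tm (case_nat a s) (Imp (App (lift U) (Var 0)) (cover (Var 0) (lift V))))"
    by simp
qed

lemma tr_covers_E:
  assumes U: "sub \<Gamma> U" and V: "sub \<Gamma> V" and "tr \<Gamma> (cover_all U V)" and u: "el \<Gamma> u" "tr \<Gamma> (App U u)"
  shows "tr \<Gamma> (cover u V)"
proof -
  have wf: "wfc \<Gamma>" using U tj_wfc by blast
  have "tr \<Gamma> (Imp (App U u) (cover u V))"
    using tr_All_E[OF isset_S[OF wf] isset_covers_body[OF U V] assms(3)[unfolded tm_covers_def] u(1)] by simp
  then show ?thesis
    by (rule tr_Imp_E[OF fam_app[OF U u(1)] isset_cover[OF u(1) V] _ u(2)])
qed

lemma eqj_single: "el \<Gamma> a \<Longrightarrow> el \<Gamma> b \<Longrightarrow> eqj \<Gamma> (App (single a) b) (ID' S b a) TSet"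
  using eqj_beta_set[OF isset_single_body, of \<Gamma> a b] by (simp add: tm_single_def)

lemma tr_single_self: "el \<Gamma> a \<Longrightarrow> tr \<Gamma> (App (single a) a)"
  by (rule tr_conv[OF tr_REFL eqj_sym[OF eqj_single]]) (auto intro: isset_S tj_wfc)

lemma tr_below_I:
  assumes "sub \<Gamma> U" "el \<Gamma> d" "el \<Gamma> u" "tr \<Gamma> (App U u)" "tr \<Gamma> (cover d (single u))"
  shows "tr \<Gamma> (below U d)"
  unfolding tm_below_def
proof (rule tr_Ex_I[OF isset_S isset_below_body[OF assms(1,2)] assms(3)])
  show "wfc \<Gamma>" using assms tj_wfc by blast
  show "tr \<Gamma> (subst_tm (sub1 u) (And (App (lift U) (Var 0)) (cover (lift d) (single (Var 0)))))"
    using tr_And_I[OF fam_app[OF assms(1,3)] isset_cover[OF assms(2) sub_single[OF assms(3)]] assms(4,5)] by simp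
qed

lemma tr_below_E:
  assumes "sub \<Gamma> U" "el \<Gamma> d" "tr \<Gamma> (below U d)"
  obtains u where "el \<Gamma> u" "tr \<Gamma> (App U u)" "tr \<Gamma> (cover d (single u))"
proof (rule tr_Ex_E[OF isset_S isset_below_body[OF assms(1,2)] assms(3)[unfolded tm_below_def]])
  show "wfc \<Gamma>" using assms tj_wfc by blast
  fix u assume u: "el \<Gamma> u" and "tr \<Gamma> (subst_tm (sub1 u) (And (App (lift U) (Var 0)) (cover (lift d) (single (Var 0)))))"
  then have "tr \<Gamma> (And (App U u) (cover d (single u)))" by simp
  from that[OF u tr_And_E[OF fam_app[OF assms(1) u] isset_cover[OF assms(2) sub_single[OF u]] this]]
  show thesis .
qed

lemma eqj_down: "sub \<Gamma> U \<Longrightarrow> sub \<Gamma> V \<Longrightarrow> el \<Gamma> d \<Longrightarrow>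
    eqj \<Gamma> (App (down U V) d) (And (below U d) (below V d)) TSet"
  using eqj_beta_set[OF isset_down_body, of \<Gamma> U V d] by (simp add: tm_down_def)

lemma tr_down_I:
  assumes "sub \<Gamma> U" "sub \<Gamma> V" "el \<Gamma> d" "tr \<Gamma> (below U d)" "tr \<Gamma> (below V d)"
  shows "tr \<Gamma> (App (down U V) d)"
  by (rule tr_conv[OF tr_And_I eqj_sym[OF eqj_down]]) (intro assms isset_below)+

lemma tr_down_E:
  assumes "sub \<Gamma> U" "sub \<Gamma> V" "el \<Gamma> d" "tr \<Gamma> (App (down U V) d)"
  shows "tr \<Gamma> (below U d)" "tr \<Gamma> (below V d)"
  by (rule tr_And_E[OF _ _ tr_conv[OF assms(4) eqj_down[OF assms(1-3)]]]; intro assms isset_below)+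

lemma eqj_compl: "sub \<Gamma> U \<Longrightarrow> el \<Gamma> a \<Longrightarrow>
    eqj \<Gamma> (App (compl U) a) (cover_all (down (single a) U) tm_empty) TSet"
  using eqj_beta_set[OF isset_compl_body, of \<Gamma> U a] by (simp add: tm_compl_def)

lemma tr_compl_I:
  assumes U: "sub \<Gamma> U" and a: "el \<Gamma> a"
    and *: "\<And>\<Delta> s d. mor \<Delta> s \<Gamma> \<Longrightarrow> el \<Delta> d \<Longrightarrow> tr \<Delta> (below (single (subst_tm s a)) d) \<Longrightarrow>
      tr \<Delta> (below (subst_tm s U) d) \<Longrightarrow> tr \<Delta> (cover d tm_empty)"
  shows "tr \<Gamma> (App (compl U) a)"
proof (rule tr_conv[OF tr_covers_I eqj_sym[OF eqj_compl[OF U a]]])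
  show "sub \<Gamma> (down (single a) U)" by (intro sub_down sub_single U a)
  show "sub \<Gamma> tm_empty" using U by (intro sub_empty) (rule tj_wfc)
  fix \<Delta> s u assume s: "mor \<Delta> s \<Gamma>" and u: "el \<Delta> u" and "tr \<Delta> (App (subst_tm s (down (single a) U)) u)"
  then have "tr \<Delta> (App (down (single (subst_tm s a)) (subst_tm s U)) u)" by simp
  from tr_down_E[OF sub_single[OF el_subst[OF a s]] sub_subst[OF U s] u this] *[OF s u]
  show "tr \<Delta> (cover u (subst_tm s tm_empty))" by simp
qed

lemma tr_compl_E:
  assumes U: "sub \<Gamma> U" and a: "el \<Gamma> a" and "tr \<Gamma> (App (compl U) a)"
    and d: "el \<Gamma> d" "tr \<Gamma> (below (single a) d)" "tr \<Gamma> (below U d)"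
  shows "tr \<Gamma> (cover d tm_empty)"
proof (rule tr_covers_E)
  show "tr \<Gamma> (cover_all (down (single a) U) tm_empty)" by (rule tr_conv[OF assms(3) eqj_compl[OF U a]])
  show "sub \<Gamma> (down (single a) U)" by (intro sub_down sub_single U a)
  show "sub \<Gamma> tm_empty" using U by (intro sub_empty) (rule tj_wfc)
  show "tr \<Gamma> (App (down (single a) U) d)" by (intro tr_down_I sub_single U a d)
qed (rule d)

end

definition tm_subset :: "tm \<Rightarrow> tm \<Rightarrow> tm \<Rightarrow> tm" where
  "tm_subset S U V = PI' S (Lam (Imp (App (lift U) (Var 0)) (App (lift V) (Var 0))))"

definition tm_dneg :: "tm \<Rightarrow> tm \<Rightarrow> tm \<Rightarrow> tm \<Rightarrow> tm" where
  "tm_dneg S C a U = tm_covers S C (tm_compl S C (tm_compl S C (tm_single S a))) (tm_compl S C (tm_compl S C U))"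

text \<open>The disjunction of \<open>P\<close> and \<open>P\<close> implies \<open>Q\<close>, with the disjunct selected by a code \<open>k\<close> in the first
  universe. As the codes form a fixed set, the uniformity principle applies to \<open>k\<close>.\<close>

abbreviation DEC :: "tm \<Rightarrow> tm" where "DEC k \<equiv> App (Const (Prim (Dec 0))) k"

definition tm_decision :: "tm \<Rightarrow> tm \<Rightarrow> tm \<Rightarrow> tm" where
  "tm_decision P Q k = And (Imp (DEC k) P)
    (Imp (Imp (DEC k) FALSE) (Imp P Q))"

abbreviation UNIV0 :: tm where "UNIV0 \<equiv> Const (Prim (Univ 0))"

definition tm_decided :: "tm \<Rightarrow> tm \<Rightarrow> tm" where
  "tm_decided P Q = SIG' UNIV0 (Lam (tm_decision (lift P) (lift Q) (Var 0)))"

lemma subst_decision [simp]: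
  "subst_tm s (tm_decision P Q k) = tm_decision (subst_tm s P) (subst_tm s Q) (subst_tm s k)"
  by (simp add: tm_decision_def)

lemma subst_decided [simp]: "subst_tm s (tm_decided P Q) = tm_decided (subst_tm s P) (subst_tm s Q)"
  by (simp add: tm_decided_def)

lemma lift_decided [simp]: "lift (tm_decided P Q) = tm_decided (lift P) (lift Q)"
  using subst_decided[of "\<lambda>i. Var (Suc i)"] by simp

section \<open>Decisions by codes of sets\<close>

context ctt_rules
begin

lemma isset_decision:
  assumes "isset \<Gamma> P" "isset \<Gamma> Q" "tj \<Gamma> k (TEl UNIV0)"
  shows "isset \<Gamma> (tm_decision P Q k)"
  unfolding tm_decision_def
  by (intro isset_And isset_Imp isset_Dec isset_Fin assms tj_wfc[OF assms(1)])

lemma isset_decided_body: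
  assumes "isset \<Gamma> P" "isset \<Gamma> Q"
  shows "isset (TEl UNIV0 # \<Gamma>) (tm_decision (lift P) (lift Q) (Var 0))"
proof -
  have U: "isset \<Gamma> UNIV0" by (rule isset_Univ[OF tj_wfc[OF assms(1)]])
  show ?thesis
    using el_Var0[OF U] by (intro isset_decision isset_lift assms wfc_El U) simp
qed

lemma isset_decided: "isset \<Gamma> P \<Longrightarrow> isset \<Gamma> Q \<Longrightarrow> isset \<Gamma> (tm_decided P Q)"
  unfolding tm_decided_def by (intro isset_SIG fam_Lam isset_Univ isset_decided_body) (auto intro: tj_wfc)

lemma tr_decidedI:
  assumes "isset \<Gamma> P" "isset \<Gamma> Q" "tj \<Gamma> k (TEl UNIV0)" "tr \<Gamma> (tm_decision P Q k)"
  shows "tr \<Gamma> (tm_decided P Q)"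
  unfolding tm_decided_def
  by (rule tr_Ex_I[OF isset_Univ isset_decided_body[OF assms(1,2)] assms(3)])
    (use assms tj_wfc in auto)

lemma tr_decided_true:
  assumes P: "isset \<Gamma> P" and Q: "isset \<Gamma> Q" and "tr \<Gamma> P"
  shows "tr \<Gamma> (tm_decided P Q)"
proof (rule tr_decidedI[OF P Q])
  have wf: "wfc \<Gamma>" by (rule tj_wfc[OF P])
  \<comment> \<open>The code of the one-element set selects P; the clause for a false
    \<open>DEC\<close> then follows by ex falso.\<close>
  let ?k = "Const (Prim (CFin 0 1))"
  show k: "tj \<Gamma> ?k (TEl UNIV0)" by (rule tj_CFin[OF wf])
  note sets = isset_Dec[OF k] isset_Fin[OF wf] P Q
  show "tr \<Gamma> (tm_decision P Q ?k)"
    unfolding tm_decision_def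
  proof (intro tr_And_I isset_Imp sets)
    show "tr \<Gamma> (Imp (DEC ?k) P)"
      by (rule tr_Imp_I[OF sets(1,3) tr_subst[OF assms(3)]])
    show "tr \<Gamma> (Imp (Imp (DEC ?k) FALSE) (Imp P Q))"
    proof (rule tr_Imp_I)
      fix \<Delta> s assume s: "mor \<Delta> s \<Gamma>" and "tr \<Delta> (subst_tm s (Imp (DEC ?k) FALSE))"
      then have imp: "tr \<Delta> (Imp (DEC ?k) FALSE)" by simp
      have wfD: "wfc \<Delta>" by (rule mor_wfc[OF s])
      have "tr \<Delta> (DEC ?k)"
        by (rule tr_conv[OF tr_TRUE[OF wfD] eqj_sym[OF eqj_Dec_CFin[OF wfD]]])
      then have "tr \<Delta> FALSE"
        by (rule tr_Imp_E[OF isset_Dec[OF tj_CFin[OF wfD]] isset_Fin[OF wfD] imp])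
      then show "tr \<Delta> (subst_tm s (Imp P Q))"
        by (rule tr_FALSE_E) (rule isset_subst[OF isset_Imp[OF P Q] s])
    qed (intro isset_Imp sets)+
  qed
qed

lemma tr_decided_imp:
  assumes P: "isset \<Gamma> P" and Q: "isset \<Gamma> Q" and "tr \<Gamma> (Imp P Q)"
  shows "tr \<Gamma> (tm_decided P Q)"
proof (rule tr_decidedI[OF P Q])
  have wf: "wfc \<Gamma>" by (rule tj_wfc[OF P])
  \<comment> \<open>The code of the empty set selects the implication; the clause for a true
    \<open>DEC\<close> follows by ex falso.\<close>
  let ?k = "Const (Prim (CFin 0 0))"
  show k: "tj \<Gamma> ?k (TEl UNIV0)" by (rule tj_CFin[OF wf])
  note sets = isset_Dec[OF k] isset_Fin[OF wf] P Q
  show "tr \<Gamma> (tm_decision P Q ?k)"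
    unfolding tm_decision_def
  proof (intro tr_And_I isset_Imp sets)
    show "tr \<Gamma> (Imp (DEC ?k) P)"
    proof (rule tr_Imp_I)
      fix \<Delta> s assume s: "mor \<Delta> s \<Gamma>" and "tr \<Delta> (subst_tm s (DEC ?k))"
      then have "tr \<Delta> FALSE" using tr_conv[OF _ eqj_Dec_CFin[OF mor_wfc[OF s]]] by simp
      then show "tr \<Delta> (subst_tm s P)" by (rule tr_FALSE_E) (rule isset_subst[OF P s])
    qed (intro sets)+
    show "tr \<Gamma> (Imp (Imp (DEC ?k) FALSE) (Imp P Q))"
      by (rule tr_Imp_I[OF _ _ tr_subst[OF assms(3)]]) (intro isset_Imp sets)+
  qed
qed

text \<open>Neither Q nor the uniform k depends on the proposition variable, so the same k may be
  examined at \<open>FALSE\<close>, which refutes \<open>DEC k\<close>, and at \<open>UNIT\<close>,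
  which then yields Q.\<close>

lemma tr_decided_uniform:
  assumes GUP: "GUP_CTT \<subseteq> R" and Q: "isset \<Gamma> Q" and *: "tr (TSet # \<Gamma>) (tm_decided (Var 0) (lift Q))"
  shows "tr \<Gamma> Q"
proof -
  have wf: "wfc \<Gamma>" by (rule tj_wfc[OF Q])
  have wf1: "wfc (TSet # \<Gamma>)" by (rule wfc_SET[OF wf])
  have V: "isset (TSet # \<Gamma>) (Var 0)" using tj_Var0[OF wf1] by simp
  have body: "isset (TEl (lift UNIV0) # TSet # \<Gamma>) (tm_decision (lift (Var 0)) (lift (lift Q)) (Var 0))"
    using isset_decided_body[OF V isset_lift[OF Q wf1]] by simp
  obtain k where k: "tj \<Gamma> k (TEl UNIV0)"
    and "tr (TSet # \<Gamma>) (subst_tm (sub1 (lift k)) (tm_decision (lift (Var 0)) (lift (lift Q)) (Var 0)))"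
    by (rule tr_GUP[OF GUP isset_Univ[OF wf, of 0] body]) (use * in \<open>auto simp: tm_decided_def\<close>)
  then have tr1: "tr (TSet # \<Gamma>) (tm_decision (Var 0) (lift Q) (lift k))" by simp
  have inst: "tr \<Gamma> (tm_decision P Q k)" if "isset \<Gamma> P" for P
    using tr_subst[OF tr1 mor_sub1[OF that]] by simp
  let ?D = "DEC k"
  have D: "isset \<Gamma> ?D" and F: "isset \<Gamma> FALSE" and T: "isset \<Gamma> UNIT"
    by (intro isset_Dec isset_Fin k wf)+
  have "tr \<Gamma> (Imp ?D FALSE)"
    by (rule tr_And_E(1)[OF isset_Imp[OF D F] isset_Imp[OF isset_Imp[OF D F] isset_Imp[OF F Q]]
          inst[OF F, unfolded tm_decision_def]])
  moreover have "tr \<Gamma> (Imp (Imp ?D FALSE) (Imp UNIT Q))"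
    by (rule tr_And_E(2)[OF isset_Imp[OF D T] isset_Imp[OF isset_Imp[OF D F] isset_Imp[OF T Q]]
          inst[OF T, unfolded tm_decision_def]])
  ultimately have "tr \<Gamma> (Imp UNIT Q)"
    using tr_Imp_E[OF isset_Imp[OF D F] isset_Imp[OF T Q]] by blast
  then show ?thesis by (rule tr_Imp_E[OF T Q _ tr_TRUE[OF wf]])
qed

end

section \<open>Null points and the double negation cover in CTT\<close>

locale ctt_space = ctt_cover +
  assumes refl0: "\<exists>t. der R ([], HasType t (TFun (TEl S) (TFun (TFun (TEl S) TSet)
      (TEl (Imp (App (Var 0) (Var 1)) (tm_cover C (Var 1) (Var 0)))))))"
    and trans0: "\<exists>t. der R ([], HasType t (TFun (TEl S) (TFun (TFun (TEl S) TSet) (TFun (TFun (TEl S) TSet)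
      (TEl (Imp (tm_cover C (Var 2) (Var 1)) (Imp (tm_covers S C (Var 1) (Var 0)) (tm_cover C (Var 2) (Var 0)))))))))"
begin

abbreviation "dneg \<equiv> tm_dneg S C"

lemma tr_cover_refl:
  assumes U: "sub \<Gamma> U" and a: "el \<Gamma> a" and *: "tr \<Gamma> (App U a)"
  shows "tr \<Gamma> (cover a U)"
proof -
  have wf: "wfc \<Gamma>" by (rule tj_wfc[OF a])
  obtain t where "der R ([], HasType t (TFun (TEl S) (TFun (TFun (TEl S) TSet)
      (TEl (Imp (App (Var 0) (Var 1)) (cover (Var 1) (Var 0)))))))"
    using refl0 by blast
  then have "tj \<Gamma> (subst_tm Var t) (TFun (TEl S) (TFun (TFun (TEl S) TSet)
      (TEl (Imp (App (Var 0) (Var 1)) (cover (Var 1) (Var 0))))))"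
    using tj_subst[OF _ mor_Nil[OF wf], of t _ Var] wfc_Nil by (fastforce simp: tj_def)
  then have "tj \<Gamma> (App (subst_tm Var t) a) (TFun (TFun (TEl S) TSet) (TEl (Imp (App (Var 0) (lift a)) (cover (lift a) (Var 0)))))"
    by (rule tj_app[OF _ a]) (simp add: eval_nat_numeral)
  then have "tj \<Gamma> (App (App (subst_tm Var t) a) U) (TEl (Imp (App U a) (cover a U)))"
    by (rule tj_app[OF _ U]) simp
  then have "tr \<Gamma> (Imp (App U a) (cover a U))" by (auto simp: tr_def)
  then show ?thesis by (rule tr_Imp_E[OF fam_app[OF U a] isset_cover[OF a U] _ *])
qed

lemma tr_cover_trans:
  assumes U: "sub \<Gamma> U" and V: "sub \<Gamma> V" and a: "el \<Gamma> a" and *: "tr \<Gamma> (cover a U)" "tr \<Gamma> (cover_all U V)"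
  shows "tr \<Gamma> (cover a V)"
proof -
  have wf: "wfc \<Gamma>" by (rule tj_wfc[OF a])
  obtain t where "der R ([], HasType t (TFun (TEl S) (TFun (TFun (TEl S) TSet) (TFun (TFun (TEl S) TSet)
      (TEl (Imp (cover (Var 2) (Var 1)) (Imp (cover_all (Var 1) (Var 0)) (cover (Var 2) (Var 0)))))))))"
    using trans0 by blast
  then have "tj \<Gamma> (subst_tm Var t) (TFun (TEl S) (TFun (TFun (TEl S) TSet) (TFun (TFun (TEl S) TSet)
      (TEl (Imp (cover (Var 2) (Var 1)) (Imp (cover_all (Var 1) (Var 0)) (cover (Var 2) (Var 0))))))))"
    using tj_subst[OF _ mor_Nil[OF wf], of t _ Var] wfc_Nil by (fastforce simp: tj_def)
  then have "tj \<Gamma> (App (subst_tm Var t) a) (TFun (TFun (TEl S) TSet) (TFun (TFun (TEl S) TSet)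
      (TEl (Imp (cover (lift (lift a)) (Var 1)) (Imp (cover_all (Var 1) (Var 0)) (cover (lift (lift a)) (Var 0)))))))"
    by (rule tj_app[OF _ a]) (simp add: eval_nat_numeral)
  then have "tj \<Gamma> (App (App (subst_tm Var t) a) U) (TFun (TFun (TEl S) TSet)
      (TEl (Imp (cover (lift a) (lift U)) (Imp (cover_all (lift U) (Var 0)) (cover (lift a) (Var 0))))))"
    by (rule tj_app[OF _ U]) simp
  then have "tj \<Gamma> (App (App (App (subst_tm Var t) a) U) V)
      (TEl (Imp (cover a U) (Imp (cover_all U V) (cover a V))))"
    by (rule tj_app[OF _ V]) simp
  then have "tr \<Gamma> (Imp (cover a U) (Imp (cover_all U V) (cover a V)))" by (auto simp: tr_def)
  note sets = isset_cover[OF a U] isset_cover[OF a V] isset_covers[OF U V]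
  show ?thesis
    by (rule tr_Imp_E[OF sets(3,2) tr_Imp_E[OF sets(1) isset_Imp[OF sets(3,2)]]]) fact+
qed

definition Null :: "ctx \<Rightarrow> tm \<Rightarrow> bool" where
  "Null \<Gamma> a \<longleftrightarrow> el \<Gamma> a \<and> tr \<Gamma> (cover a tm_empty)"

lemma isset_null: "el \<Gamma> a \<Longrightarrow> isset \<Gamma> (cover a tm_empty)"
  by (intro isset_cover sub_empty) (auto intro: tj_wfc)

lemma isset_null_body: "wfc \<Gamma> \<Longrightarrow> isset (TEl S # \<Gamma>) (cover (Var 0) tm_empty)"
  by (intro isset_null el_Var0')

lemma Null_subst: "Null \<Gamma> a \<Longrightarrow> mor \<Delta> s \<Gamma> \<Longrightarrow> Null \<Delta> (subst_tm s a)"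
  using el_subst tr_subst[of \<Gamma> "cover a tm_empty"] by (auto simp: Null_def)

text \<open>Membership in a singleton is an identity set, not a judgemental equality, so nullity is
  carried from v to u by \<open>tr_transport\<close> along the family of nullity statements.\<close>

lemma Null_single:
  assumes "el \<Gamma> u" "Null \<Gamma> v" "tr \<Gamma> (App (single v) u)"
  shows "Null \<Gamma> u"
proof -
  have v: "el \<Gamma> v" "tr \<Gamma> (cover v tm_empty)" using assms(2) by (auto simp: Null_def)
  have wf: "wfc \<Gamma>" by (rule tj_wfc[OF v(1)])
  let ?G = "Lam (cover (Var 0) tm_empty)"
  have G: "sub \<Gamma> ?G" by (rule fam_Lam[OF isset_S[OF wf] isset_null_body[OF wf]])
  have eq: "eqj \<Gamma> (App ?G a) (cover a tm_empty) TSet" if "el \<Gamma> a" for a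
    using eqj_beta_set[OF isset_null_body[OF wf] that] by simp
  have "tr \<Gamma> (App ?G u)"
    by (rule tr_transport[OF isset_S[OF wf] G assms(1) v(1) tr_conv[OF assms(3) eqj_single[OF v(1) assms(1)]]
          tr_conv[OF v(2) eqj_sym[OF eq[OF v(1)]]]])
  from tr_conv[OF this eq[OF assms(1)]] show ?thesis using assms(1) by (simp add: Null_def)
qed

lemma Null_cover:
  assumes K: "sub \<Gamma> K" and a: "el \<Gamma> a" "tr \<Gamma> (cover a K)"
    and null: "\<And>\<Delta> s u. mor \<Delta> s \<Gamma> \<Longrightarrow> el \<Delta> u \<Longrightarrow> tr \<Delta> (App (subst_tm s K) u) \<Longrightarrow> Null \<Delta> u"
  shows "Null \<Gamma> a"
proof -
  have E: "sub \<Gamma> tm_empty" by (rule sub_empty[OF tj_wfc[OF K]])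
  have "tr \<Gamma> (cover_all K tm_empty)"
    by (rule tr_covers_I[OF K E]) (use null in \<open>auto simp: Null_def\<close>)
  from tr_cover_trans[OF K E a this] a(1) show ?thesis by (simp add: Null_def)
qed

lemma Null_below:
  assumes K: "sub \<Gamma> K" and d: "el \<Gamma> d" "tr \<Gamma> (below K d)"
    and null: "\<And>v. el \<Gamma> v \<Longrightarrow> tr \<Gamma> (App K v) \<Longrightarrow> Null \<Gamma> v"
  shows "Null \<Gamma> d"
proof -
  obtain v where v: "el \<Gamma> v" "tr \<Gamma> (App K v)" "tr \<Gamma> (cover d (single v))"
    using tr_below_E[OF K d] .
  show ?thesis
  proof (rule Null_cover[OF sub_single[OF v(1)] d(1) v(3)])
    fix \<Delta> s u assume s: "mor \<Delta> s \<Gamma>" and u: "el \<Delta> u" "tr \<Delta> (App (subst_tm s (single v)) u)"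
    show "Null \<Delta> u"
      by (rule Null_single[OF u(1) Null_subst[OF null[OF v(1,2)] s]]) (use u(2) in simp)
  qed
qed

lemma tr_below_self:
  assumes K: "sub \<Gamma> K" and v: "el \<Gamma> v" "tr \<Gamma> (App K v)"
  shows "tr \<Gamma> (below K v)"
  by (rule tr_below_I[OF K v(1) v])
    (rule tr_cover_refl[OF sub_single[OF v(1)] v(1) tr_single_self[OF v(1)]])

lemma Null_compl_member:
  assumes K: "sub \<Gamma> K" and v: "el \<Gamma> v" "tr \<Gamma> (App (compl K) v)" "tr \<Gamma> (App K v)"
  shows "Null \<Gamma> v"
  unfolding Null_def
  by (intro HOL.conjI v(1) tr_compl_E[OF K v(1,2,1)] tr_below_self[OF K v(1,3)]
      tr_below_self[OF sub_single[OF v(1)] v(1) tr_single_self[OF v(1)]])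

lemma tr_compl_null:
  assumes K: "sub \<Gamma> K" and a: "el \<Gamma> a"
    and null: "\<And>\<Delta> s v. mor \<Delta> s \<Gamma> \<Longrightarrow> el \<Delta> v \<Longrightarrow> tr \<Delta> (App (subst_tm s K) v) \<Longrightarrow> Null \<Delta> v"
  shows "tr \<Gamma> (App (compl K) a)"
proof (rule tr_compl_I[OF K a])
  fix \<Delta> s d assume s: "mor \<Delta> s \<Gamma>" and d: "el \<Delta> d" "tr \<Delta> (below (subst_tm s K) d)"
  from Null_below[OF sub_subst[OF K s] d null[OF s]]
  show "tr \<Delta> (cover d tm_empty)" by (simp add: Null_def)
qed

text \<open>Every point lies in K** as soon as K* is null. Subsets are propositional functions, so
  reflexivity applies to K** itself.\<close>

lemma tr_dneg_dense:
  assumes K: "sub \<Gamma> K" and a: "el \<Gamma> a"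
    and null: "\<And>\<Delta> s v. mor \<Delta> s \<Gamma> \<Longrightarrow> el \<Delta> v \<Longrightarrow> tr \<Delta> (App (compl (subst_tm s K)) v) \<Longrightarrow> Null \<Delta> v"
  shows "tr \<Gamma> (dneg a K)"
  unfolding tm_dneg_def
proof (rule tr_covers_I)
  show "sub \<Gamma> (compl (compl (single a)))" "sub \<Gamma> (compl (compl K))"
    by (intro sub_compl sub_single a K)+
  fix \<Delta> s u assume s: "mor \<Delta> s \<Gamma>" and u: "el \<Delta> u"
  have K': "sub \<Delta> (compl (subst_tm s K))" by (intro sub_compl sub_subst[OF K s])
  have "tr \<Delta> (App (compl (compl (subst_tm s K))) u)"
  proof (rule tr_compl_null[OF K' u])
    fix \<Theta> t v assume "mor \<Theta> t \<Delta>" "el \<Theta> v" "tr \<Theta> (App (subst_tm t (compl (subst_tm s K))) v)"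
    then show "Null \<Theta> v" using null[OF mor_comp[OF _ s]] by (simp add: subst_tm_subst)
  qed
  from tr_cover_refl[OF sub_compl[OF K'] u this]
  show "tr \<Delta> (cover u (subst_tm s (compl (compl K))))" by simp
qed

text \<open>The argument of \<open>sem_dneg_null\<close>: a lies in {a}**, and a point of K** lies
  in K* too once K is null.\<close>

lemma Null_dneg:
  assumes K: "sub \<Gamma> K" and a: "el \<Gamma> a" and *: "tr \<Gamma> (dneg a K)"
    and null: "\<And>\<Delta> s v. mor \<Delta> s \<Gamma> \<Longrightarrow> el \<Delta> v \<Longrightarrow> tr \<Delta> (App (subst_tm s K) v) \<Longrightarrow> Null \<Delta> v"
  shows "Null \<Gamma> a"
proof -
  have sa: "sub \<Gamma> (compl (single a))" by (intro sub_compl sub_single a)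
  have "tr \<Gamma> (App (compl (compl (single a))) a)"
  proof (rule tr_compl_I[OF sa a])
    fix \<Delta> s d assume s: "mor \<Delta> s \<Gamma>" and d: "el \<Delta> d" "tr \<Delta> (below (single (subst_tm s a)) d)"
      and "tr \<Delta> (below (subst_tm s (compl (single a))) d)"
    then have b: "tr \<Delta> (below (compl (single (subst_tm s a))) d)" by simp
    have a': "el \<Delta> (subst_tm s a)" by (rule el_subst[OF a s])
    obtain v where v: "el \<Delta> v" "tr \<Delta> (App (compl (single (subst_tm s a))) v)" "tr \<Delta> (cover d (single v))"
      using tr_below_E[OF sub_compl[OF sub_single[OF a']] d(1) b] .
    show "tr \<Delta> (cover d tm_empty)"
      by (rule tr_compl_E[OF sub_single[OF a'] v(1,2) d(1) tr_below_I[OF sub_single[OF v(1)] d(1) v(1)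
              tr_single_self[OF v(1)] v(3)] d(2)])
  qed
  then have "tr \<Gamma> (cover a (compl (compl K)))"
    by (rule tr_covers_E[OF sub_compl[OF sa] sub_compl[OF sub_compl[OF K]] *[unfolded tm_dneg_def] a])
  then show ?thesis
  proof (rule Null_cover[OF sub_compl[OF sub_compl[OF K]] a])
    fix \<Delta> s u assume s: "mor \<Delta> s \<Gamma>" and u: "el \<Delta> u" "tr \<Delta> (App (subst_tm s (compl (compl K))) u)"
    have K': "sub \<Delta> (subst_tm s K)" by (rule sub_subst[OF K s])
    have "tr \<Delta> (App (compl (subst_tm s K)) u)"
    proof (rule tr_compl_null[OF K' u(1)])
      fix \<Theta> t v assume "mor \<Theta> t \<Delta>" "el \<Theta> v" "tr \<Theta> (App (subst_tm t (subst_tm s K)) v)"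
      then show "Null \<Theta> v" using null[OF mor_comp[OF _ s]] by (simp add: subst_tm_subst)
    qed
    then show "Null \<Delta> u" using Null_compl_member[OF sub_compl[OF K'] u(1)] u(2) by simp
  qed
qed

text \<open>The subset belonging to P is a term with P as a parameter, and nullity occurs in it as a
  proposition, with no auxiliary set of null points.\<close>

definition decided_set :: "tm \<Rightarrow> tm" where
  "decided_set P = Lam (tm_decided (lift P) (cover (Var 0) tm_empty))"

lemma subst_decided_set [simp]: "subst_tm s (decided_set P) = decided_set (subst_tm s P)"
  by (simp add: decided_set_def)

lemma isset_decided_set_body:
  assumes "isset \<Gamma> P"
  shows "isset (TEl S # \<Gamma>) (tm_decided (lift P) (cover (Var 0) tm_empty))"
proof -
  have wf: "wfc \<Gamma>" by (rule tj_wfc[OF assms])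
  show ?thesis by (intro isset_decided isset_lift assms wfc_S isset_null_body wf)
qed

lemma sub_decided_set: "isset \<Gamma> P \<Longrightarrow> sub \<Gamma> (decided_set P)"
  unfolding decided_set_def by (intro fam_Lam isset_S isset_decided_set_body) (auto intro: tj_wfc)

lemma eqj_decided_set: "isset \<Gamma> P \<Longrightarrow> el \<Gamma> x \<Longrightarrow>
    eqj \<Gamma> (App (decided_set P) x) (tm_decided P (cover x tm_empty)) TSet"
  using eqj_beta_set[OF isset_decided_set_body, of \<Gamma> P x] by (simp add: decided_set_def)

lemma Null_compl_decided_set:
  assumes P: "isset \<Gamma> P" and v: "el \<Gamma> v" "tr \<Gamma> (App (compl (decided_set P)) v)"
  shows "Null \<Gamma> v"
proof -
  \<comment> \<open>Needed at two stages: where P has been assumed, and at the identity morphism for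
    the final step.\<close>
  have member: "Null \<Delta> (subst_tm s v)"
    if s: "mor \<Delta> s \<Gamma>" and d: "tr \<Delta> (tm_decided (subst_tm s P) (cover (subst_tm s v) tm_empty))" for \<Delta> s
  proof (rule Null_compl_member)
    show v': "el \<Delta> (subst_tm s v)" by (rule el_subst[OF v(1) s])
    have P': "isset \<Delta> (subst_tm s P)" by (rule isset_subst[OF P s])
    show "sub \<Delta> (decided_set (subst_tm s P))" by (rule sub_decided_set[OF P'])
    show "tr \<Delta> (App (compl (decided_set (subst_tm s P))) (subst_tm s v))"
      using tr_subst[OF v(2) s] by simp
    show "tr \<Delta> (App (decided_set (subst_tm s P)) (subst_tm s v))"
      by (rule tr_conv[OF d eqj_sym[OF eqj_decided_set[OF P' v']]])
  qed
  have wf: "wfc \<Gamma>" by (rule tj_wfc[OF P])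
  have "tr \<Gamma> (Imp P (cover v tm_empty))"
  proof (rule tr_Imp_I[OF P isset_null[OF v(1)]])
    fix \<Delta> s assume s: "mor \<Delta> s \<Gamma>" and p: "tr \<Delta> (subst_tm s P)"
    have "Null \<Delta> (subst_tm s v)"
      by (rule member[OF s tr_decided_true[OF isset_subst[OF P s] isset_null[OF el_subst[OF v(1) s]] p]])
    then show "tr \<Delta> (subst_tm s (cover v tm_empty))" by (simp add: Null_def)
  qed
  then have "tr \<Gamma> (tm_decided P (cover v tm_empty))" by (rule tr_decided_imp[OF P isset_null[OF v(1)]])
  then show ?thesis using member[OF mor_Var[OF wf]] by simp
qed

lemma subst_subset [simp]: "subst_tm s (tm_subset S U V) = tm_subset S (subst_tm s U) (subst_tm s V)"
  by (simp add: tm_subset_def)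

lemma isset_subset_body:
  assumes "sub \<Gamma> U" "sub \<Gamma> V"
  shows "isset (TEl S # \<Gamma>) (Imp (App (lift U) (Var 0)) (App (lift V) (Var 0)))"
proof -
  have wf: "wfc \<Gamma>" by (rule tj_wfc[OF assms(1)])
  note lifted = sub_lift[OF assms(1) wfc_S[OF wf]] sub_lift[OF assms(2) wfc_S[OF wf]]
  show ?thesis by (intro isset_Imp fam_app[OF lifted(1)] fam_app[OF lifted(2)] el_Var0' wf)
qed

lemma isset_subset: "sub \<Gamma> U \<Longrightarrow> sub \<Gamma> V \<Longrightarrow> isset \<Gamma> (tm_subset S U V)"
  unfolding tm_subset_def by (intro isset_PI fam_Lam isset_S isset_subset_body) (auto intro: tj_wfc)

lemma tr_subset_I:
  assumes U: "sub \<Gamma> U" and V: "sub \<Gamma> V"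
    and *: "\<And>\<Delta> s u. mor \<Delta> s \<Gamma> \<Longrightarrow> el \<Delta> u \<Longrightarrow> tr \<Delta> (App (subst_tm s U) u) \<Longrightarrow> tr \<Delta> (App (subst_tm s V) u)"
  shows "tr \<Gamma> (tm_subset S U V)"
  unfolding tm_subset_def
proof (rule tr_All_I[OF isset_S isset_subset_body[OF U V]])
  show "wfc \<Gamma>" by (rule tj_wfc[OF U])
  fix \<Delta> s a assume s: "mor \<Delta> s \<Gamma>" and a: "tj \<Delta> a (TEl (subst_tm s S))"
  then have a: "el \<Delta> a" by simp
  have "tr \<Delta> (Imp (App (subst_tm s U) a) (App (subst_tm s V) a))"
  proof (rule tr_Imp_I)
    show "isset \<Delta> (App (subst_tm s U) a)" by (rule fam_app[OF sub_subst[OF U s] a])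
    show "isset \<Delta> (App (subst_tm s V) a)" by (rule fam_app[OF sub_subst[OF V s] a])
    fix \<Theta> t assume t: "mor \<Theta> t \<Delta>" and "tr \<Theta> (subst_tm t (App (subst_tm s U) a))"
    then show "tr \<Theta> (subst_tm t (App (subst_tm s V) a))"
      using *[OF mor_comp[OF t s] el_subst[OF a t]] by (simp add: subst_tm_subst)
  qed
  then show "tr \<Delta> (subst_tm (case_nat a s) (Imp (App (lift U) (Var 0)) (App (lift V) (Var 0))))"
    by simp
qed

lemma tr_subset_E:
  assumes U: "sub \<Gamma> U" and V: "sub \<Gamma> V" and "tr \<Gamma> (tm_subset S U V)" and u: "el \<Gamma> u" "tr \<Gamma> (App U u)"
  shows "tr \<Gamma> (App V u)"
proof -
  have "tr \<Gamma> (Imp (App U u) (App V u))"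
    using tr_All_E[OF isset_S[OF tj_wfc[OF U]] isset_subset_body[OF U V] assms(3)[unfolded tm_subset_def] u(1)] by simp
  then show ?thesis
    by (rule tr_Imp_E[OF fam_app[OF U u(1)] fam_app[OF V u(1)] _ u(2)])
qed

lemma isset_dneg: "el \<Gamma> a \<Longrightarrow> sub \<Gamma> U \<Longrightarrow> isset \<Gamma> (dneg a U)"
  unfolding tm_dneg_def by (intro isset_covers sub_compl sub_single)

lemma subst_dneg [simp]: "subst_tm s (dneg a U) = dneg (subst_tm s a) (subst_tm s U)"
  by (simp add: tm_dneg_def)

text \<open>The double negation cover is given to the presentation as a closed abstraction; two beta
  steps reduce its value at a and U to the proposition reasoned about.\<close>

lemma eqj_dneg:
  assumes a: "el \<Gamma> a" and U: "sub \<Gamma> U"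
  shows "eqj \<Gamma> (App (App (Lam (Lam (dneg (Var 1) (Var 0)))) a) U) (dneg a U) TSet"
proof -
  have wf: "wfc \<Gamma>" by (rule tj_wfc[OF a])
  have wf1: "wfc (TEl S # \<Gamma>)" by (rule wfc_S[OF wf])
  have wf2: "wfc (TFun (TEl S) TSet # TEl S # \<Gamma>)" by (rule wfc_fam[OF isset_S[OF wf1]])
  have wf2': "wfc (TFun (TEl S) TSet # \<Gamma>)" by (rule wfc_fam[OF isset_S[OF wf]])
  have 2: "isset (TFun (TEl S) TSet # TEl S # \<Gamma>) (dneg (Var 1) (Var 0))"
    by (rule isset_dneg; rule tj_Var[OF wf2]) simp_all
  have 1: "isset (TFun (TEl S) TSet # \<Gamma>) (dneg (lift a) (Var 0))"
    by (rule isset_dneg[OF el_lift'[OF a wf2']]; rule tj_Var[OF wf2']) simp_all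
  have "eqj \<Gamma> (App (Lam (Lam (dneg (Var 1) (Var 0)))) a) (Lam (dneg (lift a) (Var 0)))
      (TFun (TFun (TEl S) TSet) TSet)"
    by (rule eqj_beta[OF tj_abs[OF wf1 2] a]) simp_all
  then have "eqj \<Gamma> (App (App (Lam (Lam (dneg (Var 1) (Var 0)))) a) U) (App (Lam (dneg (lift a) (Var 0))) U) TSet"
    by (rule eqj_app[OF _ eqj_refl[OF U]]) simp
  moreover have "eqj \<Gamma> (App (Lam (dneg (lift a) (Var 0))) U) (dneg a U) TSet"
    by (rule eqj_beta[OF 1 U]) simp_all
  ultimately show ?thesis by (rule eqj_trans)
qed

end

section \<open>Collapse of a set-presented double negation space in CTT\<close>

definition tm_presented :: "tm \<Rightarrow> tm \<Rightarrow> tm \<Rightarrow> tm \<Rightarrow> tm \<Rightarrow> tm" where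
  "tm_presented S I D a U = SIG' (App I a) (Lam (tm_subset S (App (App D (lift a)) (Var 0)) (lift U)))"

locale ctt_presented_dneg = ctt_space +
  fixes I D :: tm
  assumes GUP: "GUP_CTT \<subseteq> R"
    and closed_presentation: "closed_tm I" "closed_tm D"
    and I0: "tj [] I (TFun (TEl S) TSet)"
    and D0: "tj [] D (TFun (TEl S) (TFun (TEl (App I (Var 0))) (TFun (TEl S) TSet)))"
    and presented0: "\<exists>t. der R ([], HasType t (TFun (TEl S) (TFun (TFun (TEl S) TSet) (TEl
      (And (Imp (App (App (Lam (Lam (tm_dneg S C (Var 1) (Var 0)))) (Var 1)) (Var 0)) (tm_presented S I D (Var 1) (Var 0)))
           (Imp (tm_presented S I D (Var 1) (Var 0)) (App (App (Lam (Lam (tm_dneg S C (Var 1) (Var 0)))) (Var 1)) (Var 0))))))))"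
begin

lemma closed_presentation_simps [simp]:
  "subst_tm s I = I" "subst_tm s D = D" "ren_tm f I = I" "ren_tm f D = D"
  by (simp_all add: closed_presentation subst_tm_closed ren_tm_closed)

lemma subst_presented [simp]:
  "subst_tm s (tm_presented S I D a U) = tm_presented S I D (subst_tm s a) (subst_tm s U)"
  by (simp add: tm_presented_def)

lemma isset_I: "el \<Gamma> a \<Longrightarrow> isset \<Gamma> (App I a)"
  by (rule tj_app, rule tj_subst[OF I0 mor_Nil, of _ Var, simplified]) (auto intro: tj_wfc)

lemma sub_D: "el \<Gamma> a \<Longrightarrow> tj \<Gamma> i (TEl (App I a)) \<Longrightarrow> sub \<Gamma> (App (App D a) i)"
  by ((rule tj_app)+, rule tj_subst[OF D0 mor_Nil, of _ Var, simplified]) (auto intro: tj_wfc)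

lemma isset_presented_body:
  assumes "el \<Gamma> a" "sub \<Gamma> U"
  shows "isset (TEl (App I a) # \<Gamma>) (tm_subset S (App (App D (lift a)) (Var 0)) (lift U))"
proof -
  have wf: "wfc (TEl (App I a) # \<Gamma>)" by (rule wfc_El[OF isset_I[OF assms(1)]])
  show ?thesis
    using el_Var0[OF isset_I[OF assms(1)]] by (intro isset_subset sub_D el_lift' sub_lift assms wf) simp
qed

lemma isset_presented: "el \<Gamma> a \<Longrightarrow> sub \<Gamma> U \<Longrightarrow> isset \<Gamma> (tm_presented S I D a U)"
  unfolding tm_presented_def by (intro isset_SIG fam_Lam isset_I isset_presented_body)

lemma tr_presented_I:
  assumes "el \<Gamma> a" "sub \<Gamma> U" "tj \<Gamma> i (TEl (App I a))" "tr \<Gamma> (tm_subset S (App (App D a) i) U)"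
  shows "tr \<Gamma> (tm_presented S I D a U)"
  unfolding tm_presented_def
  by (rule tr_Ex_I[OF isset_I[OF assms(1)] isset_presented_body[OF assms(1,2)] assms(3)]) (simp add: assms(4))

lemma tr_presented_iff:
  assumes a: "el \<Gamma> a" and U: "sub \<Gamma> U"
  shows "tr \<Gamma> (tm_presented S I D a U) \<longleftrightarrow> tr \<Gamma> (dneg a U)"
proof -
  have wf: "wfc \<Gamma>" by (rule tj_wfc[OF a])
  let ?N = "Lam (Lam (dneg (Var 1) (Var 0)))"
  let ?T = "\<lambda>a U. And (Imp (App (App ?N a) U) (tm_presented S I D a U)) (Imp (tm_presented S I D a U) (App (App ?N a) U))"
  have eq: "eqj \<Gamma> (App (App ?N a) U) (dneg a U) TSet" by (rule eqj_dneg[OF a U])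
  have T_subst: "subst_tm s (?T b V) = ?T (subst_tm s b) (subst_tm s V)" for s b V
    by simp
  obtain t where "der R ([], HasType t (TFun (TEl S) (TFun (TFun (TEl S) TSet) (TEl (?T (Var 1) (Var 0))))))"
    using presented0 by blast
  then have "tj [] t (TFun (TEl S) (TFun (TFun (TEl S) TSet) (TEl (?T (Var 1) (Var 0)))))"
    by (simp add: tj_def wfc_Nil)
  from tj_subst[OF this mor_Nil[OF wf, of Var]]
  have "tj \<Gamma> (subst_tm Var t) (TFun (TEl S) (TFun (TFun (TEl S) TSet) (TEl (?T (Var 1) (Var 0)))))"
    by (simp only: subst_ty_Var)
  then have "tj \<Gamma> (App (subst_tm Var t) a) (TFun (TFun (TEl S) TSet) (TEl (?T (lift a) (Var 0))))"
    by (rule tj_app[OF _ a]) (simp only: subst_ty.simps T_subst, simp)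
  then have "tj \<Gamma> (App (App (subst_tm Var t) a) U) (TEl (?T a U))"
    by (rule tj_app[OF _ U]) (simp only: subst_ty.simps T_subst, simp)
  then have *: "tr \<Gamma> (?T a U)" by (auto simp: tr_def)
  have N: "isset \<Gamma> (App (App ?N a) U)"
  proof -
    have wf1: "wfc (TEl S # \<Gamma>)" by (rule wfc_S[OF wf])
    have wf2: "wfc (TFun (TEl S) TSet # TEl S # \<Gamma>)" by (rule wfc_fam[OF isset_S[OF wf1]])
    have "tj \<Gamma> ?N (TFun (TEl S) (TFun (TFun (TEl S) TSet) TSet))"
      by (intro tj_abs wf wf1 isset_dneg; rule tj_Var[OF wf2]) simp_all
    then have "tj \<Gamma> (App ?N a) (TFun (TFun (TEl S) TSet) TSet)" by (rule tj_app[OF _ a]) simp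
    then show ?thesis by (rule tj_app[OF _ U]) simp
  qed
  note Pr = isset_presented[OF a U]
  note both = tr_And_E[OF isset_Imp[OF N Pr] isset_Imp[OF Pr N] *]
  show ?thesis
    using tr_Imp_E[OF N Pr both(1)] tr_Imp_E[OF Pr N both(2)] tr_conv eq eqj_sym[OF eq] by blast
qed

lemma Null_everything:
  assumes a: "el \<Gamma> a"
  shows "Null \<Gamma> a"
proof -
  have wf: "wfc \<Gamma>" by (rule tj_wfc[OF a])
  \<comment> \<open>The new variable of type \<open>TSet\<close> is the generic proposition
    P.\<close>
  have wf1: "wfc (TSet # \<Gamma>)" by (rule wfc_SET[OF wf])
  have P: "isset (TSet # \<Gamma>) (Var 0)" using tj_Var0[OF wf1] by simp
  have U: "sub (TSet # \<Gamma>) (decided_set (Var 0))" by (rule sub_decided_set[OF P])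
  have a1: "el (TSet # \<Gamma>) (lift a)" by (rule el_lift'[OF a wf1])
  have "tr (TSet # \<Gamma>) (dneg (lift a) (decided_set (Var 0)))"
  proof (rule tr_dneg_dense[OF U a1])
    fix \<Delta> s v assume s: "mor \<Delta> s (TSet # \<Gamma>)" and v: "el \<Delta> v"
      and "tr \<Delta> (App (compl (subst_tm s (decided_set (Var 0)))) v)"
    then show "Null \<Delta> v" using Null_compl_decided_set[OF isset_subst[OF P s] v] by simp
  qed
  then have pres: "tr (TSet # \<Gamma>) (tm_presented S I D (lift a) (decided_set (Var 0)))"
    by (simp add: tr_presented_iff[OF a1 U])
  \<comment> \<open>Variable 0 is the index and variable 1 the proposition. Since \<open>D\<close>
    and \<open>decided_set\<close> are terms, uniformity applies directly to the index set
    \<open>App I a\<close> and to the inclusion as it stands.\<close>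
  let ?Q = "tm_subset S (App (App D (lift (lift a))) (Var 0)) (lift (decided_set (Var 0)))"
  have Q: "isset (TEl (lift (App I a)) # TSet # \<Gamma>) ?Q"
    using isset_presented_body[OF a1 U] by simp
  have "tr (TSet # \<Gamma>) (SIG' (lift (App I a)) (Lam ?Q))"
    using pres by (simp add: tm_presented_def)
  then obtain i where i: "tj \<Gamma> i (TEl (App I a))" and "tr (TSet # \<Gamma>) (subst_tm (sub1 (lift i)) ?Q)"
    by (rule tr_GUP[OF GUP isset_I[OF a] Q])
  then have V1: "tr (TSet # \<Gamma>) (tm_subset S (App (App D (lift a)) (lift i)) (decided_set (Var 0)))"
    by simp
  let ?V = "App (App D a) i" and ?Z = "Lam (cover (Var 0) tm_empty)"
  have V: "sub \<Gamma> ?V" by (rule sub_D[OF a i])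
  have Z: "sub \<Gamma> ?Z" if "wfc \<Gamma>" for \<Gamma>
    by (rule fam_Lam[OF isset_S[OF that] isset_null_body[OF that]])
  have Z_eq: "eqj \<Gamma> (App ?Z x) (cover x tm_empty) TSet" if "el \<Gamma> x" for \<Gamma> x
    using eqj_beta_set[OF isset_null_body[OF tj_wfc[OF that]] that] by simp
  have "tr \<Gamma> (tm_subset S ?V ?Z)"
  proof (rule tr_subset_I[OF V Z[OF wf]])
    fix \<Delta> s x assume s: "mor \<Delta> s \<Gamma>" and x: "el \<Delta> x" "tr \<Delta> (App (subst_tm s ?V) x)"
    have wfD: "wfc (TSet # \<Delta>)" by (rule wfc_SET[OF mor_wfc[OF s]])
    have P': "isset (TSet # \<Delta>) (Var 0)" using tj_Var0[OF wfD] by simp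
    have "mor (TSet # \<Delta>) (\<lambda>i. lift (s i)) \<Gamma>" using mor_comp[OF mor_lift[OF wfD] s] by simp
    \<comment> \<open>The proposition variable is kept and the rest of the context moves to the
      later stage, so x is again decided for a generic proposition.\<close>
    then have "mor (TSet # \<Delta>) (case_nat (Var 0) (\<lambda>i. lift (s i))) (TSet # \<Gamma>)"
      by (rule mor_cons) (use P' in simp)
    from tr_subst[OF V1 this]
    have "tr (TSet # \<Delta>) (tm_subset S (lift (subst_tm s ?V)) (decided_set (Var 0)))"
      by (simp add: ren_tm_subst_tm)
    moreover have "tr (TSet # \<Delta>) (App (lift (subst_tm s ?V)) (lift x))"
      using tr_lift[OF x(2) wfD] by simp
    ultimately have "tr (TSet # \<Delta>) (App (decided_set (Var 0)) (lift x))"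
      by (rule tr_subset_E[OF sub_lift[OF sub_subst[OF V s] wfD] sub_decided_set[OF P'] _ el_lift'[OF x(1) wfD]])
    then have "tr (TSet # \<Delta>) (tm_decided (Var 0) (lift (cover x tm_empty)))"
      using tr_conv[OF _ eqj_decided_set[OF P' el_lift'[OF x(1) wfD]]] by simp
    then have "tr \<Delta> (cover x tm_empty)" by (rule tr_decided_uniform[OF GUP isset_null[OF x(1)]])
    then show "tr \<Delta> (App (subst_tm s ?Z) x)"
      using tr_conv[OF _ eqj_sym[OF Z_eq[OF x(1)]]] by simp
  qed
  then have "tr \<Gamma> (tm_presented S I D a ?Z)" by (rule tr_presented_I[OF a Z[OF wf] i])
  then have "tr \<Gamma> (dneg a ?Z)" by (simp only: tr_presented_iff[OF a Z[OF wf]])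
  then show ?thesis
  proof (rule Null_dneg[OF Z[OF wf] a])
    fix \<Delta> s v assume "el \<Delta> v" "tr \<Delta> (App (subst_tm s ?Z) v)"
    then show "Null \<Delta> v" using tr_conv[OF _ Z_eq] by (simp add: Null_def)
  qed
qed

lemma tr_FALSE:
  assumes "tr [] (Imp (cover_all (Lam UNIT) tm_empty) FALSE)"
  shows "tr [] FALSE"
proof -
  have full: "sub [] (Lam UNIT)"
    by (intro fam_Lam isset_S isset_Fin wfc_S wfc_Nil)
  have E: "sub [] tm_empty" by (rule sub_empty[OF wfc_Nil])
  have "tr [] (cover_all (Lam UNIT) tm_empty)"
    by (rule tr_covers_I[OF full E]) (use Null_everything in \<open>auto simp: Null_def\<close>)
  then show ?thesis by (rule tr_Imp_E[OF isset_covers[OF full E] isset_Fin[OF wfc_Nil] assms])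
qed

end

lemmas tm_defs = tm_cover_def tm_covers_def tm_single_def tm_below_def tm_down_def tm_empty_def
  tm_compl_def tm_subset_def tm_dneg_def tm_presented_def Imp_def And_def

lemmas ctt_hoas_defs = hoas_ty_defs tAll_def tEx_def tImp_def tAnd_def tFalse_def tSub_def tEmpty_def tFull_def
  tSingle_def tSubset_def tCovers_def tDown_def tPseudocompl_def tDneg_cover_def

theorem dneg_not_presented_CTT:
  assumes consistent: "consistent_CTT_ext (R \<union> GUP_CTT)"
    and space: "ctt_formal_space R S C" and nontrivial: "ctt_nontrivial R S C"
  shows "\<not> ctt_set_presented R S (ctt_dneg S C)"
proof
  let ?R = "R \<union> GUP_CTT"
  assume "ctt_set_presented R S (ctt_dneg S C)"
  then obtain I D where ID: "closed_tm I" "closed_tm D"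
    and I: "der R ([], HasType I ((El (\<lambda>n. S) \<^bold>\<rightarrow> SET) 0))"
    and D: "der R ([], HasType D ((\<^bold>\<Pi>x\<^bold>:El (\<lambda>n. S). El ((\<lambda>n. I) \<cdot> x) \<^bold>\<rightarrow> tSub (\<lambda>n. S)) 0))"
    and pres: "proves_type R (\<^bold>\<Pi>a\<^bold>:El (\<lambda>n. S). \<^bold>\<Pi>U\<^bold>:tSub (\<lambda>n. S).
        El (((\<lambda>n. ctt_dneg S C) \<cdot> a \<cdot> U \<^bold>\<supset> tEx ((\<lambda>n. I) \<cdot> a) (\<lambda>i. tSubset (\<lambda>n. S) ((\<lambda>n. D) \<cdot> a \<cdot> i) U)) \<^bold>&
            (tEx ((\<lambda>n. I) \<cdot> a) (\<lambda>i. tSubset (\<lambda>n. S) ((\<lambda>n. D) \<cdot> a \<cdot> i) U) \<^bold>\<supset> (\<lambda>n. ctt_dneg S C) \<cdot> a \<cdot> U)))"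
    unfolding ctt_set_presented_def Let_def by blast
  from space have SC: "closed_tm S" "closed_tm C" by (simp_all add: ctt_formal_space_def Let_def)
  note [simp] = ren_tm_closed[OF SC(1)] ren_tm_closed[OF SC(2)] ren_tm_closed[OF ID(1)] ren_tm_closed[OF ID(2)]
    subst_tm_closed[OF SC(1)] subst_tm_closed[OF SC(2)] subst_tm_closed[OF ID(1)] subst_tm_closed[OF ID(2)]
  \<comment> \<open>All derivations in R are transferred to the extension by the uniformity
    constants, which is the one assumed consistent.\<close>
  have mono: "der R J \<Longrightarrow> der ?R J" for J by (rule der_mono) auto
  have wf: "ctt_rules.wfc ?R []" by (rule ctt_rules.wfc_Nil)
  \<comment> \<open>A literal equality of terms, because the closed S and C are unaffected by the
    binders around them.\<close>
  have dneg: "ctt_dneg S C = Lam (Lam (tm_dneg S C (Var 1) (Var 0)))"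
    by (simp add: ctt_dneg_def ctt_hoas_defs tm_defs)
  interpret ctt_presented_dneg ?R S C I D
  proof unfold_locales
    show "closed_tm S" "closed_tm C" "closed_tm I" "closed_tm D" by (simp_all add: SC ID)
    show "GUP_CTT \<subseteq> ?R" by simp
    show "ctt_rules.tj ?R [] S TSet" "ctt_rules.tj ?R [] C (TFun (TEl S) (TFun (TFun (TEl S) TSet) TSet))"
      using space by (auto simp: ctt_formal_space_def Let_def ctt_hoas_defs ctt_rules.tj_def wf mono)
    show "ctt_rules.tj ?R [] I (TFun (TEl S) TSet)"
      "ctt_rules.tj ?R [] D (TFun (TEl S) (TFun (TEl (App I (Var 0))) (TFun (TEl S) TSet)))"
      using I D by (auto simp: ctt_hoas_defs ctt_rules.tj_def wf mono)
    have "proves_type R (\<^bold>\<Pi>a\<^bold>:El (\<lambda>n. S). \<^bold>\<Pi>U\<^bold>:tSub (\<lambda>n. S). El (U \<cdot> a \<^bold>\<supset> (\<lambda>n. C) \<cdot> a \<cdot> U))"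
      using space by (simp add: ctt_formal_space_def Let_def)
    then show "\<exists>t. der ?R ([], HasType t (TFun (TEl S) (TFun (TFun (TEl S) TSet)
        (TEl (Imp (App (Var 0) (Var 1)) (tm_cover C (Var 1) (Var 0)))))))"
      by (auto simp: proves_type_def ctt_hoas_defs tm_defs eval_nat_numeral dest: mono)
    have "proves_type R (\<^bold>\<Pi>a\<^bold>:El (\<lambda>n. S). \<^bold>\<Pi>U\<^bold>:tSub (\<lambda>n. S). \<^bold>\<Pi>V\<^bold>:tSub (\<lambda>n. S).
        El ((\<lambda>n. C) \<cdot> a \<cdot> U \<^bold>\<supset> tCovers (\<lambda>n. S) (\<lambda>n. C) U V \<^bold>\<supset> (\<lambda>n. C) \<cdot> a \<cdot> V))"
      using space by (simp add: ctt_formal_space_def Let_def)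
    then show "\<exists>t. der ?R ([], HasType t (TFun (TEl S) (TFun (TFun (TEl S) TSet) (TFun (TFun (TEl S) TSet)
      (TEl (Imp (tm_cover C (Var 2) (Var 1)) (Imp (tm_covers S C (Var 1) (Var 0)) (tm_cover C (Var 2) (Var 0)))))))))"
      by (auto simp: proves_type_def ctt_hoas_defs tm_defs eval_nat_numeral dest: mono)
    show "\<exists>t. der ?R ([], HasType t (TFun (TEl S) (TFun (TFun (TEl S) TSet) (TEl
      (And (Imp (App (App (Lam (Lam (tm_dneg S C (Var 1) (Var 0)))) (Var 1)) (Var 0)) (tm_presented S I D (Var 1) (Var 0)))
           (Imp (tm_presented S I D (Var 1) (Var 0)) (App (App (Lam (Lam (tm_dneg S C (Var 1) (Var 0)))) (Var 1)) (Var 0))))))))"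
      using pres unfolding dneg
      by (auto simp: proves_type_def ctt_hoas_defs tm_defs eval_nat_numeral dest: mono)
  qed
  have "tr [] (Imp (tm_covers S C (Lam UNIT) tm_empty) FALSE)"
    using nontrivial
    by (auto simp: ctt_nontrivial_def Let_def proves_type_def ctt_hoas_defs tm_defs tr_def tj_def wf dest: mono)
  from tr_FALSE[OF this] show False
    using consistent by (auto simp: consistent_CTT_ext_def proves_type_def tr_def tj_def ctt_hoas_defs)
qed

theorem corollary4p5:
  shows "(\<forall>T :: fm set. CZF \<subseteq> T \<and> consistent_CZF_ext (T \<union> GUP_CZF) \<longrightarrow>
      (\<forall>\<sigma> \<delta> :: fm. free_vars \<sigma> \<subseteq> {0} \<and> free_vars \<delta> \<subseteq> {0, 1} \<and>
        proves_of T \<sigma> (\<lambda>S. formal_space S (cover_of \<delta>)) \<and>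
        proves_of T \<sigma> (\<lambda>S. nontrivial S (cover_of \<delta>)) \<longrightarrow>
        \<not> proves_of T \<sigma> (\<lambda>S. set_presented S (dneg_cover S (cover_of \<delta>))))) \<and>
    (\<forall>R :: rule set. consistent_CTT_ext (R \<union> GUP_CTT) \<longrightarrow>
      (\<forall>S C :: tm. ctt_formal_space R S C \<and> ctt_nontrivial R S C \<longrightarrow>
        \<not> ctt_set_presented R S (ctt_dneg S C)))"
  using dneg_not_presented_CZF dneg_not_presented_CTT by blast

end
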